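(* Let $(E,\nabla)$ be an irreducible algebraic connection on a Zariski open subset of the affine line $\mathbb A^1=\mathbb C$, which is not a rank $1$ connection with only a singularity at infinity of order less than two. Let $(\breve\Theta,\breve{\mathcal C})$ be its modified formal data. Then for any $A$ in an open dense subset of $\mathrm{SL}_2(\mathbb C)$, the formal data $A\cdot(\breve\Theta,\breve{\mathcal C})$ only have support at infinity, and the diagram $\Gamma^\infty(A\cdot(\breve\Theta,\breve{\mathcal C}))$ is independent of $A$ (up to relabelling of nodes).
   Context: **Circles.** For $a\in\mathbb P^1$ put $z_a=z-a$ if $a\in\mathbb C$ and $z_\infty=1/z$. An exponential factor at $a$ is a polynomial $q$ without constant term in $z_a^{-1/r}$; with $r\geq1$ minimal, $\mathrm{ram}(q)=r$, $\mathrm{Irr}(q)$ is its degree in $z_a^{-1/r}$, and $\mathrm{slope}(q)=\mathrm{Irr}(q)/\mathrm{ram}(q)$ (slope of $0$ is $0$). Its Galois conjugates are obtained by $z_a^{1/r}\mapsto\omega z_a^{1/r}$, $\omega^r=1$; the circle $\langle q\rangle_a$ is its Galois orbit, seen as a connected $r$-fold cover of the circle $\partial_a$ of real directions at $a$ (formed by the branches of $q$); $\langle0\rangle_a$ is the tame circle. $\mathcal I_a\to\partial_a$ is the disjoint union of all circles at $a$. **(Modified) formal data.** By the Turrittin–Levelt theorem, the formalization of $(E,\nabla)$ at $a$ is equivalent to an $\mathcal I_a$-graded local system of vector spaces on $\partial_a$, whose circles with nonzero part are those with a factor $e^{q}$ occurring in the formal horizontal sections. The part graded by $\langle q\rangle_a$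 is a local system on the circle $\langle q\rangle_a$ of some rank $n_{\langle q\rangle}$ (multiplicity), with monodromy conjugacy class $\mathcal C_{\langle q\rangle}$ (formal monodromy). The modified formal data $(\breve\Theta,\breve{\mathcal C})$ are the collection of multiplicities and classes obtained by keeping those of all circles at infinity and of all irregular circles at finite distance, and replacing, for each tame circle $\langle0\rangle_a$ with $a\neq\infty$ and monodromy $T$, the multiplicity by $\mathrm{rank}(T-\mathrm{Id})$ and the class by that of $T|_{\mathrm{Im}(T-\mathrm{Id})}$. Active circles are those with nonzero multiplicity; the data have support at infinity if all active circles are at infinity. **The diagram $\Gamma^\infty$** of data with support at infinity. Core nodes: the active circles $\langle q_1\rangle,\dots,\langle q_m\rangle$; with $\beta_i=\mathrm{ram}(q_i)$ and $A_{ij}=\sum\mathrm{slope}(q-q')$ (sum over all pairs of Galois conjugates $q$ of $q_i$, $q'$ of $q_j$), the edge multiplicities are $B_{ij}=A_{ij}-\beta_i\beta_j$ for $i\ne j$ and $B_{ii}=A_{ii}-\beta_i^2+1$. The full diagram is obtained by gluing to each core node $i$ a leg, i.e. a type $A$ graph $v_1-\dots-v_k$ with simple edges, $v_1$ identified with $i$, where $k$ is the degree of the minimal polynomial of the conjugacy class of $i$. **Action of $\mathrm{SL}_2(\mathbb C)$ on circles and modified formal data.** It is generated by elementary transformations: - Twist $T_\mu=\begin{pmatrix}1&\mu\\0&1\end{pmatrix}$: $\langle q\rangle_\infty\mapsto\langle q-\tfrac{\mu}{2}z^2\rangle_\infty$; circles at finite points are fixed. - Scaling $S_\mu=\begin{pmatrix}\mu^{-1}&0\\0&\mu\end{pmatrix}$,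 $\mu\ne 0$: the circle obtained from the change of variable $q(z)\mapsto q(z/\mu)$ (so a circle at $a$ goes to one at $\mu a$). - Fourier transform $F=\begin{pmatrix}0&1\\-1&0\end{pmatrix}$ (Legendre transform, with dual variable $\xi$ then renamed $z$): a circle $\langle q\rangle_\infty$ of slope $>1$, or $\langle q\rangle_a$ with $a\in\mathbb C$, $q\neq0$, goes to $\langle\tilde q\rangle_\infty$ where $\tilde q(\xi)=q(z)-\xi z$ with $z=z(\xi)$ determined by $dq/dz=\xi$ (keeping only positive powers of $\xi$); $\langle0\rangle_a\mapsto\langle-a\xi\rangle_\infty$; $\langle\alpha z\rangle_\infty\mapsto\langle0\rangle_\alpha$; and $\langle\alpha z+q\rangle_\infty$ with $0<\mathrm{slope}(q)<1$ goes to the circle $\langle\tilde q\rangle_\alpha$ at $\xi=\alpha$ given by the polar part of $\alpha z+q(z)-\xi z$ with $\xi=\alpha+dq/dz$. For general $A$, $A\cdot\langle q\rangle$ is obtained by factoring $A$ into elementary transformations (the result does not depend on the factorization). On modified formal data, multiplicities are transported along circles, and formal monodromy classes are transported up to sign and inversion (which does not affect legs): $T_\mu,S_\mu$ leave them unchanged; $F$ multiplies the class of an irregular circle by $(-1)^{\mathrm{Irr}}$ (with $\mathrm{Irr}=\mathrm{Irr}(q)$ for a circle $\langle\alpha z+q\rangle_\infty$ with $\alpha\in\mathbb C$ and $0<\mathrm{slope}(q)<1$), and transports the classes of circles $\langle0\rangle_a$, $\langle\alpha z\rangle_\infty$ via an orientation-reversing identification. *)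

theory Defs
  imports
    "HOL-Complex_Analysis.Laurent_Convergence"
    "HOL-Library.Poly_Mapping"
    "HOL-Library.Groups_Big_Fun"
    "HOL-Library.Function_Algebras"
    "Jordan_Normal_Form.Matrix"
begin

hide_const (open) Matrix.vec Matrix.mat Matrix.row Matrix.col

no_notation Matrix.vec_index (infixl \<open>$\<close> 100)
no_notation fps_nth (infixl \<open>$\<close> 75)

section \<open>Exponential factors and circles\<close>

datatype P1 = Aff complex | Infty

text \<open>
  An exponential factor at a point with local coordinate \<open>x\<close> (that is, \<open>x = z - a\<close> at \<open>Aff a\<close>
  and \<open>x = 1/z\<close> at \<open>Infty\<close>) is encoded by its coefficients:
  \<open>q\<close> stands for the sum over the rationals \<open>e\<close> of \<open>lookup q e * x^(-e)\<close>.
  So at \<open>Infty\<close> the exponent \<open>e\<close> belongs to the monomial \<open>z^e\<close>.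
\<close>

type_synonym expfactor = "rat \<Rightarrow>\<^sub>0 complex"

definition exp_factor :: "expfactor \<Rightarrow> bool" where
  "exp_factor q \<longleftrightarrow> (\<forall>e\<in>Poly_Mapping.keys q. 0 < e)"

definition clears_denominators :: "nat \<Rightarrow> expfactor \<Rightarrow> bool" where
  "clears_denominators r q \<longleftrightarrow> 1 \<le> r \<and> (\<forall>e\<in>Poly_Mapping.keys q. e * of_nat r \<in> \<int>)"

definition ram :: "expfactor \<Rightarrow> nat" where
  "ram q = (LEAST r. clears_denominators r q)"

definition irr :: "expfactor \<Rightarrow> nat" where
  "irr q = (if q = 0 then 0 else nat \<lfloor>Max (Poly_Mapping.keys q) * of_nat (ram q)\<rfloor>)"

definition slope :: "expfactor \<Rightarrow> rat" where
  "slope q = of_nat (irr q) / of_nat (ram q)"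

text \<open>The substitution \<open>x^(1/r) \<mapsto> \<omega> x^(1/r)\<close>, where \<open>r = ram q\<close>.\<close>

definition galois_conj :: "complex \<Rightarrow> expfactor \<Rightarrow> expfactor" where
  "galois_conj \<omega> q = Poly_Mapping.mapp (\<lambda>e c. \<omega> powi (- \<lfloor>e * of_nat (ram q)\<rfloor>) * c) q"

definition galois_orbit :: "expfactor \<Rightarrow> expfactor set" where
  "galois_orbit q = {galois_conj \<omega> q |\<omega>. \<omega> ^ ram q = 1}"

text \<open>A circle is a point together with a Galois orbit of exponential factors at that point.\<close>

type_synonym circle = "P1 \<times> expfactor set"

definition circle_of :: "P1 \<Rightarrow> expfactor \<Rightarrow> circle" where
  "circle_of p q = (p, galois_orbit q)"

definition is_circle :: "circle \<Rightarrow> bool" where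
  "is_circle c \<longleftrightarrow> (\<exists>p q. exp_factor q \<and> c = circle_of p q)"

definition a_representative :: "circle \<Rightarrow> expfactor" where
  "a_representative c = (SOME q. q \<in> snd c)"

definition circle_ram :: "circle \<Rightarrow> nat" where
  "circle_ram c = ram (a_representative c)"


section \<open>Algebraic connections\<close>

text \<open>
  The Zariski open subset of the affine line is the complement of a finite set \<open>S\<close>. Its regular
  functions are normalised to vanish on \<open>S\<close>, so that equality of functions is equality on \<open>- S\<close>.
  Since every algebraic vector bundle on such a curve is trivial, a connection of rank
  \<open>CARD('n)\<close> is \<open>\<nabla> = d - B dz\<close> for a matrix \<open>B\<close> of regular functions;
  its horizontal sections are the solutions of \<open>y' = B y\<close>.
\<close>

definition regular_functions :: "complex set \<Rightarrow> (complex \<Rightarrow> complex) set" where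
  "regular_functions S = {f. \<exists>p q. (\<forall>z. z \<notin> S \<longrightarrow> poly q z \<noteq> 0) \<and>
     f = (\<lambda>z. if z \<in> S then 0 else poly p z / poly q z)}"

definition algebraic_connection :: "complex set \<Rightarrow> (complex \<Rightarrow> complex^'n^'n) \<Rightarrow> bool" where
  "algebraic_connection S B \<longleftrightarrow>
     finite S \<and> (\<forall>i j. (\<lambda>z. B z $ i $ j) \<in> regular_functions S)"

definition sections :: "complex set \<Rightarrow> (complex \<Rightarrow> complex^'n) set" where
  "sections S = {v. \<forall>i. (\<lambda>z. v z $ i) \<in> regular_functions S}"

definition nabla ::
  "complex set \<Rightarrow> (complex \<Rightarrow> complex^'n^'n) \<Rightarrow> (complex \<Rightarrow> complex^'n) \<Rightarrow> complex \<Rightarrow> complex^'n" where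
  "nabla S B v = (\<lambda>z. if z \<in> S then 0 else (\<chi> i. deriv (\<lambda>w. v w $ i) z) - B z *v v z)"

definition subconnection ::
  "complex set \<Rightarrow> (complex \<Rightarrow> complex^'n^'n) \<Rightarrow> (complex \<Rightarrow> complex^'n) set \<Rightarrow> bool" where
  "subconnection S B N \<longleftrightarrow>
     N \<subseteq> sections S \<and> (\<lambda>z. 0) \<in> N \<and>
     (\<forall>v\<in>N. \<forall>w\<in>N. (\<lambda>z. v z + w z) \<in> N) \<and>
     (\<forall>f\<in>regular_functions S. \<forall>v\<in>N. (\<lambda>z. f z *s v z) \<in> N) \<and>
     (\<forall>v\<in>N. nabla S B v \<in> N)"

definition irreducible_connection :: "complex set \<Rightarrow> (complex \<Rightarrow> complex^'n^'n) \<Rightarrow> bool" where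
  "irreducible_connection S B \<longleftrightarrow>
     (\<forall>N. subconnection S B N \<longrightarrow> N = {\<lambda>z. 0} \<or> N = sections S)"

text \<open>
  The system in the local coordinate \<open>x\<close>: horizontal sections satisfy
  \<open>dy/dx = local_matrix B p * y\<close>. At \<open>Infty\<close> one has \<open>dz = - dx / x^2\<close>.
\<close>

definition local_matrix :: "(complex \<Rightarrow> complex^'n^'n) \<Rightarrow> P1 \<Rightarrow> (complex fls)^'n^'n" where
  "local_matrix B p = (case p of
      Aff a \<Rightarrow> (\<chi> i j. laurent_expansion (\<lambda>z. B z $ i $ j) a)
    | Infty \<Rightarrow> (\<chi> i j. laurent_expansion (\<lambda>x. - (B (1 / x) $ i $ j) / x ^ 2) 0))"

definition local_coeff :: "(complex \<Rightarrow> complex^'n^'n) \<Rightarrow> P1 \<Rightarrow> int \<Rightarrow> complex^'n^'n" where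
  "local_coeff B p m = (\<chi> i j. fls_nth (local_matrix B p $ i $ j) m)"

text \<open>
  A point of \<open>S\<close> may be an apparent singularity, across which the connection extends; this is the
  case exactly when there is a fundamental matrix of horizontal formal Laurent sections.
\<close>

definition formally_trivial_at :: "(complex \<Rightarrow> complex^'n^'n) \<Rightarrow> P1 \<Rightarrow> bool" where
  "formally_trivial_at B p \<longleftrightarrow> (\<exists>Y :: (complex fls)^'n^'n. det Y \<noteq> 0 \<and>
     (\<forall>i j. fls_deriv (Y $ i $ j) = (\<Sum>k\<in>UNIV. local_matrix B p $ i $ k * Y $ k $ j)))"

abbreviation singular_at :: "(complex \<Rightarrow> complex^'n^'n) \<Rightarrow> P1 \<Rightarrow> bool" where
  "singular_at B p \<equiv> \<not> formally_trivial_at B p"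


section \<open>Formal horizontal sections and formal monodromy\<close>

text \<open>
  For a fixed exponential factor \<open>q\<close>, a coefficient family \<open>c\<close> stands for the formal section
  \<open>exp(q)\<close> times the sum over all complex \<open>\<mu>\<close> and naturals \<open>k\<close> of \<open>c \<mu> k * x^\<mu> * (log x)^k\<close>.
  Admissible are the combinations of \<open>x^\<nu> (log x)^k\<close>, for finitely many \<open>\<nu>\<close> and \<open>k\<close>, whose
  coefficients are power series in some root \<open>x^(1/r)\<close>.
\<close>

type_synonym 'n formal_section = "complex \<Rightarrow> nat \<Rightarrow> complex^'n"

definition admissible :: "('n::finite) formal_section \<Rightarrow> bool" where
  "admissible c \<longleftrightarrow> (\<exists>\<Lambda> r K. finite \<Lambda> \<and> (1::nat) \<le> r \<and>
     (\<forall>\<mu> k. c \<mu> k \<noteq> 0 \<longrightarrow> k \<le> K \<and> (\<exists>\<nu>\<in>\<Lambda>. \<exists>j::nat. \<mu> = \<nu> + of_nat j / of_nat r)))"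

text \<open>
  Comparison of the coefficients of \<open>exp(q) x^\<mu> (log x)^k\<close> in \<open>dy/dx = local_matrix B p * y\<close>.
  The sum over the integers \<open>m\<close> has only finitely many nonzero terms for admissible \<open>c\<close>.
\<close>

definition horizontal ::
  "(complex \<Rightarrow> complex^'n^'n) \<Rightarrow> P1 \<Rightarrow> expfactor \<Rightarrow> ('n::finite) formal_section \<Rightarrow> bool" where
  "horizontal B p q c \<longleftrightarrow> (\<forall>\<mu> k.
     (\<mu> + 1) *s c (\<mu> + 1) k + of_nat (k + 1) *s c (\<mu> + 1) (k + 1)
       - (\<Sum>e\<in>Poly_Mapping.keys q. (of_rat e * Poly_Mapping.lookup q e) *s c (\<mu> + of_rat e + 1) k)
     = Sum_any (\<lambda>m::int. local_coeff B p m *v c (\<mu> - of_int m) k))"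

definition horizontal_sections ::
  "(complex \<Rightarrow> complex^'n^'n) \<Rightarrow> P1 \<Rightarrow> expfactor \<Rightarrow> ('n::finite) formal_section set" where
  "horizontal_sections B p q = {c. admissible c \<and> horizontal B p q c}"

definition fs_scale :: "complex \<Rightarrow> ('n::finite) formal_section \<Rightarrow> ('n::finite) formal_section" where
  "fs_scale s c = (\<lambda>\<mu> k. s *s c \<mu> k)"

global_interpretation fs: vector_space "fs_scale :: complex \<Rightarrow> ('n::finite) formal_section \<Rightarrow> ('n::finite) formal_section"
  by unfold_locales
    (auto simp: fs_scale_def plus_fun_def fun_eq_iff vec_eq_iff algebra_simps)

text \<open>
  Analytic continuation of formal sections along \<open>r\<close> positive turns in the local coordinate \<open>x\<close>:
  \<open>x^\<mu>\<close> becomes \<open>exp(2 \<pi> i r \<mu>) x^\<mu>\<close> and \<open>log x\<close> becomes \<open>log x + 2 \<pi> i r\<close>. If \<open>r = ram q\<close>, then \<open>q\<close> is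
  unchanged and this is the monodromy of the local system on the circle of \<open>q\<close>.
\<close>

definition formal_monodromy :: "nat \<Rightarrow> ('n::finite) formal_section \<Rightarrow> ('n::finite) formal_section" where
  "formal_monodromy r c = (\<lambda>\<mu> k. exp (2 * of_real pi * \<i> * of_nat r * \<mu>) *s
     Sum_any (\<lambda>l. (of_nat ((k + l) choose k) * (2 * of_real pi * \<i> * of_nat r) ^ l) *s c \<mu> (k + l)))"

text \<open>
  The space attached to the branch \<open>q\<close> in the modified formal data: for tame circles at finite
  distance, \<open>Im (T - Id)\<close> instead of the whole space.
\<close>

definition modified_space ::
  "(complex \<Rightarrow> complex^'n^'n) \<Rightarrow> P1 \<Rightarrow> expfactor \<Rightarrow> ('n::finite) formal_section set" where
  "modified_space B p q =
     (if p \<noteq> Infty \<and> q = 0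
      then (\<lambda>c. formal_monodromy 1 c - c) ` horizontal_sections B p q
      else horizontal_sections B p q)"

definition represents_on ::
  "complex mat \<Rightarrow> (('n::finite) formal_section \<Rightarrow> ('n::finite) formal_section) \<Rightarrow> ('n::finite) formal_section set \<Rightarrow> bool" where
  "represents_on M T V \<longleftrightarrow> (let d = fs.dim V in
     M \<in> carrier_mat d d \<and>
     (\<exists>b :: nat \<Rightarrow> ('n::finite) formal_section. inj_on b {..<d} \<and>
        fs.independent (b ` {..<d}) \<and> fs.span (b ` {..<d}) = V \<and>
        (\<forall>j<d. T (b j) = (\<Sum>i<d. fs_scale (index_mat M (i, j)) (b i)))))"

definition modified_multiplicity :: "(complex \<Rightarrow> complex^'n^'n) \<Rightarrow> circle \<Rightarrow> nat" where
  "modified_multiplicity B c = fs.dim (modified_space B (fst c) (a_representative c))"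

definition modified_class :: "(complex \<Rightarrow> complex^'n^'n) \<Rightarrow> circle \<Rightarrow> complex mat set" where
  "modified_class B c = (let q = a_representative c in
     {M. represents_on M (formal_monodromy (ram q)) (modified_space B (fst c) q)})"

text \<open>
  A collection of multiplicities and conjugacy classes indexed by circles, as a set of triples.
\<close>

type_synonym formal_data = "(circle \<times> nat \<times> complex mat set) set"

definition modified_formal_data :: "(complex \<Rightarrow> complex^'n^'n) \<Rightarrow> formal_data" where
  "modified_formal_data B = {(c, modified_multiplicity B c, modified_class B c) |c. is_circle c}"

definition active_circles :: "formal_data \<Rightarrow> circle set" where
  "active_circles D = {c. \<exists>n C. (c, n, C) \<in> D \<and> n \<noteq> 0}"

definition support_at_infinity :: "formal_data \<Rightarrow> bool" where
  "support_at_infinity D \<longleftrightarrow> (\<forall>c\<in>active_circles D. fst c = Infty)"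


section \<open>Elementary transformations\<close>

definition twist_circle :: "complex \<Rightarrow> circle \<Rightarrow> circle" where
  "twist_circle \<mu> c = (case fst c of
      Aff a \<Rightarrow> c
    | Infty \<Rightarrow> (Infty, (\<lambda>q. q - Poly_Mapping.single 2 (\<mu> / 2)) ` snd c))"

text \<open>
  Substitution of \<open>z/\<mu>\<close> for \<open>z\<close>. The principal branch is used for all powers of \<open>\<mu>\<close>; another
  branch yields the same Galois orbit. Note that \<open>z/\<mu> - a = (z - \<mu> a)/\<mu>\<close>.
\<close>

definition scale_circle :: "complex \<Rightarrow> circle \<Rightarrow> circle" where
  "scale_circle \<mu> c = (case fst c of
      Aff a \<Rightarrow> (Aff (\<mu> * a), Poly_Mapping.mapp (\<lambda>e k. \<mu> powr of_rat e * k) ` snd c)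
    | Infty \<Rightarrow> (Infty, Poly_Mapping.mapp (\<lambda>e k. \<mu> powr (- of_rat e) * k) ` snd c))"

text \<open>
  The Legendre transform is written with a uniformising parameter \<open>u\<close> of the target circle. The
  coordinate on the target side is \<open>\<xi> = b + u^r'\<close> or \<open>\<xi> = u^(-r')\<close>, and \<open>x = x(u)\<close> is an \<open>r\<close>-th root
  of the local coordinate on the source side, so that \<open>z = a + x^r\<close> or \<open>z = x^(-r)\<close>. The equation
  \<open>dq/dz = \<xi>\<close> reads \<open>dq/du = \<xi> dz/du\<close>, and the transform is the polar part of \<open>q - \<xi> z\<close>.
\<close>

definition expand_factor :: "nat \<Rightarrow> complex fls \<Rightarrow> expfactor \<Rightarrow> complex fls" where
  "expand_factor r x q =
     (\<Sum>e\<in>Poly_Mapping.keys q. fls_const (Poly_Mapping.lookup q e) * x powi (- \<lfloor>e * of_nat r\<rfloor>))"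

definition expand_coordinate :: "P1 \<Rightarrow> nat \<Rightarrow> complex fls \<Rightarrow> complex fls" where
  "expand_coordinate p r x = (case p of Aff a \<Rightarrow> fls_const a + x ^ r | Infty \<Rightarrow> inverse (x ^ r))"

definition legendre :: "P1 \<Rightarrow> expfactor \<Rightarrow> P1 \<Rightarrow> expfactor \<Rightarrow> bool" where
  "legendre p q p' q' \<longleftrightarrow> exp_factor q' \<and>
     (\<exists>r r' x. clears_denominators r q \<and> clears_denominators r' q' \<and> 0 < fls_subdegree x \<and>
       (let Q = expand_factor r x q;
            Z = expand_coordinate p r x;
            \<Xi> = expand_coordinate p' r' fls_X
        in fls_deriv Q = \<Xi> * fls_deriv Z \<and>
           (\<forall>m<0. fls_nth (Q - \<Xi> * Z) m = fls_nth (expand_factor r' fls_X q') m)))"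

text \<open>
  At infinity, slope at most 1 means \<open>q = \<alpha> z + q0\<close> with \<open>slope q0 < 1\<close>, where \<open>\<alpha> = lookup q 1\<close> is the
  same for all conjugates.
\<close>

definition drop_linear :: "expfactor \<Rightarrow> expfactor" where
  "drop_linear q = q - Poly_Mapping.single 1 (Poly_Mapping.lookup q 1)"

definition fourier_circle :: "circle \<Rightarrow> circle" where
  "fourier_circle c = (let q = a_representative c in case fst c of
      Aff a \<Rightarrow>
        (if q = 0 then circle_of Infty (Poly_Mapping.single 1 (- a))
         else (Infty, {q'. \<exists>q\<in>snd c. legendre (Aff a) q Infty q'}))
    | Infty \<Rightarrow>
        (if slope q > 1 then (Infty, {q'. \<exists>q\<in>snd c. legendre Infty q Infty q'})
         else if drop_linear q = 0 then circle_of (Aff (Poly_Mapping.lookup q 1)) 0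
         else (Aff (Poly_Mapping.lookup q 1),
               {q'. \<exists>q\<in>snd c. legendre Infty q (Aff (Poly_Mapping.lookup q 1)) q'})))"

text \<open>
  The effect of the Fourier transform on formal monodromies. For tame circles and circles
  \<open>\<alpha> z\<close> at infinity, transport along an orientation-reversing identification inverts the class.
\<close>

definition inverse_class :: "complex mat set \<Rightarrow> complex mat set" where
  "inverse_class C = {N. \<exists>M\<in>C. N \<in> carrier_mat (dim_row M) (dim_row M) \<and>
     inverts_mat M N \<and> inverts_mat N M}"

definition fourier_class :: "circle \<Rightarrow> complex mat set \<Rightarrow> complex mat set" where
  "fourier_class c C = (let q = a_representative c;
       q0 = (if fst c = Infty \<and> slope q \<le> 1 then drop_linear q else q)
     in if q0 = 0 then inverse_class C else (\<lambda>M. (-1) ^ irr q0 \<cdot>\<^sub>m M) ` C)"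

datatype elementary = Twist complex | Scaling complex | Fourier

fun valid_elementary :: "elementary \<Rightarrow> bool" where
  "valid_elementary (Twist \<mu>) = True"
| "valid_elementary (Scaling \<mu>) = (\<mu> \<noteq> 0)"
| "valid_elementary Fourier = True"

fun elementary_matrix :: "elementary \<Rightarrow> complex^2^2" where
  "elementary_matrix (Twist \<mu>) = vector [vector [1, \<mu>], vector [0, 1]]"
| "elementary_matrix (Scaling \<mu>) = vector [vector [inverse \<mu>, 0], vector [0, \<mu>]]"
| "elementary_matrix Fourier = vector [vector [0, 1], vector [-1, 0]]"

fun elementary_circle :: "elementary \<Rightarrow> circle \<Rightarrow> circle" where
  "elementary_circle (Twist \<mu>) c = twist_circle \<mu> c"
| "elementary_circle (Scaling \<mu>) c = scale_circle \<mu> c"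
| "elementary_circle Fourier c = fourier_circle c"

fun elementary_class :: "elementary \<Rightarrow> circle \<Rightarrow> complex mat set \<Rightarrow> complex mat set" where
  "elementary_class (Twist \<mu>) c C = C"
| "elementary_class (Scaling \<mu>) c C = C"
| "elementary_class Fourier c C = fourier_class c C"

definition elementary_data :: "elementary \<Rightarrow> formal_data \<Rightarrow> formal_data" where
  "elementary_data g D = (\<lambda>(c, n, C). (elementary_circle g c, n, elementary_class g c C)) ` D"


section \<open>The action of the special linear group\<close>

definition SL2 :: "(complex^2^2) set" where
  "SL2 = {A. det A = 1}"

text \<open>
  \<open>sl2_acts A D D'\<close>: the data \<open>D'\<close> are obtained from \<open>D\<close> by applying the elementary transformations of
  some factorization of \<open>A\<close>, the rightmost factor first. Quantifying over all such \<open>D'\<close> avoids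
  singling out a factorization.
\<close>

definition sl2_acts :: "complex^2^2 \<Rightarrow> formal_data \<Rightarrow> formal_data \<Rightarrow> bool" where
  "sl2_acts A D D' \<longleftrightarrow> (\<exists>gs. (\<forall>g\<in>set gs. valid_elementary g) \<and>
     A = foldr (\<lambda>g M. elementary_matrix g ** M) gs (mat 1) \<and>
     D' = foldr elementary_data gs D)"

lemma sl2_acts_exists:
  assumes "A \<in> SL2"
  shows "\<exists>D'. sl2_acts A D D'"
proof -
  have "\<exists>gs. (\<forall>g\<in>set gs. valid_elementary g) \<and>
     A = foldr (\<lambda>g M. elementary_matrix g ** M) gs (mat 1)"
  proof (cases "A $ 2 $ 1 = 0")
    case True
    with assms have d: "A $ 1 $ 1 * A $ 2 $ 2 = 1" by (simp add: SL2_def det_2)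
    hence d0: "A $ 2 $ 2 \<noteq> 0" by auto
    with d have a: "A $ 1 $ 1 = inverse (A $ 2 $ 2)"
      by (simp add: eq_divide_eq inverse_eq_divide)
    show ?thesis
      by (rule exI[of _ "[Scaling (A $ 2 $ 2), Twist (A $ 1 $ 2 * A $ 2 $ 2)]"])
        (use True d0 a in \<open>simp add: Finite_Cartesian_Product.vec_eq_iff
          Finite_Cartesian_Product.mat_def forall_2 matrix_matrix_mult_def sum_2\<close>)
  next
    case False
    from assms have d: "A $ 1 $ 1 * A $ 2 $ 2 - A $ 1 $ 2 * A $ 2 $ 1 = 1"
      by (simp add: SL2_def det_2)
    show ?thesis
      by (rule exI[of _ "[Twist (A $ 1 $ 1 / A $ 2 $ 1), Fourier, Scaling (- 1 / A $ 2 $ 1),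
                          Twist (A $ 2 $ 2 / A $ 2 $ 1)]"])
        (use False d in \<open>simp add: Finite_Cartesian_Product.vec_eq_iff
          Finite_Cartesian_Product.mat_def forall_2 matrix_matrix_mult_def sum_2 field_simps\<close>)
  qed
  thus ?thesis by (auto simp: sl2_acts_def)
qed


section \<open>The diagram\<close>

definition class_minpoly_degree :: "complex mat set \<Rightarrow> nat" where
  "class_minpoly_degree C = (LEAST d. \<exists>p :: complex poly. p \<noteq> 0 \<and> degree p = d \<and>
     (\<forall>M\<in>C. \<forall>i<dim_row M. \<forall>j<dim_row M.
        (\<Sum>k\<le>degree p. coeff p k * index_mat (M ^\<^sub>m k) (i, j)) = 0))"

definition circle_A :: "circle \<Rightarrow> circle \<Rightarrow> rat" where
  "circle_A c c' = (\<Sum>q\<in>snd c. \<Sum>q'\<in>snd c'. slope (q - q'))"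

definition circle_B :: "circle \<Rightarrow> circle \<Rightarrow> rat" where
  "circle_B c c' = circle_A c c' - of_nat (circle_ram c * circle_ram c') + (if c = c' then 1 else 0)"

record 'v diagram =
  nodes :: "'v set"
  core :: "'v set"
  edge_mult :: "'v \<Rightarrow> 'v \<Rightarrow> rat"

text \<open>The node \<open>(c, i)\<close> is the vertex number \<open>i\<close> of the leg glued to the core node \<open>(c, 1)\<close>.\<close>

definition diagram_infinity :: "formal_data \<Rightarrow> (circle \<times> nat) diagram" where
  "diagram_infinity D =
     \<lparr> nodes = {(c, i). \<exists>n C. (c, n, C) \<in> D \<and> n \<noteq> 0 \<and> 1 \<le> i \<and> i \<le> class_minpoly_degree C},
       core = {(c, 1) |c. c \<in> active_circles D},
       edge_mult = (\<lambda>(c, i) (c', j).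
         if i = 1 \<and> j = 1 then circle_B c c'
         else if c = c' \<and> (i = j + 1 \<or> j = i + 1) then 1 else 0) \<rparr>"

definition diagram_iso :: "'v diagram \<Rightarrow> 'w diagram \<Rightarrow> bool" where
  "diagram_iso G H \<longleftrightarrow> (\<exists>f. bij_betw f (nodes G) (nodes H) \<and> f ` core G = core H \<and>
     (\<forall>u\<in>nodes G. \<forall>v\<in>nodes G. edge_mult H (f u) (f v) = edge_mult G u v))"

end

theory Submission
  imports Defs "Jordan_Normal_Form.Determinant"
begin

hide_const (open) Determinant.det
no_notation Matrix.vec_index (infixl \<open>$\<close> 100)

text \<open>
  A circle is encoded by a formal curve \<open>(Z, \<Xi>)\<close> of Laurent series in one parameter, where \<open>Z\<close> is the
  coordinate \<open>z\<close> and \<open>\<Xi>\<close> is \<open>dq/dz\<close> up to an error for which \<open>\<Xi> dZ\<close> is regular singular. The group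
  \<open>SL\<^sub>2\<close> acts linearly on such curves, by acting on the vector \<open>(-\<Xi>, Z)\<close>, and each elementary
  transformation of circles is induced by the action of its matrix. Hence the effect of a word in
  the elementary transformations depends on its product only.

  The leading coefficient of a curve is a direction in the plane, vertical exactly for the circles at
  finite distance and those at infinity of slope more than 2. There are finitely many directions of
  active circles at infinity, because sections \<open>exp(q) w\<close> with distinct \<open>q\<close> are independent. So
  a generic \<open>A\<close> sends no active direction to the vertical one, and all circles end up at infinity with
  slope at most 2. Two such generic images of the data differ by an element of \<open>SL\<^sub>2\<close> that maps
  circles at infinity of slope at most 2 to circles of the same kind. To first order, comparing
  two curves at equal \<open>z\<close> before and after applying the matrix gives differences of the same order, so
  the slopes of the \<open>q - q'\<close> are preserved and with them the edge multiplicities.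
\<close>

text \<open>The curves are Lagrangian. The form \<open>\<Xi> dZ\<close> stands for dq, and as
  \<open>d(q - \<xi> z) = - z d\<xi>\<close>, the Legendre transform is the quarter turn from (Z,
  \<Xi>) to (\<Xi>, - Z); twists are shears. The obstacle is that a circle fixes its curve only up
  to reparametrization and up to logarithmic forms. Logarithmic errors survive the quarter turn
  because an error in \<Xi> can be traded for one of the same kind in Z. Reparametrization is
  harmless for a single circle, but the slope of q - q' needs both branches over the same z, and a
  matrix moves their z-coordinates differently. They are realigned by a substitution; where the
  branches agree to leading order it is tangent to the identity, and its distance from the identity,
  read off from z, bounds its effect on \<xi>. Slope 2 is the threshold up to which \<Xi> has no
  deeper pole than Z, so that leading coefficients see the matrix only. The legs need an argument of
  their own: the Fourier transform changes signs of monodromy classes or inverts them, and the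
  degree of the minimal polynomial survives inversion because formal monodromy is
  invertible.\<close>

definition order_ge :: "complex fls \<Rightarrow> int \<Rightarrow> bool" where
  "order_ge f n \<longleftrightarrow> (\<forall>m<n. fls_nth f m = 0)"

text \<open>By convention \<open>fls_subdegree 0\<close> is 0, while 0 must be negligible to every
  order; a bare comparison with \<open>fls_subdegree\<close> would not do as an order
  estimate.\<close>

lemma order_ge_iff: "order_ge f n \<longleftrightarrow> f = 0 \<or> n \<le> fls_subdegree f"
  unfolding order_ge_def
  by (metis fls_eq0_below_subdegree fls_subdegree_geI fls_zero_nth linorder_not_less
      nth_fls_subdegree_nonzero order_less_le_trans)

lemma order_ge_0 [simp]: "order_ge 0 n"
  by (simp add: order_ge_def)

lemma order_ge_mono: "order_ge f n \<Longrightarrow> m \<le> n \<Longrightarrow> order_ge f m"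
  by (auto simp: order_ge_def)

lemma order_ge_add: "order_ge f n \<Longrightarrow> order_ge g n \<Longrightarrow> order_ge (f + g) n"
  by (auto simp: order_ge_def)

lemma order_ge_diff: "order_ge f n \<Longrightarrow> order_ge g n \<Longrightarrow> order_ge (f - g) n"
  by (auto simp: order_ge_def)

lemma order_ge_minus [simp]: "order_ge (- f) n \<longleftrightarrow> order_ge f n"
  by (auto simp: order_ge_def)

lemma order_ge_const [simp]: "order_ge (fls_const c) 0"
  by (simp add: order_ge_iff)

lemma order_ge_1 [simp]: "order_ge 1 0"
  by (simp add: order_ge_iff)

lemma order_ge_sum: "(\<And>i. i \<in> I \<Longrightarrow> order_ge (f i) n) \<Longrightarrow> order_ge (sum f I) n"
  by (induction I rule: infinite_finite_induct) (auto intro: order_ge_add)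

lemma order_ge_mult: "order_ge f m \<Longrightarrow> order_ge g n \<Longrightarrow> order_ge (f * g) (m + n)"
  by (cases "f = 0 \<or> g = 0") (auto simp: order_ge_iff)

lemma order_ge_const_mult: "order_ge f n \<Longrightarrow> order_ge (fls_const c * f) n"
  using order_ge_mult[OF order_ge_const[of c]] by fastforce

lemma order_ge_divide:
  assumes "order_ge f n" "g \<noteq> 0"
  shows "order_ge (f / g) (n - fls_subdegree g)"
  using assms by (cases "f = 0") (auto simp: order_ge_iff fls_divide_subdegree)

lemma order_ge_mult_cancel:
  assumes "order_ge (f * g) n" "g \<noteq> 0"
  shows "order_ge f (n - fls_subdegree g)"
  using order_ge_divide[OF assms] assms(2) by simp

lemma order_ge_deriv: "order_ge f n \<Longrightarrow> order_ge (fls_deriv f) (n - 1)"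
  by (auto simp: order_ge_def)

text \<open>The bound on \<open>n\<close> keeps the unseen constant term out of the way.\<close>

lemma order_ge_deriv_cancel:
  assumes "order_ge (fls_deriv f) (n - 1)" "n \<le> 0"
  shows "order_ge f n"
  unfolding order_ge_def
proof (intro allI impI)
  fix m assume "m < n"
  hence "m - 1 < n - 1" and m: "m \<noteq> 0" using assms by auto
  hence "fls_nth (fls_deriv f) (m - 1) = 0" using assms unfolding order_ge_def by blast
  thus "fls_nth f m = 0" using m by simp
qed

lemma subdegree_eq_iff_order_ge:
  "fls_nth f n \<noteq> 0 \<Longrightarrow> order_ge f n \<longleftrightarrow> fls_subdegree f = n"
  by (metis fls_subdegree_leI fls_zero_nth order_antisym order_ge_iff order_refl)

lemma order_ge_Suc: "order_ge f n \<Longrightarrow> fls_nth f n = 0 \<Longrightarrow> order_ge f (n + 1)"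
  unfolding order_ge_def by (metis linorder_neqE_linordered_idom zless_add1_eq)

lemma fls_nth_add_order_ge: "order_ge g (n + 1) \<Longrightarrow> fls_nth (f + g) n = fls_nth f n"
  by (simp add: order_ge_def)

lemma subdegree_add_order_ge:
  assumes "f \<noteq> 0" "order_ge g (fls_subdegree f + 1)"
  shows "fls_subdegree (f + g) = fls_subdegree f" "f + g \<noteq> 0"
proof -
  have "fls_nth (f + g) (fls_subdegree f) \<noteq> 0"
    using fls_nth_add_order_ge[OF assms(2), of f] assms(1) by simp
  moreover have "order_ge (f + g) (fls_subdegree f)"
    by (intro order_ge_add order_ge_mono[OF assms(2)]) (auto simp: order_ge_iff)
  ultimately show "fls_subdegree (f + g) = fls_subdegree f" "f + g \<noteq> 0"
    using subdegree_eq_iff_order_ge[of "f + g" "fls_subdegree f"] fls_zero_nth by metis+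
qed

text \<open>The bounds need not be attained: if one is not, both sides vanish. So leading
  coefficients can be multiplied without knowing exact orders.\<close>

lemma fls_nth_mult_leading:
  fixes f g :: "complex fls"
  assumes "order_ge f m" "order_ge g n"
  shows "fls_nth (f * g) (m + n) = fls_nth f m * fls_nth g n"
proof (cases "f = 0 \<or> g = 0")
  case False
  hence "m \<le> fls_subdegree f" "n \<le> fls_subdegree g" using assms by (auto simp: order_ge_iff)
  moreover have ?thesis if "m = fls_subdegree f" "n = fls_subdegree g"
    using that by (simp add: fls_times_base)
  moreover have ?thesis if "m + n < fls_subdegree f + fls_subdegree g"
  proof -
    have "fls_nth (f * g) (m + n) = 0" using that by (rule fls_times_nth_eq0)
    moreover have "m < fls_subdegree f \<or> n < fls_subdegree g" using that by linarith
    ultimately show ?thesis by auto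
  qed
  ultimately show ?thesis by linarith
qed auto

lemma fls_const_eq_iff [simp]: "fls_const a = fls_const b \<longleftrightarrow> a = b"
  by (metis fls_const_nth)

section \<open>Substitution\<close>

abbreviation reparam :: "complex fps \<Rightarrow> bool" where
  "reparam \<phi> \<equiv> 0 < subdegree \<phi>"

abbreviation compose :: "complex fls \<Rightarrow> complex fps \<Rightarrow> complex fls" (infixl "\<triangleleft>" 75) where
  "f \<triangleleft> \<phi> \<equiv> fls_compose_fps f \<phi>"

lemma reparamD: "reparam \<phi> \<Longrightarrow> \<phi> \<noteq> 0" "reparam \<phi> \<Longrightarrow> fps_nth \<phi> 0 = 0"
  by (auto simp: subdegree_pos_iff)

lemmas compose_simps = fls_compose_fps_add[OF reparamD] fls_compose_fps_diff[OF reparamD]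
  fls_compose_fps_mult[OF reparamD] fls_compose_fps_inverse[OF reparamD]
  fls_compose_fps_divide[OF reparamD] fls_compose_fps_power[OF reparamD]
  fls_compose_fps_powi[OF reparamD]

lemma compose_eq_0_iff: "reparam \<phi> \<Longrightarrow> f \<triangleleft> \<phi> = 0 \<longleftrightarrow> f = 0"
  by (rule fls_compose_fps_eq_0_iff) (auto simp: subdegree_pos_iff)

lemma compose_sum: "reparam \<phi> \<Longrightarrow> sum f I \<triangleleft> \<phi> = (\<Sum>i\<in>I. f i \<triangleleft> \<phi>)"
  by (induction I rule: infinite_finite_induct) (auto simp: compose_simps)

lemma subdegree_compose: "reparam \<phi> \<Longrightarrow> fls_subdegree (f \<triangleleft> \<phi>) = fls_subdegree f * int (subdegree \<phi>)"
  by (subst subdegree_fls_compose_fps) (auto dest: reparamD)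

lemma order_ge_compose:
  assumes "reparam \<phi>" "order_ge f n"
  shows "order_ge (f \<triangleleft> \<phi>) (n * int (subdegree \<phi>))"
  using assms by (auto simp: order_ge_iff subdegree_compose mult_right_mono)

lemma order_ge_compose_unif:
  assumes "subdegree \<phi> = 1" "order_ge f n"
  shows "order_ge (f \<triangleleft> \<phi>) n"
  using order_ge_compose[of \<phi> f n] assms by simp

text \<open>The chain rule for power series extends to poles: a power of \<open>fls_X\<close> clears
  them and is divided out again by the product rule.\<close>

lemma fls_deriv_compose:
  assumes [simp]: "reparam \<phi>"
  shows "fls_deriv (f \<triangleleft> \<phi>) = (fls_deriv f \<triangleleft> \<phi>) * fls_deriv (fps_to_fls \<phi>)"
proof -
  note nz = reparamD[OF assms]
  have fps: "fls_deriv (fps_to_fls G \<triangleleft> \<phi>) = (fls_deriv (fps_to_fls G) \<triangleleft> \<phi>) * fls_deriv (fps_to_fls \<phi>)" for G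
    using nz by (simp add: fls_deriv_fps_to_fls fps_compose_deriv fls_times_fps_to_fls)
  define k where "k = nat (- fls_subdegree f)"
  have "0 \<le> fls_subdegree (f * fls_X ^ k)"
    by (cases "f = 0") (auto simp: k_def)
  hence "f * fls_X ^ k = fps_to_fls (fls_regpart (f * fls_X ^ k))" by simp
  then obtain G where G: "f * fls_X ^ k = fps_to_fls G" by blast
  have X: "fls_X ^ k = fps_to_fls (fps_X ^ k :: complex fps)" by (simp add: fps_to_fls_power)
  have "fls_deriv ((f * fls_X ^ k) \<triangleleft> \<phi>) = (fls_deriv (f * fls_X ^ k) \<triangleleft> \<phi>) * fls_deriv (fps_to_fls \<phi>)"
    unfolding G by (rule fps)
  moreover have "fls_deriv (fls_X ^ k \<triangleleft> \<phi>) = (fls_deriv (fls_X ^ k) \<triangleleft> \<phi>) * fls_deriv (fps_to_fls \<phi>)"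
    unfolding X by (rule fps)
  moreover have "fls_X ^ k \<triangleleft> \<phi> \<noteq> 0" by (simp add: compose_eq_0_iff)
  ultimately show ?thesis using nz(1) by (auto simp: compose_simps algebra_simps)
qed

lemma deriv_compose_subdegree:
  "reparam \<phi> \<Longrightarrow> order_ge (fls_deriv (fps_to_fls \<phi>)) (int (subdegree \<phi>) - 1)"
  by (intro order_ge_deriv) (auto simp: order_ge_iff fls_subdegree_fls_to_fps)

text \<open>Order at least \<open>-1\<close> encodes a differential form with at most a logarithmic pole.\<close>

lemma order_ge_log_compose:
  assumes "reparam \<phi>" "order_ge f (-1)"
  shows "order_ge ((f \<triangleleft> \<phi>) * fls_deriv (fps_to_fls \<phi>)) (-1)"
  using order_ge_mult[OF order_ge_compose[OF assms] deriv_compose_subdegree[OF assms(1)]] by simp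

text \<open>Once the power of \<open>fls_X\<close> is split off, a power series with nonzero
  constant term remains, and its root is a formal radical. Prescribing c selects one of the m roots,
  which later makes substitutions between roots tangent to the identity.\<close>

lemma exists_root:
  fixes f :: "complex fls"
  assumes f: "f \<noteq> 0" and m: "0 < m" and e: "fls_subdegree f = int m * d"
    and c: "c ^ m = fls_nth f (fls_subdegree f)"
  shows "\<exists>s. fls_subdegree s = d \<and> fls_nth s d = c \<and> s ^ m = f"
proof -
  define G where "G = fls_base_factor_to_fps f"
  have G0: "fps_nth G 0 = c ^ m" "fps_nth G 0 \<noteq> 0"
    using f c by (auto simp: G_def)
  define R where "R = fps_radical (\<lambda>_ _. c) m G"
  obtain m' where m': "m = Suc m'" using m by (cases m) auto
  have R: "R ^ m = G"
    using power_radical[of G "\<lambda>_ _. c" m'] G0 unfolding R_def m' by simp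
  have R0: "fps_nth R 0 = c" unfolding R_def m' by simp
  have c0: "c \<noteq> 0" using G0 m by (auto simp: power_0_left)
  define s where "s = fls_shift (-d) (fps_to_fls R)"
  have R1: "fps_to_fls R \<noteq> 0" using R0 c0 by auto
  have sd: "subdegree R = 0" using R0 c0 by auto
  have "fls_subdegree s = d"
    using R1 by (simp add: s_def fls_subdegree_fls_to_fps sd)
  moreover have "fls_nth s d = c" by (simp add: s_def R0)
  moreover have "s ^ m = f"
  proof -
    have s: "s = fps_to_fls R * fls_X powi d"
      by (simp add: s_def fls_X_intpow_times_conv_shift)
    have "s ^ m = fps_to_fls (R ^ m) * fls_X powi (d * int m)"
      unfolding s power_mult_distrib fps_to_fls_power by (simp only: power_int_power')
    also have "\<dots> = f"
      unfolding R G_def fps_to_fls_base_factor_to_fps fls_X_power_int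
      by (simp only: mult.commute[of d] e[symmetric] fls_base_factor_X_power_decompose(1)[symmetric])
    finally show ?thesis .
  qed
  ultimately show ?thesis by blast
qed

text \<open>Differentiating \<open>v ^ m = 1\<close> forces the derivative of v to vanish.\<close>

lemma power_eq_const_imp:
  fixes v :: "complex fls"
  assumes "v ^ m = 1" "0 < m"
  shows "\<exists>\<omega>. v = fls_const \<omega> \<and> \<omega> ^ m = 1"
proof -
  have v0: "v \<noteq> 0" using assms by (auto simp: power_0_left)
  have "fls_deriv (v ^ m) = 0" using assms by simp
  hence "of_nat m * v ^ (m - 1) * fls_deriv v = 0" by (simp add: fls_deriv_power)
  hence d: "fls_deriv v = 0" using v0 assms by simp
  have "fls_nth v n = 0" if "n \<noteq> 0" for n
    using arg_cong[OF d, of "\<lambda>f. fls_nth f (n - 1)"] that by simp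
  hence "\<exists>\<omega>. v = fls_const \<omega>" by (intro exI[of _ "fls_nth v 0"] fls_eqI) simp
  then obtain \<omega> where v: "v = fls_const \<omega>" by blast
  have "fls_const (\<omega> ^ m) = fls_const 1" using assms(1) v by (simp add: fls_const_power)
  hence "\<omega> ^ m = 1" by (simp only: fls_const_eq_iff)
  with v show ?thesis by blast
qed

lemma power_eq_imp_root_of_unity:
  fixes s t :: "complex fls"
  assumes "s ^ m = t ^ m" "0 < m" "t \<noteq> 0"
  shows "\<exists>\<omega>. s = fls_const \<omega> * t \<and> \<omega> ^ m = 1"
proof -
  have "(s / t) ^ m = 1" using assms by (simp add: power_divide)
  from power_eq_const_imp[OF this assms(2)] obtain \<omega> where
    "s / t = fls_const \<omega>" "\<omega> ^ m = 1" by blast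
  moreover from this assms(3) have "s = fls_const \<omega> * t" by (simp add: divide_eq_eq)
  ultimately show ?thesis by blast
qed

text \<open>A series of order 1 has a compositional inverse; \<phi> is the inverse of s evaluated at
  t.\<close>

lemma exists_reparam:
  assumes "fls_subdegree s = 1" "0 < fls_subdegree t"
  shows "\<exists>\<phi>. int (subdegree \<phi>) = fls_subdegree t \<and> s \<triangleleft> \<phi> = t"
proof -
  define S where "S = fls_regpart s"
  define T where "T = fls_regpart t"
  have s: "s = fps_to_fls S" and t: "t = fps_to_fls T"
    using assms by (simp_all add: S_def T_def)
  have dS: "subdegree S = 1" and dT: "int (subdegree T) = fls_subdegree t"
    using assms by (simp_all add: s t fls_subdegree_fls_to_fps)
  have S': "S \<noteq> 0" using dS by auto
  have S: "fps_nth S 0 = 0" "fps_nth S 1 \<noteq> 0"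
    using nth_less_subdegree_zero[of 0 S] nth_subdegree_nonzero[OF S'] unfolding dS by auto
  have T: "fps_nth T 0 = 0" "T \<noteq> 0"
  proof -
    have "0 < subdegree T" using dT assms(2) by linarith
    thus "fps_nth T 0 = 0" "T \<noteq> 0" by auto
  qed
  define \<phi> where "\<phi> = fps_compose (fps_inv S) T"
  have inv0: "fps_nth (fps_inv S) 0 = 0" by (simp add: fps_inv_def)
  have "fps_compose S \<phi> = fps_compose (fps_compose S (fps_inv S)) T"
    unfolding \<phi>_def using T inv0 by (simp add: fps_compose_assoc)
  also have "\<dots> = T" using S T by (simp add: fps_inv_right fps_X_fps_compose_startby0)
  finally have ST: "fps_compose S \<phi> = T" .
  have \<phi>0: "fps_nth \<phi> 0 = 0" using inv0 by (simp add: \<phi>_def)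
  have "\<phi> \<noteq> 0" using ST T S by auto
  hence rp: "reparam \<phi>" using \<phi>0 by (simp add: subdegree_pos_iff)
  have st: "s \<triangleleft> \<phi> = t" using ST \<phi>0 \<open>\<phi> \<noteq> 0\<close> by (simp add: s t)
  moreover have "int (subdegree \<phi>) = fls_subdegree t"
    using subdegree_compose[OF rp, of s] st assms by simp
  ultimately show ?thesis by blast
qed

section \<open>Substitutions close to the identity\<close>

lemma binomial_first_order_nat:
  assumes u: "order_ge u k" and k: "0 \<le> k"
  shows "order_ge ((1 + u) ^ n - 1 - of_nat n * u) (2 * k)"
proof (induction n)
  case (Suc n)
  have "(1 + u) ^ Suc n - 1 - of_nat (Suc n) * u
    = ((1 + u) ^ n - 1 - of_nat n * u) * (1 + u) + fls_const (of_nat n) * (u * u)"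
    unfolding fls_of_nat[symmetric] by (simp add: algebra_simps)
  moreover have "order_ge (((1 + u) ^ n - 1 - of_nat n * u) * (1 + u)) (2 * k + 0)"
    by (intro order_ge_mult Suc.IH order_ge_add order_ge_mono[OF u k]) simp
  moreover have "order_ge (fls_const (of_nat n) * (u * u)) (2 * k)"
    using order_ge_const_mult[OF order_ge_mult[OF u u]] by simp
  ultimately show ?case by (simp add: order_ge_add)
qed simp

lemma order_ge_of_int_mult: "order_ge f n \<Longrightarrow> order_ge (of_int i * f) n"
  using order_ge_const_mult[of f n "of_int i"] by (simp add: fls_of_int)

text \<open>For a negative exponent put \<open>w = (1 + u) ^ m\<close>. Then
  \<open>1/w - 1 + m u\<close> equals \<open>(m u (w - 1) - (w - 1 - m u)) / w\<close>, where both
  terms of the numerator are quadratically small.\<close>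

lemma binomial_first_order:
  assumes u: "order_ge u k" and k: "0 < k"
  shows "order_ge ((1 + u) powi n - 1 - of_int n * u) (2 * k)"
proof (cases "0 \<le> n")
  case True
  then obtain m where "n = int m" using nonneg_int_cases by blast
  thus ?thesis using binomial_first_order_nat[OF u, of m] k by simp
next
  case False
  then obtain m where n: "n = - int m" by (metis linear nonpos_int_cases)
  define w where "w = (1 + u) ^ m"
  have w1: "order_ge (w - 1 - of_int (int m) * u) (2 * k)"
    using binomial_first_order_nat[OF u, of m] k by (simp add: w_def)
  have "order_ge (w - 1 - of_int (int m) * u + of_int (int m) * u) k"
    by (intro order_ge_add order_ge_of_int_mult u order_ge_mono[OF w1]) (use k in auto)
  hence w2: "order_ge (w - 1) k" by (simp add: algebra_simps)
  have sw: "fls_subdegree w = 0" "w \<noteq> 0"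
    using subdegree_add_order_ge[of 1 "w - 1"] order_ge_mono[OF w2] k by simp_all
  have "(1 + u) powi n - 1 - of_int n * u
      = (of_int (int m) * u * (w - 1) - (w - 1 - of_int (int m) * u)) / w"
    using sw by (simp add: n w_def power_int_minus field_simps)
  moreover have "order_ge (of_int (int m) * u * (w - 1)) (2 * k)"
    using order_ge_mult[OF order_ge_of_int_mult[OF u, of "int m"] w2] by simp
  hence "order_ge ((of_int (int m) * u * (w - 1) - (w - 1 - of_int (int m) * u)) / w) (2 * k - fls_subdegree w)"
    by (intro order_ge_divide order_ge_diff w1 sw)
  ultimately show ?thesis using sw by simp
qed

lemma power_first_order:
  assumes h: "order_ge (p - fls_X) (k + 1)" and k: "0 < k"
  shows "order_ge (p powi n - fls_X powi n - of_int n * fls_X powi (n - 1) * (p - fls_X)) (n + 2 * k)"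
proof -
  define u where "u = (p - fls_X) / fls_X"
  have u: "order_ge u k" using order_ge_divide[OF h, of fls_X] by (simp add: u_def)
  have "fls_X * u = p - fls_X"
    unfolding u_def by (subst times_divide_eq_right, rule nonzero_mult_div_cancel_left) simp
  hence p: "p = fls_X * (1 + u)" by (simp add: algebra_simps)
  have alg: "(x * (1 + u)) powi n - x powi n - of_int n * x powi (n - 1) * (x * (1 + u) - x)
     = x powi n * ((1 + u) powi n - 1 - of_int n * u)" if "x \<noteq> 0" for x :: "complex fls"
    using that unfolding power_int_mult_distrib by (simp add: power_int_diff field_simps)
  have "p powi n - fls_X powi n - of_int n * fls_X powi (n - 1) * (p - fls_X)
     = fls_X powi n * ((1 + u) powi n - 1 - of_int n * u)"
    unfolding p by (rule alg) simp
  moreover have "order_ge (fls_X powi n) n" by (simp add: order_ge_iff)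
  ultimately show ?thesis using order_ge_mult[OF _ binomial_first_order[OF u k]] by simp
qed

text \<open>This crude bound suffices: it is applied to the power series left after splitting off
  \<open>fls_X powi n\<close>, where order k + 1 already counts as an error term.\<close>

lemma fps_compose_first_order:
  fixes \<phi> :: "complex fps"
  assumes \<phi>: "reparam \<phi>" and h: "order_ge (fps_to_fls \<phi> - fls_X) (k + 1)" and k: "0 < k"
  shows "order_ge (fps_to_fls G \<triangleleft> \<phi> - fps_to_fls G) (k + 1)"
  unfolding order_ge_def
proof (intro allI impI)
  fix m assume m: "m < k + 1"
  show "fls_nth (fps_to_fls G \<triangleleft> \<phi> - fps_to_fls G) m = 0"
  proof (cases "0 \<le> m")
    case True
    then obtain j where j: "m = int j" using nonneg_int_cases by blast
    have pw: "fps_nth (\<phi> ^ i) j = fps_nth (fps_X ^ i) j" for i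
    proof -
      have "order_ge (fps_to_fls \<phi> ^ i - fls_X ^ i) (k + 1)"
      proof (cases i)
        case (Suc i')
        have "order_ge (fps_to_fls \<phi> powi int i - fls_X powi int i
            - of_int (int i) * fls_X powi (int i - 1) * (fps_to_fls \<phi> - fls_X)) (int i + 2 * k)"
          by (rule power_first_order[OF h k])
        moreover have "order_ge (of_int (int i) * (fls_X powi (int i - 1) * (fps_to_fls \<phi> - fls_X))) (int i - 1 + (k + 1))"
          by (intro order_ge_of_int_mult order_ge_mult h) (simp add: order_ge_iff)
        ultimately have "order_ge ((fps_to_fls \<phi> powi int i - fls_X powi int i
            - of_int (int i) * fls_X powi (int i - 1) * (fps_to_fls \<phi> - fls_X))
            + of_int (int i) * (fls_X powi (int i - 1) * (fps_to_fls \<phi> - fls_X))) (k + 1)"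
          using k Suc by (intro order_ge_add) (erule order_ge_mono; simp)+
        thus ?thesis by (simp add: power_int_of_nat mult.assoc del: fls_X_power_int)
      qed simp
      hence "fls_nth (fps_to_fls (\<phi> ^ i - fps_X ^ i)) (int j) = 0"
        using m j unfolding order_ge_def by (simp add: fps_to_fls_power)
      thus ?thesis by simp
    qed
    have "fps_nth (fps_compose G \<phi>) j = fps_nth (fps_compose G fps_X) j"
      unfolding fps_compose_nth pw ..
    thus ?thesis using reparamD[OF \<phi>] by (simp add: j)
  qed (use reparamD[OF \<phi>] in simp)
qed

text \<open>This is the Taylor term \<open>F' * (\<phi> - X)\<close>. Its leading coefficient
  carries the factor n, so a series of order 0 may fail to notice the substitution. In the proof H
  is the Taylor term of \<open>fls_X powi n\<close>; all other contributions have order above n +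
  k.\<close>

lemma compose_first_order:
  assumes \<phi>: "reparam \<phi>" and h: "order_ge (fps_to_fls \<phi> - fls_X) (k + 1)" and k: "0 < k"
    and F: "order_ge F n"
  shows "order_ge (F \<triangleleft> \<phi> - F) (n + k)"
    and "fls_nth (F \<triangleleft> \<phi> - F) (n + k) = of_int n * fls_nth F n * fls_nth (fps_to_fls \<phi> - fls_X) (k + 1)"
proof -
  define p where "p = fps_to_fls \<phi>"
  define G where "G = fls_regpart (fls_shift n F)"
  have "0 \<le> fls_subdegree (fls_shift n F)" using F by (cases "F = 0") (auto simp: order_ge_iff)
  hence "fls_shift n F = fps_to_fls G" by (simp add: G_def)
  hence FG: "F = fls_X powi n * fps_to_fls G"
    by (simp add: fls_X_intpow_times_conv_shift flip: \<open>fls_shift n F = fps_to_fls G\<close>)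
  have rp: "reparam \<phi>" by fact
  have Fc: "F \<triangleleft> \<phi> = p powi n * (fps_to_fls G \<triangleleft> \<phi>)"
    unfolding FG p_def by (simp only: compose_simps[OF rp rp] fls_compose_fps_X)
  define E where "E = p powi n - fls_X powi n - of_int n * fls_X powi (n - 1) * (p - fls_X)"
  have E: "order_ge E (n + 2 * k)"
    unfolding E_def p_def by (rule power_first_order[OF h k])
  define H where "H = of_int n * (fls_X powi (n - 1) * (p - fls_X))"
  have H: "order_ge H (n + k)"
    using order_ge_mult[of "fls_X powi (n - 1)" "n - 1", OF _ h] unfolding H_def p_def
    by (intro order_ge_of_int_mult) (simp add: order_ge_iff)
  have Xn: "order_ge (fls_X powi n) n" by (simp add: order_ge_iff)
  have EH: "p powi n = fls_X powi n + H + E"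
    by (simp add: E_def H_def algebra_simps)
  have pn: "order_ge (p powi n) n"
    unfolding EH by (intro order_ge_add Xn order_ge_mono[OF H] order_ge_mono[OF E]) (use k in auto)
  have eq: "F \<triangleleft> \<phi> - F = H * fps_to_fls G + (p powi n * (fps_to_fls G \<triangleleft> \<phi> - fps_to_fls G) + E * fps_to_fls G)"
  proof -
    have "F \<triangleleft> \<phi> - F = p powi n * (fps_to_fls G \<triangleleft> \<phi>) - fls_X powi n * fps_to_fls G"
      unfolding Fc by (simp only: FG[symmetric])
    thus ?thesis unfolding EH by (simp only: algebra_simps)
  qed
  have G0: "order_ge (fps_to_fls G) 0" by (simp add: order_ge_def)
  have "order_ge (p powi n * (fps_to_fls G \<triangleleft> \<phi> - fps_to_fls G)) (n + k + 1)"
    using order_ge_mult[OF pn fps_compose_first_order[OF rp h k, of G]] by (simp add: add.assoc)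
  moreover have "order_ge (E * fps_to_fls G) (n + k + 1)"
    using order_ge_mult[OF E G0] by (rule order_ge_mono) (use k in auto)
  ultimately have r: "order_ge (p powi n * (fps_to_fls G \<triangleleft> \<phi> - fps_to_fls G) + E * fps_to_fls G) (n + k + 1)"
    by (rule order_ge_add)
  have HG: "order_ge (H * fps_to_fls G) (n + k)" using order_ge_mult[OF H G0] by simp
  show "order_ge (F \<triangleleft> \<phi> - F) (n + k)"
    unfolding eq by (intro order_ge_add HG order_ge_mono[OF r]) simp
  have "fls_nth (H * fps_to_fls G) (n + k + 0) = fls_nth H (n + k) * fls_nth (fps_to_fls G) 0"
    by (rule fls_nth_mult_leading[OF H G0])
  moreover have "fls_nth (fls_X powi (n - 1) * (p - fls_X)) (n - 1 + (k + 1)) = fls_nth (fls_X powi (n - 1)) (n - 1) * fls_nth (p - fls_X) (k + 1)"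
    by (rule fls_nth_mult_leading[OF _ h[folded p_def]]) (simp add: order_ge_iff)
  hence "fls_nth H (n + k) = of_int n * fls_nth (p - fls_X) (k + 1)"
    unfolding H_def by (simp add: fls_of_int)
  moreover have "fls_nth (fps_to_fls G) 0 = fls_nth F n" by (simp add: G_def)
  ultimately show "fls_nth (F \<triangleleft> \<phi> - F) (n + k) = of_int n * fls_nth F n * fls_nth (fps_to_fls \<phi> - fls_X) (k + 1)"
    unfolding eq using fls_nth_add_order_ge[OF r] by (simp add: p_def)
qed

text \<open>
  The mean value principle: how far a substitution tangent to the identity moves one nonconstant
  series determines how far it moves every other series.
\<close>

lemma close_compose_transfer:
  assumes \<phi>: "subdegree \<phi> = 1" "fps_nth \<phi> 1 = 1"
    and f: "fls_subdegree f \<noteq> 0" and j: "0 < j"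
    and ff: "order_ge (f \<triangleleft> \<phi> - f) (fls_subdegree f + j)"
    and F: "order_ge F n"
  shows "order_ge (F \<triangleleft> \<phi> - F) (n + j)"
proof (cases "fps_to_fls \<phi> - fls_X = 0")
  case True
  hence "\<phi> = fps_X" by (metis eq_iff_diff_eq_0 fls_X_conv_shift_1 fps_X_to_fls fps_to_fls_eq_iff)
  thus ?thesis using fls_nth_fls_compose_fps_linear[of 1 F] by (simp add: order_ge_def)
next
  case False
  have rp: "reparam \<phi>" using \<phi> by simp
  define k where "k = fls_subdegree (fps_to_fls \<phi> - fls_X) - 1"
  have h: "order_ge (fps_to_fls \<phi> - fls_X) (k + 1)" unfolding order_ge_iff by (simp add: k_def)
  have hk: "fls_nth (fps_to_fls \<phi> - fls_X) (k + 1) \<noteq> 0"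
    using False nth_fls_subdegree_nonzero[of "fps_to_fls \<phi> - fls_X"] unfolding k_def diff_add_cancel by blast
  have "order_ge (fps_to_fls \<phi> - fls_X) 2"
    unfolding order_ge_def
  proof (intro allI impI)
    fix m :: int assume "m < 2"
    then consider "m < 0" | "m = 0" | "m = 1" by linarith
    thus "fls_nth (fps_to_fls \<phi> - fls_X) m = 0"
      using reparamD[OF rp] \<phi> by cases auto
  qed
  hence k: "0 < k" using False by (simp add: k_def order_ge_iff)
  have fe: "order_ge f (fls_subdegree f)" by (simp add: order_ge_iff)
  have f0: "f \<noteq> 0" using f by auto
  \<comment> \<open>The coefficient is the nonzero order of f times two nonzero leading
    coefficients. So f detects the exact distance k of \<phi> from the identity, and
    \<open>j \<le> k\<close>.\<close>
  have "fls_nth (f \<triangleleft> \<phi> - f) (fls_subdegree f + k) \<noteq> 0"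
    using compose_first_order(2)[OF rp h k fe] hk f f0 by simp
  hence "\<not> fls_subdegree f + k < fls_subdegree f + j" using ff unfolding order_ge_def by blast
  thus ?thesis
    using compose_first_order(1)[OF rp h k F] order_ge_mono by fastforce
qed

section \<open>Exponential factors\<close>

abbreviation coef :: "expfactor \<Rightarrow> rat \<Rightarrow> complex" where "coef \<equiv> Poly_Mapping.lookup"
abbreviation exponents :: "expfactor \<Rightarrow> rat set" where "exponents \<equiv> Poly_Mapping.keys"

lemma exponents_iff: "e \<in> exponents q \<longleftrightarrow> coef q e \<noteq> 0"
  by (simp add: in_keys_iff)

lemma clears_denominators_floor:
  "clears_denominators N q \<Longrightarrow> e \<in> exponents q \<Longrightarrow> of_int \<lfloor>e * of_nat N\<rfloor> = e * of_nat N"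
  unfolding clears_denominators_def by (elim conjE ballE[of _ _ e] Ints_cases) simp_all

lemma clears_denominators_pos: "clears_denominators N q \<Longrightarrow> 0 < N"
  by (simp add: clears_denominators_def)

lemma clears_denominators_mult:
  assumes "clears_denominators N q" "0 < m"
  shows "clears_denominators (N * m) q"
  using assms unfolding clears_denominators_def
  by (auto simp flip: mult.assoc intro!: Ints_mult)

lemma exponents_diff_subset: "exponents (q - q') \<subseteq> exponents q \<union> exponents q'"
  by (auto simp: exponents_iff lookup_minus)

lemma clears_denominators_diff:
  "clears_denominators N q \<Longrightarrow> clears_denominators N q' \<Longrightarrow> clears_denominators N (q - q')"
  using exponents_diff_subset[of q q'] unfolding clears_denominators_def by blast

lemma exp_factor_diff: "exp_factor q \<Longrightarrow> exp_factor q' \<Longrightarrow> exp_factor (q - q')"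
  using exponents_diff_subset[of q q'] unfolding exp_factor_def by blast

lemma exp_factor_0 [simp]: "exp_factor 0"
  by (simp add: exp_factor_def)

lemma exponents_single: "exponents (Poly_Mapping.single e c) = (if c = 0 then {} else {e})"
  by simp

lemma exp_factor_single: "0 < e \<Longrightarrow> exp_factor (Poly_Mapping.single e c)"
  by (simp add: exp_factor_def)

lemma clears_denominators_cong:
  "exponents q = exponents q' \<Longrightarrow> clears_denominators N q \<longleftrightarrow> clears_denominators N q'"
  by (simp add: clears_denominators_def)

lemma exists_clears_denominators: "\<exists>N. clears_denominators N q"
proof -
  have "\<exists>N>0. \<forall>e\<in>A. e * of_nat N \<in> \<int>" if "finite A" for A :: "rat set"
    using that
  proof induction
    case empty
    thus ?case by auto
  next
    case (insert e A)
    then obtain N where N: "0 < N" "\<forall>e\<in>A. e * of_nat N \<in> \<int>" by blast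
    obtain a b where ab: "0 < b" "e = of_int a / of_int b"
      by (cases e rule: Rat_cases) (auto simp: Fract_of_int_quotient)
    have b: "of_nat (nat b) = (of_int b :: rat)" using ab(1) by simp
    have "e * of_nat (N * nat b) = of_int a * of_nat N" using ab by (simp add: b)
    hence "e * of_nat (N * nat b) \<in> \<int>" by (metis Ints_mult Ints_of_int Ints_of_nat)
    moreover have "e' * of_nat (N * nat b) \<in> \<int>" if "e' \<in> A" for e'
    proof -
      have "e' * of_nat (N * nat b) = (e' * of_nat N) * of_nat (nat b)" by simp
      thus ?thesis using N that by (metis Ints_mult Ints_of_nat)
    qed
    ultimately show ?case using N ab(1) by (intro exI[of _ "N * nat b"]) auto
  qed
  from this[of "exponents q"] show ?thesis unfolding clears_denominators_def by (auto simp: Suc_le_eq)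
qed

lemma clears_denominators_ram: "clears_denominators (ram q) q"
  unfolding ram_def using exists_clears_denominators by (rule LeastI_ex)

lemma ram_pos: "0 < ram q"
  using clears_denominators_ram clears_denominators_pos by blast

lemma ram_le: "clears_denominators N q \<Longrightarrow> ram q \<le> N"
  unfolding ram_def by (rule Least_le)

lemma ram_cong: "exponents q = exponents q' \<Longrightarrow> ram q = ram q'"
  unfolding ram_def using clears_denominators_cong by metis

text \<open>The remainder \<open>N mod ram q\<close>, if positive, would clear the denominators too,
  against the minimality of \<open>ram q\<close>.\<close>

lemma ram_dvd:
  assumes "clears_denominators N q"
  shows "ram q dvd N"
proof (rule ccontr)
  assume "\<not> ram q dvd N"
  hence pos: "0 < N mod ram q" by (simp add: mod_greater_zero_iff_not_dvd)
  have "clears_denominators (N mod ram q) q"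
    unfolding clears_denominators_def
  proof (intro conjI ballI)
    fix e assume e: "e \<in> exponents q"
    have "e * of_nat (N mod ram q) = e * of_nat N - (e * of_nat (ram q)) * of_nat (N div ram q)"
    proof -
      have "(of_nat N :: rat) = of_nat (N mod ram q) + of_nat (ram q) * of_nat (N div ram q)"
        by (metis mod_mult_div_eq of_nat_add of_nat_mult)
      thus ?thesis by (simp add: algebra_simps)
    qed
    moreover have "e * of_nat N \<in> \<int>" "e * of_nat (ram q) \<in> \<int>"
      using assms clears_denominators_ram[of q] e unfolding clears_denominators_def by auto
    ultimately show "e * of_nat (N mod ram q) \<in> \<int>"
      by (metis Ints_diff Ints_mult Ints_of_nat)
  qed (use pos in simp)
  hence "ram q \<le> N mod ram q" by (rule ram_le)
  thus False using mod_less_divisor[OF ram_pos] by (metis not_less)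
qed

lemma slope_eq:
  assumes "exp_factor q"
  shows "slope q = (if q = 0 then 0 else Max (exponents q))"
proof (cases "q = 0")
  case False
  define M where "M = Max (exponents q)"
  have M: "M \<in> exponents q" unfolding M_def using False by (intro Max_in) auto
  have "0 < M" using M assms by (simp add: exp_factor_def)
  hence "of_nat (nat \<lfloor>M * of_nat (ram q)\<rfloor>) = (of_int \<lfloor>M * of_nat (ram q)\<rfloor> :: rat)"
    by (simp add: ram_pos)
  thus ?thesis
    using False ram_pos[of q] clears_denominators_floor[OF clears_denominators_ram M]
    by (simp add: slope_def irr_def M_def[symmetric])
qed (simp add: slope_def irr_def)

lemma slope_le_iff:
  assumes "exp_factor q" "0 \<le> s"
  shows "slope q \<le> s \<longleftrightarrow> (\<forall>e\<in>exponents q. e \<le> s)"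
  using assms by (cases "q = 0") (simp_all add: slope_eq)

lemma slope_pos: "exp_factor q \<Longrightarrow> q \<noteq> 0 \<Longrightarrow> 0 < slope q"
  using Max_in[of "exponents q"] by (simp add: slope_eq) (simp add: exp_factor_def)

lemma slope_0 [simp]: "slope 0 = 0"
  by (simp add: slope_eq)

lemma slope_nonneg: "exp_factor q \<Longrightarrow> 0 \<le> slope q"
  by (cases "q = 0") (auto intro: less_imp_le slope_pos)

lemma slope_eq_0_iff: "exp_factor q \<Longrightarrow> slope q = 0 \<longleftrightarrow> q = 0"
  using slope_pos[of q] by (cases "q = 0") auto

lemma slope_diff_le:
  assumes "exp_factor q" "exp_factor q'" "slope q \<le> s" "slope q' \<le> s"
  shows "slope (q - q') \<le> s"
proof -
  have "0 \<le> s" using slope_nonneg[OF assms(1)] assms(3) by linarith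
  thus ?thesis
    using assms exponents_diff_subset[of q q'] exp_factor_diff[OF assms(1,2)]
    by (auto simp: slope_le_iff)
qed

subsection \<open>Expansion along a uniformiser\<close>

lemma expand_factor_superset:
  assumes "finite A" "exponents q \<subseteq> A"
  shows "expand_factor N x q = (\<Sum>e\<in>A. fls_const (coef q e) * x powi (- \<lfloor>e * of_nat N\<rfloor>))"
  unfolding expand_factor_def using assms
  by (intro sum.mono_neutral_left) (auto simp: exponents_iff)

lemma expand_factor_0 [simp]: "expand_factor N x 0 = 0"
  by (simp add: expand_factor_def)

lemma expand_factor_single:
  "expand_factor N x (Poly_Mapping.single e c) = fls_const c * x powi (- \<lfloor>e * of_nat N\<rfloor>)"
  by (subst expand_factor_superset[of "{e}"]) (auto simp: exponents_single)

lemma expand_factor_add: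
  "expand_factor N x (q + q') = expand_factor N x q + expand_factor N x q'"
proof -
  let ?A = "exponents q \<union> exponents q'"
  have "exponents (q + q') \<subseteq> ?A" by (auto simp: exponents_iff lookup_add)
  thus ?thesis
    by (subst (1 2 3) expand_factor_superset[of ?A])
      (auto simp: lookup_add distrib_right sum.distrib simp flip: fls_plus_const)
qed

lemma expand_factor_diff:
  "expand_factor N x (q - q') = expand_factor N x q - expand_factor N x q'"
  using expand_factor_add[of N x "q - q'" q'] by simp

lemma expand_factor_compose:
  "reparam \<phi> \<Longrightarrow> expand_factor N x q \<triangleleft> \<phi> = expand_factor N (x \<triangleleft> \<phi>) q"
  unfolding expand_factor_def by (simp add: compose_sum compose_simps)

lemma expand_factor_power:
  assumes "clears_denominators N q"
  shows "expand_factor N (s ^ m) q = expand_factor (N * m) s q"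
  unfolding expand_factor_def
proof (intro sum.cong refl arg_cong[of _ _ "\<lambda>y. fls_const _ * y"])
  fix e assume e: "e \<in> exponents q"
  have "\<lfloor>e * of_nat (N * m)\<rfloor> = \<lfloor>of_int \<lfloor>e * of_nat N\<rfloor> * of_nat m :: rat\<rfloor>"
    by (simp add: clears_denominators_floor[OF assms e] mult.assoc)
  also have "(of_int \<lfloor>e * of_nat N\<rfloor> * of_nat m :: rat) = of_int (\<lfloor>e * of_nat N\<rfloor> * int m)" by simp
  also have "\<lfloor>\<dots>\<rfloor> = \<lfloor>e * of_nat N\<rfloor> * int m" by (rule floor_of_int)
  finally show "(s ^ m) powi (- \<lfloor>e * of_nat N\<rfloor>) = s powi (- \<lfloor>e * of_nat (N * m)\<rfloor>)"
    by (simp only: power_int_power mult.commute minus_mult_right)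
qed

lemma subdegree_expand_factor:
  assumes N: "clears_denominators N q" and q: "q \<noteq> 0" and s: "fls_subdegree s = 1"
  shows "expand_factor N s q \<noteq> 0"
    and "of_int (fls_subdegree (expand_factor N s q)) = - (Max (exponents q) * of_nat N)"
proof -
  define M where "M = Max (exponents q)"
  have M: "M \<in> exponents q" unfolding M_def using q by (intro Max_in) auto
  have s0: "s \<noteq> 0" using s by auto
  define T where "T = fls_const (coef q M) * s powi (- \<lfloor>M * of_nat N\<rfloor>)"
  have T0: "T \<noteq> 0" using M s0 by (simp add: T_def exponents_iff power_int_eq_0_iff)
  have Td: "fls_subdegree T = - \<lfloor>M * of_nat N\<rfloor>"
    using T0 s by (simp add: T_def)
  define R where "R = (\<Sum>e\<in>exponents q - {M}. fls_const (coef q e) * s powi (- \<lfloor>e * of_nat N\<rfloor>))"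
  have "expand_factor N s q = T + R"
    unfolding expand_factor_def T_def R_def using M by (subst sum.remove[of _ M]) auto
  moreover have "order_ge R (fls_subdegree T + 1)"
    unfolding R_def
  proof (intro order_ge_sum order_ge_const_mult)
    fix e assume e: "e \<in> exponents q - {M}"
    hence "e < M" unfolding M_def by (metis Diff_iff Max_ge finite_keys insertI1 order_less_le)
    hence "e * of_nat N < M * of_nat N" using clears_denominators_pos[OF N] by simp
    hence "of_int \<lfloor>e * of_nat N\<rfloor> < (of_int \<lfloor>M * of_nat N\<rfloor> :: rat)"
      using e M clears_denominators_floor[OF N] by (metis DiffD1)
    hence "\<lfloor>e * of_nat N\<rfloor> < \<lfloor>M * of_nat N\<rfloor>" by (simp only: of_int_less_iff)
    thus "order_ge (s powi (- \<lfloor>e * of_nat N\<rfloor>)) (fls_subdegree T + 1)"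
      using s s0 Td by (simp add: order_ge_iff)
  qed
  ultimately have "expand_factor N s q \<noteq> 0" "fls_subdegree (expand_factor N s q) = fls_subdegree T"
    using subdegree_add_order_ge[OF T0] by auto
  thus "expand_factor N s q \<noteq> 0"
    and "of_int (fls_subdegree (expand_factor N s q)) = - (Max (exponents q) * of_nat N)"
    using Td clears_denominators_floor[OF N M] by (simp_all add: M_def)
qed

lemma order_ge_expand_factor_iff:
  assumes "clears_denominators N q" "exp_factor q" "fls_subdegree s = 1" "0 \<le> k"
  shows "order_ge (expand_factor N s q) (- k) \<longleftrightarrow> slope q * of_nat N \<le> of_int k"
proof (cases "q = 0")
  case True
  thus ?thesis using assms by (simp add: slope_eq)
next
  case False
  note * = subdegree_expand_factor[OF assms(1) False assms(3)]
  have "- k \<le> fls_subdegree (expand_factor N s q)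
     \<longleftrightarrow> (of_int (- k) :: rat) \<le> of_int (fls_subdegree (expand_factor N s q))"
    by (rule of_int_le_iff[symmetric])
  thus ?thesis using * False assms(2) by (auto simp: order_ge_iff slope_eq)
qed

text \<open>The dictionary behind all slope computations: slopes are pole orders of dq on a cover of
  degree N. For \<open>0 \<le> k\<close> no constant term interferes, so differentiation shifts the
  bound by exactly one.\<close>

lemma order_ge_deriv_expand_factor_iff:
  assumes "clears_denominators N q" "exp_factor q" "fls_subdegree s = 1" "0 \<le> k"
  shows "order_ge (fls_deriv (expand_factor N s q)) (- k - 1) \<longleftrightarrow> slope q * of_nat N \<le> of_int k"
  using order_ge_expand_factor_iff[OF assms] order_ge_deriv[of _ "- k"]
    order_ge_deriv_cancel[of _ "- k"] assms(4) by (metis neg_le_0_iff_le)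

text \<open>This is the case k = 0 of the dictionary: a difference whose derivative has at most a
  logarithmic pole has slope 0, hence vanishes.\<close>

lemma expand_factor_eqI:
  assumes "clears_denominators N q" "clears_denominators N q'" "exp_factor q" "exp_factor q'"
    and "fls_subdegree s = 1"
    and "order_ge (fls_deriv (expand_factor N s q) - fls_deriv (expand_factor N s q')) (-1)"
  shows "q = q'"
proof -
  have "order_ge (fls_deriv (expand_factor N s (q - q'))) (- 0 - 1)"
    using assms(6) by (simp add: expand_factor_diff)
  hence "slope (q - q') * of_nat N \<le> of_int 0"
    using order_ge_deriv_expand_factor_iff[of N "q - q'" s 0] assms clears_denominators_diff exp_factor_diff
    by blast
  hence "slope (q - q') \<le> 0" using clears_denominators_pos[OF assms(1)]
    by (simp add: mult_le_0_iff)
  hence "q - q' = 0"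
    using slope_nonneg slope_eq_0_iff exp_factor_diff[OF assms(3,4)] by (metis order_antisym)
  thus ?thesis by simp
qed

text \<open>The leading terms of the pole are removed one by one. The process has to stop at order
  -1, as a derivative has no residue.\<close>

lemma exists_expand_factor:
  assumes s: "fls_subdegree s = 1" and N: "0 < N"
  shows "\<exists>q. exp_factor q \<and> clears_denominators N q \<and>
    order_ge (f - fls_deriv (expand_factor N s q)) (-1)"
proof -
  have "\<exists>q. exp_factor q \<and> clears_denominators N q \<and>
    order_ge (f - fls_deriv (expand_factor N s q)) (-1)"
    if "order_ge f (- 1 - int n)" for f n
    using that
  proof (induction n arbitrary: f)
    case 0
    thus ?case using N by (intro exI[of _ 0]) (simp add: clears_denominators_def)
  next
    case (Suc n)
    define k where "k = int (Suc n)"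
    define g where "g = fls_deriv (s powi (- k))"
    have s0: "s \<noteq> 0" using s by auto
    have "fls_subdegree (s powi (- k)) = - k" using s by simp
    hence g: "fls_subdegree g = - k - 1"
      unfolding g_def by (subst fls_subdegree_deriv) (simp_all add: k_def)
    hence g0: "g \<noteq> 0" by (auto simp: k_def)
    have gn: "fls_nth g (- k - 1) \<noteq> 0" using g0 g nth_fls_subdegree_nonzero by metis
    define c where "c = fls_nth f (- k - 1) / fls_nth g (- k - 1)"
    define q1 :: expfactor where "q1 = Poly_Mapping.single (of_int k / of_nat N) c"
    have e1: "expand_factor N s q1 = fls_const c * s powi (- k)"
      using N by (simp add: q1_def expand_factor_single)
    have d1: "fls_deriv (expand_factor N s q1) = fls_const c * g"
      by (simp add: e1 g_def)
    have og: "order_ge g (- k - 1)" by (simp add: order_ge_iff g)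
    have "order_ge (f - fls_deriv (expand_factor N s q1)) (- k - 1)"
      unfolding d1 using Suc.prems by (intro order_ge_diff order_ge_const_mult og) (simp add: k_def)
    moreover have "fls_nth (f - fls_deriv (expand_factor N s q1)) (- k - 1) = 0"
      using gn by (simp add: d1 c_def)
    ultimately have "order_ge (f - fls_deriv (expand_factor N s q1)) (- 1 - int n)"
      using order_ge_Suc by (fastforce simp: k_def)
    from Suc.IH[OF this] obtain q where q: "exp_factor q" "clears_denominators N q"
      "order_ge (f - fls_deriv (expand_factor N s q1) - fls_deriv (expand_factor N s q)) (-1)" by blast
    have ex: "exponents (q1 + q) \<subseteq> exponents q1 \<union> exponents q" by (auto simp: exponents_iff lookup_add)
    have "exp_factor q1" unfolding q1_def by (rule exp_factor_single) (use N in \<open>simp add: k_def\<close>)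
    moreover have "clears_denominators N q1"
      using N by (auto simp: clears_denominators_def q1_def exponents_single split: if_splits)
    ultimately have "exp_factor (q1 + q)" "clears_denominators N (q1 + q)"
      using q ex unfolding exp_factor_def clears_denominators_def by blast+
    moreover have "order_ge (f - fls_deriv (expand_factor N s (q1 + q))) (-1)"
      using q(3) by (simp add: expand_factor_add algebra_simps)
    ultimately show ?case by blast
  qed
  moreover have "order_ge f (- 1 - int (nat (- 1 - fls_subdegree f)))"
    by (auto simp: order_ge_iff)
  ultimately show ?thesis by blast
qed

subsection \<open>Galois conjugation\<close>

text \<open>Conjugation relative to any common denominator N instead of the minimal one, so that
  factors with different ramification can be treated on one cover.\<close>

definition rotate_factor :: "nat \<Rightarrow> complex \<Rightarrow> expfactor \<Rightarrow> expfactor" where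
  "rotate_factor N \<omega> q = Poly_Mapping.mapp (\<lambda>e c. \<omega> powi (- \<lfloor>e * of_nat N\<rfloor>) * c) q"

lemma galois_conj_eq_rotate: "galois_conj \<omega> q = rotate_factor (ram q) \<omega> q"
  by (simp add: galois_conj_def rotate_factor_def)

lemma coef_mapp_mult: "coef (Poly_Mapping.mapp (\<lambda>e c. f e * c) q) e = f e * coef q e"
  by (simp add: lookup_mapp when_def exponents_iff)

lemma coef_rotate_factor: "coef (rotate_factor N \<omega> q) e = \<omega> powi (- \<lfloor>e * of_nat N\<rfloor>) * coef q e"
  unfolding rotate_factor_def by (rule coef_mapp_mult)

lemma exponents_rotate_factor: "\<omega> \<noteq> 0 \<Longrightarrow> exponents (rotate_factor N \<omega> q) = exponents q"
  by (auto simp: exponents_iff coef_rotate_factor)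

lemma rotate_factor_1 [simp]: "rotate_factor N 1 q = q"
  by (intro poly_mapping_eqI) (simp add: coef_rotate_factor)

lemma rotate_factor_rotate_factor:
  "rotate_factor N \<omega> (rotate_factor N \<eta> q) = rotate_factor N (\<omega> * \<eta>) q"
  by (intro poly_mapping_eqI) (simp add: coef_rotate_factor power_int_mult_distrib)

lemma root_of_unity_nonzero: "\<omega> ^ N = 1 \<Longrightarrow> 0 < N \<Longrightarrow> \<omega> \<noteq> (0::complex)"
  by (auto simp: power_0_left)

lemma expand_factor_rotate:
  assumes "\<omega> \<noteq> 0"
  shows "expand_factor N (fls_const \<omega> * s) q = expand_factor N s (rotate_factor N \<omega> q)"
  unfolding expand_factor_def exponents_rotate_factor[OF assms]
  by (intro sum.cong refl)
    (simp add: coef_rotate_factor power_int_mult_distrib fls_const_power_int flip: fls_const_mult_const)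

lemma rotate_factor_mult:
  assumes "clears_denominators N q"
  shows "rotate_factor (N * m) \<eta> q = rotate_factor N (\<eta> ^ m) q"
proof (rule poly_mapping_eqI)
  fix e
  show "coef (rotate_factor (N * m) \<eta> q) e = coef (rotate_factor N (\<eta> ^ m) q) e"
  proof (cases "e \<in> exponents q")
    case True
    have "e * of_nat (N * m) = of_int (\<lfloor>e * of_nat N\<rfloor> * int m)"
      by (simp add: clears_denominators_floor[OF assms True] mult.assoc)
    hence "\<lfloor>e * of_nat (N * m)\<rfloor> = \<lfloor>e * of_nat N\<rfloor> * int m" by (simp only: floor_of_int)
    thus ?thesis
      by (simp only: coef_rotate_factor power_int_power mult.commute minus_mult_right)
  qed (simp add: coef_rotate_factor exponents_iff)
qed

lemma exists_complex_root: "0 < m \<Longrightarrow> \<exists>\<eta>::complex. \<eta> ^ m = \<omega>"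
  by (rule exI[of _ "if \<omega> = 0 then 0 else exp (ln \<omega> / of_nat m)"])
    (auto simp: power_0_left simp flip: exp_of_nat_mult)

text \<open>Every root of unity of order dividing \<open>ram q\<close> is an m-th power of an N-th
  root of unity, so the larger denominator yields the same conjugates.\<close>

lemma galois_orbit_eq:
  assumes "clears_denominators N q"
  shows "galois_orbit q = {rotate_factor N \<omega> q |\<omega>. \<omega> ^ N = 1}"
proof -
  obtain m where m: "N = ram q * m" using ram_dvd[OF assms] by blast
  have m0: "0 < m" using m clears_denominators_pos[OF assms] by (cases m) auto
  note rot = rotate_factor_mult[OF clears_denominators_ram, of q m, folded m]
  have pw: "\<eta> ^ N = (\<eta> ^ m) ^ ram q" for \<eta> :: complex
    by (subst m, subst mult.commute) (rule power_mult)
  show ?thesis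
  proof (intro Set.set_eqI iffI)
    fix x assume "x \<in> galois_orbit q"
    then obtain \<omega> where w: "x = rotate_factor (ram q) \<omega> q" "\<omega> ^ ram q = 1"
      by (auto simp: galois_orbit_def galois_conj_eq_rotate)
    obtain \<eta> where "\<eta> ^ m = \<omega>" using exists_complex_root[OF m0] by blast
    with w show "x \<in> {rotate_factor N \<omega> q |\<omega>. \<omega> ^ N = 1}"
      by (intro CollectI exI[of _ \<eta>]) (simp add: rot pw)
  next
    fix x assume "x \<in> {rotate_factor N \<omega> q |\<omega>. \<omega> ^ N = 1}"
    then obtain \<eta> where "x = rotate_factor N \<eta> q" "\<eta> ^ N = 1" by blast
    thus "x \<in> galois_orbit q"
      unfolding galois_orbit_def galois_conj_eq_rotate
      by (intro CollectI exI[of _ "\<eta> ^ m"]) (simp add: rot flip: pw)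
  qed
qed

lemma galois_orbit_refl: "q \<in> galois_orbit q"
  using galois_orbit_eq[OF clears_denominators_ram, of q] by (force intro: exI[of _ 1])

lemma galois_orbitE:
  assumes "q' \<in> galois_orbit q" "clears_denominators N q"
  obtains \<omega> where "\<omega> ^ N = 1" "\<omega> \<noteq> 0" "q' = rotate_factor N \<omega> q"
  using assms galois_orbit_eq[OF assms(2)] root_of_unity_nonzero clears_denominators_pos by blast

lemma exponents_galois_orbit:
  assumes "q' \<in> galois_orbit q"
  shows "exponents q' = exponents q"
  using galois_orbitE[OF assms clears_denominators_ram] exponents_rotate_factor by metis

lemma clears_denominators_galois_orbit:
  "q' \<in> galois_orbit q \<Longrightarrow> clears_denominators N q' \<longleftrightarrow> clears_denominators N q"
  by (intro clears_denominators_cong exponents_galois_orbit)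

lemma exp_factor_galois_orbit: "q' \<in> galois_orbit q \<Longrightarrow> exp_factor q' \<longleftrightarrow> exp_factor q"
  by (simp add: exp_factor_def exponents_galois_orbit)

lemma ram_galois_orbit: "q' \<in> galois_orbit q \<Longrightarrow> ram q' = ram q"
  by (intro ram_cong exponents_galois_orbit)

lemma slope_galois_orbit: "q' \<in> galois_orbit q \<Longrightarrow> slope q' = slope q"
proof -
  assume q': "q' \<in> galois_orbit q"
  hence "exponents q' = exponents q" "ram q' = ram q"
    by (rule exponents_galois_orbit, rule ram_galois_orbit)
  moreover from this have "q' = 0 \<longleftrightarrow> q = 0" by (metis keys_eq_empty)
  ultimately show ?thesis by (simp add: slope_def irr_def)
qed

lemma galois_orbit_cong:
  assumes "q' \<in> galois_orbit q"
  shows "galois_orbit q' = galois_orbit q"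
proof -
  define N where "N = ram q"
  have N: "clears_denominators N q" "clears_denominators N q'"
    using assms clears_denominators_ram clears_denominators_galois_orbit by (auto simp: N_def)
  obtain \<omega> where w: "\<omega> ^ N = 1" "\<omega> \<noteq> 0" "q' = rotate_factor N \<omega> q"
    using galois_orbitE[OF assms N(1)] .
  show ?thesis
    unfolding N[THEN galois_orbit_eq]
  proof (intro Set.set_eqI iffI; clarify)
    fix \<eta> :: complex assume "\<eta> ^ N = 1"
    thus "\<exists>\<omega>. rotate_factor N \<eta> q' = rotate_factor N \<omega> q \<and> \<omega> ^ N = 1"
      by (intro exI[of _ "\<eta> * \<omega>"]) (simp add: w rotate_factor_rotate_factor power_mult_distrib)
  next
    fix \<eta> :: complex assume "\<eta> ^ N = 1"
    thus "\<exists>\<omega>. rotate_factor N \<eta> q = rotate_factor N \<omega> q' \<and> \<omega> ^ N = 1"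
      by (intro exI[of _ "\<eta> / \<omega>"]) (simp add: w rotate_factor_rotate_factor power_divide)
  qed
qed

lemma finite_galois_orbit: "finite (galois_orbit q)"
proof -
  have "galois_orbit q = (\<lambda>\<omega>. galois_conj \<omega> q) ` {\<omega>. \<omega> ^ ram q = 1}"
    by (auto simp: galois_orbit_def)
  thus ?thesis using finite_roots_unity[of "ram q", where ?'a = complex] ram_pos[of q] by simp
qed

text \<open>At an integer exponent the rotation is by a power of
  \<open>\<omega> ^ ram q = 1\<close>. For exponent 1 this makes the linear coefficient, which
  \<open>fourier_circle\<close> uses as the target point, an invariant of the circle.\<close>

lemma coef_galois_orbit_of_int:
  assumes "q' \<in> galois_orbit q"
  shows "coef q' (of_int i) = coef q (of_int i)"
proof -
  obtain \<omega> where w: "\<omega> ^ ram q = 1" "q' = rotate_factor (ram q) \<omega> q"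
    using galois_orbitE[OF assms clears_denominators_ram] .
  have "\<lfloor>of_int i * of_nat (ram q) :: rat\<rfloor> = int (ram q) * i"
    by (metis floor_of_int mult.commute of_int_mult of_int_of_nat_eq)
  hence "\<omega> powi (- \<lfloor>of_int i * of_nat (ram q) :: rat\<rfloor>) = (\<omega> ^ ram q) powi (- i)"
    by (simp only: power_int_power mult_minus_right)
  thus ?thesis using w by (simp add: coef_rotate_factor)
qed

lemma galois_orbit_0 [simp]: "galois_orbit 0 = {0}"
proof -
  have "q = 0" if "q \<in> galois_orbit 0" for q
    using exponents_galois_orbit[OF that] by simp
  thus ?thesis using galois_orbit_refl[of 0] by blast
qed

section \<open>Substitutions carrying a series to a nearby one\<close>

lemma order_ge_X [simp]: "order_ge fls_X 1"
  by (simp add: order_ge_iff)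

lemma fls_nth_compose_leading:
  assumes "subdegree \<phi> = 1" "order_ge f 1"
  shows "fls_nth (f \<triangleleft> \<phi>) 1 = fls_nth f 1 * fps_nth \<phi> 1"
proof -
  have rp: "reparam \<phi>" using assms by simp
  define c where "c = fls_nth f 1"
  have "order_ge (f - fls_const c * fls_X) (1 + 1)"
    by (intro order_ge_Suc order_ge_diff assms order_ge_const_mult) (simp_all add: c_def)
  hence "order_ge ((f - fls_const c * fls_X) \<triangleleft> \<phi>) 2"
    using order_ge_compose_unif[OF assms(1)] by simp
  hence "fls_nth ((f - fls_const c * fls_X) \<triangleleft> \<phi>) 1 = 0" unfolding order_ge_def by simp
  thus ?thesis by (simp add: compose_simps[OF rp rp] c_def)
qed

text \<open>Take m-th roots s and t of f and g, where m is the common order, with the same leading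
  coefficient. The substitution carrying s to t then has linear coefficient 1.\<close>

lemma tangent_compose_exists_pos:
  assumes f: "0 < fls_subdegree f" and g: "order_ge (g - f) (fls_subdegree f + 1)"
  shows "\<exists>\<phi>. subdegree \<phi> = 1 \<and> fps_nth \<phi> 1 = 1 \<and> f \<triangleleft> \<phi> = g"
proof -
  define m where "m = nat (fls_subdegree f)"
  have m: "0 < m" "fls_subdegree f = int m * 1" using f by (auto simp: m_def)
  have f0: "f \<noteq> 0" using f by auto
  have g': "fls_subdegree g = fls_subdegree f" "g \<noteq> 0"
    using subdegree_add_order_ge[OF f0 g] by simp_all
  have lead: "fls_nth g (fls_subdegree f) = fls_nth f (fls_subdegree f)"
    using fls_nth_add_order_ge[OF g, of f] by simp
  obtain c where c: "c ^ m = fls_nth f (fls_subdegree f)" using exists_complex_root[OF m(1)] by blast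
  obtain s where s: "fls_subdegree s = 1" "fls_nth s 1 = c" "s ^ m = f"
    using exists_root[OF f0 m(1,2) c] by blast
  obtain t where t: "fls_subdegree t = 1" "fls_nth t 1 = c" "t ^ m = g"
    using exists_root[of g m 1 c] g' m c lead by auto
  have c0: "c \<noteq> 0" using s by (metis nth_fls_subdegree_nonzero fls_zero_subdegree zero_neq_one)
  obtain \<phi> where \<phi>: "int (subdegree \<phi>) = fls_subdegree t" "s \<triangleleft> \<phi> = t"
    using exists_reparam[OF s(1), of t] t(1) by auto
  have d: "subdegree \<phi> = 1" using \<phi>(1) t(1) by simp
  hence rp: "reparam \<phi>" by simp
  have "fls_nth (s \<triangleleft> \<phi>) 1 = c * fps_nth \<phi> 1"
    using fls_nth_compose_leading[OF d, of s] s by (simp add: order_ge_iff)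
  hence "fps_nth \<phi> 1 = 1" using \<phi>(2) t(2) c0 by simp
  moreover have "f \<triangleleft> \<phi> = g"
    unfolding s(3)[symmetric] t(3)[symmetric] by (simp add: compose_simps[OF rp rp] \<phi>(2))
  ultimately show ?thesis using d by blast
qed

lemma order_ge_inverse_diff:
  assumes "f \<noteq> 0" "order_ge (g - f) (fls_subdegree f + j)" "0 < j"
  shows "order_ge (inverse g - inverse f) (fls_subdegree (inverse f) + j)"
proof -
  have g: "fls_subdegree g = fls_subdegree f" "g \<noteq> 0"
    using subdegree_add_order_ge[OF assms(1), of "g - f"] order_ge_mono[OF assms(2)] assms(3) by simp_all
  have "inverse g - inverse f = (- (g - f)) / (f * g)"
    using assms(1) g(2) by (simp add: field_simps)
  moreover have "order_ge (- (g - f) / (f * g)) (fls_subdegree f + j - fls_subdegree (f * g))"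
    using assms(1) g(2) order_ge_minus[of "g - f"] assms(2) by (intro order_ge_divide) (simp_all only: mult_eq_0_iff, simp)
  ultimately show ?thesis using assms(1) g by (simp add: algebra_simps)
qed

text \<open>Inversion turns a pole into a zero and keeps the relative precision.\<close>

lemma tangent_compose_exists:
  assumes f: "fls_subdegree f \<noteq> 0" and g: "order_ge (g - f) (fls_subdegree f + 1)"
  shows "\<exists>\<phi>. subdegree \<phi> = 1 \<and> fps_nth \<phi> 1 = 1 \<and> f \<triangleleft> \<phi> = g"
proof (cases "0 < fls_subdegree f")
  case True
  thus ?thesis using tangent_compose_exists_pos g by blast
next
  case False
  have f0: "f \<noteq> 0" using f by auto
  have "0 < fls_subdegree (inverse f)" using False f by simp
  moreover have "order_ge (inverse g - inverse f) (fls_subdegree (inverse f) + 1)"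
    using order_ge_inverse_diff[OF f0 g] by simp
  ultimately obtain \<phi> where "subdegree \<phi> = 1" "fps_nth \<phi> 1 = 1" "inverse f \<triangleleft> \<phi> = inverse g"
    using tangent_compose_exists_pos by blast
  moreover from this have "f \<triangleleft> \<phi> = g"
    using compose_simps(4)[of \<phi> "inverse f"] by simp
  ultimately show ?thesis by blast
qed

section \<open>Curves parametrizing circles\<close>

text \<open>The condition concerns the form \<open>\<Xi> dZ\<close>, not \<Xi>, because forms with a
  logarithmic pole are stable under substitutions. The parameter x may have any positive order, so a
  circle may be covered several times; this lets different circles share a parameter.\<close>

definition parametrizes :: "P1 \<Rightarrow> expfactor \<Rightarrow> complex fls \<Rightarrow> complex fls \<Rightarrow> bool" where
  "parametrizes p q Z \<Xi> \<longleftrightarrow> exp_factor q \<and>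
     (\<exists>r x. clears_denominators r q \<and> 0 < fls_subdegree x \<and> Z = expand_coordinate p r x \<and>
        order_ge (\<Xi> * fls_deriv Z - fls_deriv (expand_factor r x q)) (-1))"

lemma expand_coordinate_power: "expand_coordinate p r (x ^ m) = expand_coordinate p (r * m) x"
  by (simp add: expand_coordinate_def power_mult mult.commute split: P1.split flip: power_mult)

lemma expand_coordinate_compose:
  assumes "reparam \<phi>"
  shows "expand_coordinate p r x \<triangleleft> \<phi> = expand_coordinate p r (x \<triangleleft> \<phi>)"
  using assms by (simp add: expand_coordinate_def compose_simps split: P1.split)

lemma expand_coordinate_const_mult:
  assumes "\<omega> ^ r = 1"
  shows "expand_coordinate p r (fls_const \<omega> * x) = expand_coordinate p r x"
  using assms
  by (simp add: expand_coordinate_def power_mult_distrib split: P1.split flip: fls_const_power)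

text \<open>Together with \<open>coordinate_order\<close>, this writes \<open>Z - basepoint\<close>
  as the power \<open>(x ^ r) powi 1\<close> or \<open>(x ^ r) powi (-1)\<close>, so that finite
  points and infinity are treated by the same estimates.\<close>

definition basepoint :: "P1 \<Rightarrow> complex" where
  "basepoint p = (case p of Aff a \<Rightarrow> a | Infty \<Rightarrow> 0)"

definition coordinate_order :: "P1 \<Rightarrow> int" where
  "coordinate_order p = (case p of Aff a \<Rightarrow> 1 | Infty \<Rightarrow> -1)"

lemma basepoint_simps [simp]: "basepoint (Aff a) = a" "basepoint Infty = 0"
  and coordinate_order_simps [simp]: "coordinate_order (Aff a) = 1" "coordinate_order Infty = -1"
  by (simp_all add: basepoint_def coordinate_order_def)

lemma expand_coordinate_minus_basepoint:
  "expand_coordinate p r x - fls_const (basepoint p) = (x ^ r) powi coordinate_order p"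
  by (simp add: expand_coordinate_def power_int_minus split: P1.split)

lemma subdegree_expand_coordinate:
  "fls_subdegree (expand_coordinate p r x - fls_const (basepoint p))
     = coordinate_order p * (int r * fls_subdegree x)"
  unfolding expand_coordinate_minus_basepoint by (simp add: fls_subdegree_pow)

lemma deriv_expand_coordinate:
  assumes "0 < r" "0 < fls_subdegree x"
  shows "fls_deriv (expand_coordinate p r x) \<noteq> 0"
    and "fls_subdegree (fls_deriv (expand_coordinate p r x)) = coordinate_order p * (int r * fls_subdegree x) - 1"
proof -
  define D where "D = expand_coordinate p r x - fls_const (basepoint p)"
  have d: "fls_deriv (expand_coordinate p r x) = fls_deriv D" by (simp add: D_def)
  have sD: "fls_subdegree D = coordinate_order p * (int r * fls_subdegree x)"
    unfolding D_def by (rule subdegree_expand_coordinate)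
  hence "fls_subdegree D \<noteq> 0" using assms by (cases p) auto
  from fls_subdegree_deriv[OF this] this
  show "fls_subdegree (fls_deriv (expand_coordinate p r x)) = coordinate_order p * (int r * fls_subdegree x) - 1"
    unfolding d sD by simp
  show "fls_deriv (expand_coordinate p r x) \<noteq> 0"
  proof
    assume "fls_deriv (expand_coordinate p r x) = 0"
    hence "fls_nth (fls_deriv D) (fls_subdegree D - 1) = 0" by (simp add: d)
    hence "fls_nth D (fls_subdegree D) = 0" using \<open>fls_subdegree D \<noteq> 0\<close> by simp
    hence "D = 0" using nth_fls_subdegree_zero_iff by blast
    with \<open>fls_subdegree D \<noteq> 0\<close> show False by simp
  qed
qed

text \<open>A root of x of order 1 can replace x at the price of a larger denominator, so a genuine
  uniformiser may be assumed.\<close>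

lemma parametrizes_normal_form:
  assumes "parametrizes p q Z \<Xi>"
  obtains N s where "clears_denominators N q" "fls_subdegree s = 1" "Z = expand_coordinate p N s"
    "order_ge (\<Xi> * fls_deriv Z - fls_deriv (expand_factor N s q)) (-1)"
proof -
  from assms obtain r x where rx: "clears_denominators r q" "0 < fls_subdegree x"
    "Z = expand_coordinate p r x"
    "order_ge (\<Xi> * fls_deriv Z - fls_deriv (expand_factor r x q)) (-1)"
    unfolding parametrizes_def by blast
  define m where "m = nat (fls_subdegree x)"
  have m: "0 < m" "fls_subdegree x = int m * 1" using rx(2) by (auto simp: m_def)
  obtain c where c: "c ^ m = fls_nth x (fls_subdegree x)" using exists_complex_root[OF m(1)] by blast
  obtain s where s: "fls_subdegree s = 1" "s ^ m = x"
    using exists_root[OF _ m c] rx(2) by (metis fls_zero_subdegree less_irrefl)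
  have "expand_factor r x q = expand_factor (r * m) s q"
    unfolding s(2)[symmetric] by (rule expand_factor_power[OF rx(1)])
  moreover have "Z = expand_coordinate p (r * m) s"
    unfolding rx(3) s(2)[symmetric] by (rule expand_coordinate_power)
  ultimately show ?thesis
    using that[of "r * m" s] clears_denominators_mult[OF rx(1) m(1)] s(1) rx(4) by simp
qed

lemma parametrizesI:
  assumes "exp_factor q" "clears_denominators r q" "0 < fls_subdegree x" "Z = expand_coordinate p r x"
    "order_ge (\<Xi> * fls_deriv Z - fls_deriv (expand_factor r x q)) (-1)"
  shows "parametrizes p q Z \<Xi>"
  using assms unfolding parametrizes_def by blast

lemma parametrizes_exp_factor: "parametrizes p q Z \<Xi> \<Longrightarrow> exp_factor q"
  by (simp add: parametrizes_def)

text \<open>Rotating the uniformiser by the inverse root of unity undoes the conjugation and leaves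
  Z unchanged.\<close>

lemma parametrizes_conj:
  assumes P: "parametrizes p q Z \<Xi>" and q': "q' \<in> galois_orbit q"
  shows "parametrizes p q' Z \<Xi>"
proof -
  obtain N s where N: "clears_denominators N q" "fls_subdegree s = 1" "Z = expand_coordinate p N s"
    "order_ge (\<Xi> * fls_deriv Z - fls_deriv (expand_factor N s q)) (-1)"
    using parametrizes_normal_form[OF P] .
  obtain \<omega> where w: "\<omega> ^ N = 1" "\<omega> \<noteq> 0" "q' = rotate_factor N \<omega> q"
    using galois_orbitE[OF q' N(1)] .
  define t where "t = fls_const (inverse \<omega>) * s"
  have "expand_factor N t q' = expand_factor N s q"
    unfolding t_def by (subst expand_factor_rotate) (simp_all add: w rotate_factor_rotate_factor)
  moreover have "expand_coordinate p N t = Z"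
    unfolding t_def N(3) using w by (intro expand_coordinate_const_mult) (simp add: power_inverse)
  moreover have "fls_subdegree t = 1"
    using N(2) w(2) by (cases "s = 0") (simp_all add: t_def)
  ultimately show ?thesis
    using N q' parametrizes_exp_factor[OF P]
    by (intro parametrizesI[of q' N t]) (auto simp: exp_factor_galois_orbit clears_denominators_galois_orbit)
qed

lemma expand_coordinate_inj:
  assumes "expand_coordinate p N s = expand_coordinate p' N' s'"
    and "0 < N" "0 < N'" "fls_subdegree s = 1" "fls_subdegree s' = 1"
  shows "p' = p \<and> N' = N \<and> s' ^ N = s ^ N"
proof -
  define Z where "Z = expand_coordinate p N s"
  have Z: "fls_subdegree (Z - fls_const (basepoint p)) = coordinate_order p * int N"
    "fls_subdegree (Z - fls_const (basepoint p')) = coordinate_order p' * int N'"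
    using subdegree_expand_coordinate[of p N s] subdegree_expand_coordinate[of p' N' s'] assms
    by (simp_all add: Z_def)
  have fin: "fls_nth Z 0 = a \<and> order_ge Z 0" if "fls_subdegree (Z - fls_const a) = int M" "0 < M" for a M
  proof -
    have "order_ge (Z - fls_const a) 1" using that by (simp add: order_ge_iff)
    hence "fls_nth (Z - fls_const a) m = 0" if "m < 1" for m using that by (simp add: order_ge_def)
    thus ?thesis unfolding order_ge_def by force
  qed
  have "p' = p"
  proof (cases p)
    case pa: (Aff a)
    show ?thesis
    proof (cases p')
      case (Aff b)
      thus ?thesis using pa fin[of a N] fin[of b N'] Z assms by simp
    next
      case Infty
      hence "fls_subdegree Z < 0" using Z assms by simp
      moreover have "order_ge Z 0" using pa fin[of a N] Z assms by simp
      ultimately show ?thesis by (auto simp: order_ge_iff)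
    qed
  next
    case pI: Infty
    show ?thesis
    proof (cases p')
      case (Aff b)
      hence "order_ge Z 0" using fin[of b N'] Z assms by simp
      moreover have "fls_subdegree Z < 0" using pI Z assms by simp
      ultimately show ?thesis by (auto simp: order_ge_iff)
    qed (use pI in simp)
  qed
  moreover from this have "N' = N" using Z by (cases p) auto
  moreover from calculation have "(s' ^ N) powi coordinate_order p = (s ^ N) powi coordinate_order p"
    using assms(1) expand_coordinate_minus_basepoint by metis
  hence "s' ^ N = s ^ N" by (cases p) (auto simp: power_int_minus)
  ultimately show ?thesis by blast
qed

text \<open>The common Z fixes the point, the degree N and the uniformiser up to an N-th root of
  unity. Rotating the uniformiser conjugates the factor, after which
  \<open>expand_factor_eqI\<close> applies.\<close>

lemma parametrizes_unique:
  assumes P: "parametrizes p q Z \<Xi>" and P': "parametrizes p' q' Z \<Xi>"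
  shows "p' = p" "galois_orbit q' = galois_orbit q"
proof -
  obtain N s where N: "clears_denominators N q" "fls_subdegree s = 1" "Z = expand_coordinate p N s"
    "order_ge (\<Xi> * fls_deriv Z - fls_deriv (expand_factor N s q)) (-1)"
    using parametrizes_normal_form[OF P] .
  obtain N' s' where N': "clears_denominators N' q'" "fls_subdegree s' = 1" "Z = expand_coordinate p' N' s'"
    "order_ge (\<Xi> * fls_deriv Z - fls_deriv (expand_factor N' s' q')) (-1)"
    using parametrizes_normal_form[OF P'] .
  have eq: "p' = p" "N' = N" "s' ^ N = s ^ N"
    using expand_coordinate_inj[of p N s p' N' s'] N N' clears_denominators_pos by metis+
  show "p' = p" by fact
  have N0: "0 < N" using N(1) by (rule clears_denominators_pos)
  have "s \<noteq> 0" using N(2) by auto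
  then obtain \<omega> where w: "s' = fls_const \<omega> * s" "\<omega> ^ N = 1"
    using power_eq_imp_root_of_unity[OF eq(3) N0] by blast
  have w0: "\<omega> \<noteq> 0" using root_of_unity_nonzero[OF w(2) N0] .
  define q'' where "q'' = rotate_factor N \<omega> q'"
  have q'': "q'' \<in> galois_orbit q'"
    using galois_orbit_eq[of N q'] N'(1) eq(2) w(2) by (auto simp: q''_def)
  have "expand_factor N' s' q' = expand_factor N s q''"
    unfolding eq(2) w(1) q''_def by (rule expand_factor_rotate[OF w0])
  hence "order_ge ((\<Xi> * fls_deriv Z - fls_deriv (expand_factor N s q'')) - (\<Xi> * fls_deriv Z - fls_deriv (expand_factor N s q))) (-1)"
    using N(4) N'(4) by (simp only: order_ge_diff)
  hence "order_ge (fls_deriv (expand_factor N s q) - fls_deriv (expand_factor N s q'')) (-1)"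
    by (simp add: algebra_simps)
  hence "q = q''"
    using N(1,2) N'(1) eq(2) q'' P P' parametrizes_exp_factor exp_factor_galois_orbit clears_denominators_galois_orbit
    by (intro expand_factor_eqI[of N _ _ s]) auto
  thus "galois_orbit q' = galois_orbit q" using galois_orbit_cong[OF q''] by simp
qed

lemma parametrizes_compose:
  assumes \<phi>: "reparam \<phi>" and P: "parametrizes p q Z \<Xi>"
  shows "parametrizes p q (Z \<triangleleft> \<phi>) (\<Xi> \<triangleleft> \<phi>)"
proof -
  from P obtain r x where rx: "clears_denominators r q" "0 < fls_subdegree x"
    "Z = expand_coordinate p r x"
    "order_ge (\<Xi> * fls_deriv Z - fls_deriv (expand_factor r x q)) (-1)"
    unfolding parametrizes_def by blast
  have "(\<Xi> \<triangleleft> \<phi>) * fls_deriv (Z \<triangleleft> \<phi>) - fls_deriv (expand_factor r (x \<triangleleft> \<phi>) q)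
    = ((\<Xi> * fls_deriv Z - fls_deriv (expand_factor r x q)) \<triangleleft> \<phi>) * fls_deriv (fps_to_fls \<phi>)"
    by (simp add: fls_deriv_compose[OF \<phi>] compose_simps[OF \<phi> \<phi>] algebra_simps
        flip: expand_factor_compose[OF \<phi>])
  thus ?thesis
    using rx order_ge_log_compose[OF \<phi> rx(4)] parametrizes_exp_factor[OF P] \<phi>
    by (intro parametrizesI[of q r "x \<triangleleft> \<phi>"])
      (auto simp: expand_coordinate_compose subdegree_compose)
qed

lemma parametrizes_perturb:
  assumes P: "parametrizes p q Z \<Xi>" and "order_ge ((\<Xi>' - \<Xi>) * fls_deriv Z) (-1)"
  shows "parametrizes p q Z \<Xi>'"
proof -
  from P obtain r x where rx: "clears_denominators r q" "0 < fls_subdegree x"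
    "Z = expand_coordinate p r x"
    "order_ge (\<Xi> * fls_deriv Z - fls_deriv (expand_factor r x q)) (-1)"
    unfolding parametrizes_def by blast
  have "order_ge ((\<Xi>' - \<Xi>) * fls_deriv Z + (\<Xi> * fls_deriv Z - fls_deriv (expand_factor r x q))) (-1)"
    by (intro order_ge_add assms rx)
  thus ?thesis
    using rx parametrizes_exp_factor[OF P]
    by (intro parametrizesI[of q r x]) (auto simp: algebra_simps)
qed

lemma exists_uniformiser:
  assumes "fls_subdegree (Z - fls_const (basepoint p)) = coordinate_order p * int N" "0 < N"
    and c: "c ^ N = fls_nth (Z - fls_const (basepoint p)) (coordinate_order p * int N) powi coordinate_order p"
  shows "\<exists>s. fls_subdegree s = 1 \<and> fls_nth s 1 = c \<and> Z = expand_coordinate p N s"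
proof -
  define D where "D = Z - fls_const (basepoint p)"
  have D: "fls_subdegree D = coordinate_order p * int N" using assms by (simp add: D_def)
  have D0: "D \<noteq> 0" using D assms(2) by (cases p) auto
  define E where "E = D powi coordinate_order p"
  have E: "E \<noteq> 0" "fls_subdegree E = int N * 1"
    using D D0 by (cases p; simp add: E_def)+
  have "fls_nth E (fls_subdegree E) = fls_nth D (coordinate_order p * int N) powi coordinate_order p"
    using D D0 fls_inverse_subdegree_base[of D] by (cases p) (simp_all add: E_def power_int_minus)
  hence cE: "c ^ N = fls_nth E (fls_subdegree E)" using c by (simp add: D_def)
  obtain s where s: "fls_subdegree s = 1" "fls_nth s 1 = c" "s ^ N = E"
    using exists_root[OF E(1) assms(2) E(2) cE] by blast
  have "D = E powi coordinate_order p"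
    by (cases p) (simp_all add: E_def power_int_minus)
  hence "Z = expand_coordinate p N s"
    using expand_coordinate_minus_basepoint[of p N s] unfolding s(3) D_def by (metis diff_add_cancel)
  with s show ?thesis by blast
qed

lemma parametrizes_exists:
  assumes "fls_subdegree (Z - fls_const (basepoint p)) = coordinate_order p * int N" "0 < N"
  shows "\<exists>q. parametrizes p q Z \<Xi>"
proof -
  obtain c where "c ^ N = fls_nth (Z - fls_const (basepoint p)) (coordinate_order p * int N) powi coordinate_order p"
    using exists_complex_root[OF assms(2)] by blast
  then obtain s where s: "fls_subdegree s = 1" "Z = expand_coordinate p N s"
    using exists_uniformiser[OF assms] by blast
  from exists_expand_factor[OF s(1) assms(2), of "\<Xi> * fls_deriv Z"] s show ?thesis
    by (auto intro!: parametrizesI[where r = N and x = s])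
qed

section \<open>Linear action on curves\<close>

text \<open>
  The residue of \<open>\<Xi> dZ\<close> is free, as circles only record the polar part of \<open>q\<close>. Making it
  nonzero turns the tame circles into genuine poles, so that they need no separate treatment.
\<close>

definition nondegenerate :: "complex fls \<Rightarrow> complex fls \<Rightarrow> bool" where
  "nondegenerate Z \<Xi> \<longleftrightarrow> fls_nth (\<Xi> * fls_deriv Z) (-1) \<noteq> 0"

definition represents :: "circle \<Rightarrow> complex fls \<Rightarrow> complex fls \<Rightarrow> bool" where
  "represents c Z \<Xi> \<longleftrightarrow> nondegenerate Z \<Xi> \<and> (\<exists>p q. c = circle_of p q \<and> parametrizes p q Z \<Xi>)"

lemma represents_unique:
  "represents c Z \<Xi> \<Longrightarrow> represents c' Z \<Xi> \<Longrightarrow> c' = c"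
  unfolding represents_def circle_of_def using parametrizes_unique by blast

lemma representsI:
  "nondegenerate Z \<Xi> \<Longrightarrow> parametrizes p q Z \<Xi> \<Longrightarrow> represents (circle_of p q) Z \<Xi>"
  unfolding represents_def by blast

definition act_Z :: "complex^2^2 \<Rightarrow> complex fls \<Rightarrow> complex fls \<Rightarrow> complex fls" where
  "act_Z A Z \<Xi> = fls_const (A $ 2 $ 2) * Z - fls_const (A $ 2 $ 1) * \<Xi>"

definition act_\<Xi> :: "complex^2^2 \<Rightarrow> complex fls \<Rightarrow> complex fls \<Rightarrow> complex fls" where
  "act_\<Xi> A Z \<Xi> = fls_const (A $ 1 $ 1) * \<Xi> - fls_const (A $ 1 $ 2) * Z"

lemma act_mult:
  "act_Z (A ** B) Z \<Xi> = act_Z A (act_Z B Z \<Xi>) (act_\<Xi> B Z \<Xi>)"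
  "act_\<Xi> (A ** B) Z \<Xi> = act_\<Xi> A (act_Z B Z \<Xi>) (act_\<Xi> B Z \<Xi>)"
  unfolding act_Z_def act_\<Xi>_def matrix_matrix_mult_def
  by (simp_all add: sum_2 algebra_simps flip: fls_plus_const fls_const_mult_const)

lemma act_1 [simp]: "act_Z (Finite_Cartesian_Product.mat 1) Z \<Xi> = Z" "act_\<Xi> (Finite_Cartesian_Product.mat 1) Z \<Xi> = \<Xi>"
  by (simp_all add: act_Z_def act_\<Xi>_def Finite_Cartesian_Product.mat_def)

lemma residue_mult_deriv_self: "fls_nth (f * fls_deriv f) (-1) = (0::complex)"
proof -
  have "fls_deriv (f * f) = 2 * (f * fls_deriv f)" by simp
  hence "0 = fls_nth (2 * (f * fls_deriv f)) (-1)" by (metis fls_deriv_residue)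
  also have "2 * (f * fls_deriv f) = (f * fls_deriv f) + (f * fls_deriv f)" by (rule mult_2)
  finally show ?thesis by simp
qed

text \<open>Integration by parts: \<open>d(f g)\<close> has no residue. Hence the quarter turn
  preserves the residue of \<open>\<Xi> dZ\<close>.\<close>

lemma residue_mult_deriv_swap: "fls_nth (f * fls_deriv g) (-1) = - fls_nth (g * fls_deriv f) (-1 :: int)"
  for f g :: "complex fls"
proof -
  have "fls_nth (fls_deriv (f * g)) (-1) = 0" by (rule fls_deriv_residue)
  thus ?thesis by (simp add: mult.commute eq_neg_iff_add_eq_0)
qed

lemma nondegenerate_twist: "nondegenerate Z (\<Xi> - fls_const \<mu> * Z) \<longleftrightarrow> nondegenerate Z \<Xi>"
proof -
  have "(\<Xi> - fls_const \<mu> * Z) * fls_deriv Z = \<Xi> * fls_deriv Z - fls_const \<mu> * (Z * fls_deriv Z)"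
    by (simp add: algebra_simps)
  thus ?thesis using residue_mult_deriv_self[of Z] unfolding nondegenerate_def by simp
qed

lemma nondegenerate_scale: "\<mu> \<noteq> 0 \<Longrightarrow> nondegenerate (fls_const \<mu> * Z) (fls_const (inverse \<mu>) * \<Xi>) \<longleftrightarrow> nondegenerate Z \<Xi>"
  by (simp add: nondegenerate_def mult.assoc mult.left_commute[of _ "fls_const \<mu>"])

lemma nondegenerate_fourier: "nondegenerate \<Xi> (- Z) \<longleftrightarrow> nondegenerate Z \<Xi>"
  using residue_mult_deriv_swap[of Z \<Xi>] by (simp add: nondegenerate_def)

lemma image_galois_orbit:
  assumes "clears_denominators N q" "clears_denominators N (f q)"
    and "\<And>\<omega>. \<omega> ^ N = 1 \<Longrightarrow> f (rotate_factor N \<omega> q) = rotate_factor N \<omega> (f q)"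
  shows "f ` galois_orbit q = galois_orbit (f q)"
  unfolding galois_orbit_eq[OF assms(1)] galois_orbit_eq[OF assms(2)] using assms(3) by force

text \<open>The form \<open>\<Xi> dZ\<close> changes by \<open>- \<mu> Z dZ\<close>. At a finite
  point this is regular and the circle stays; at infinity it is the differential of
  \<open>- (\<mu> / 2) Z^2\<close>.\<close>

lemma represents_twist:
  assumes "represents c Z \<Xi>"
  shows "represents (twist_circle \<mu> c) Z (\<Xi> - fls_const \<mu> * Z)"
proof -
  from assms obtain p q where pq: "c = circle_of p q" "parametrizes p q Z \<Xi>"
    and nd: "nondegenerate Z (\<Xi> - fls_const \<mu> * Z)"
    by (auto simp: represents_def nondegenerate_twist)
  obtain N s where N: "clears_denominators N q" "fls_subdegree s = 1" "Z = expand_coordinate p N s"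
    "order_ge (\<Xi> * fls_deriv Z - fls_deriv (expand_factor N s q)) (-1)"
    using parametrizes_normal_form[OF pq(2)] .
  have N0: "0 < N" using N(1) by (rule clears_denominators_pos)
  show ?thesis
  proof (cases p)
    case (Aff a)
    have "order_ge (Z - fls_const a) 0"
      using subdegree_expand_coordinate[of p N s] Aff N by (auto simp: order_ge_iff)
    hence "order_ge (Z - fls_const a + fls_const a) 0" by (intro order_ge_add) simp_all
    hence Z: "order_ge Z 0" by simp
    have "order_ge (fls_const \<mu> * (Z * fls_deriv Z)) (0 + (0 - 1))"
      by (intro order_ge_const_mult order_ge_mult order_ge_deriv Z)
    hence "parametrizes p q Z (\<Xi> - fls_const \<mu> * Z)"
      by (intro parametrizes_perturb[OF pq(2)]) (simp add: mult.assoc)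
    thus ?thesis using representsI[OF nd] Aff by (simp add: twist_circle_def pq(1) circle_of_def)
  next
    case Infty
    define m :: expfactor where "m = Poly_Mapping.single 2 (\<mu> / 2)"
    have ex: "exponents (q - m) \<subseteq> exponents q \<union> {2}"
      using exponents_diff_subset[of q m] by (auto simp: m_def split: if_splits)
    have ef: "exp_factor (q - m)"
      using ex parametrizes_exp_factor[OF pq(2)] unfolding exp_factor_def by fastforce
    have c: "clears_denominators N (q - m)"
      using ex N(1) unfolding clears_denominators_def by (auto dest!: subsetD)
    have "(2 :: rat) * of_nat N = of_int (2 * int N)" by simp
    hence fl: "\<lfloor>(2 :: rat) * of_nat N\<rfloor> = 2 * int N" by (simp only: floor_of_int)
    have "Z = s powi (- int N)"
      using N(3) Infty by (simp add: expand_coordinate_def power_int_minus)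
    moreover have "s \<noteq> 0" using N(2) by auto
    ultimately have Z2: "Z * Z = s powi (- (2 * int N))"
      using power_int_add[of s "- int N" "- int N"] by simp
    have m: "expand_factor N s m = fls_const (\<mu> / 2) * (Z * Z)"
      unfolding m_def expand_factor_single fl Z2 ..
    have "fls_deriv (expand_factor N s m) = fls_const (\<mu> / 2) * (Z * fls_deriv Z) + fls_const (\<mu> / 2) * (Z * fls_deriv Z)"
      unfolding m by (simp add: algebra_simps)
    also have "\<dots> = fls_const \<mu> * (Z * fls_deriv Z)"
      by (simp only: distrib_right[symmetric] fls_plus_const) simp
    finally have "parametrizes p (q - m) Z (\<Xi> - fls_const \<mu> * Z)"
      using N by (intro parametrizesI[OF ef c, of s]) (simp_all add: expand_factor_diff algebra_simps)
    moreover have "(\<lambda>q. q - m) ` galois_orbit q = galois_orbit (q - m)"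
    proof (rule image_galois_orbit[OF N(1)])
      show "clears_denominators N (q - m)" by (rule c)
    next
      fix \<omega> :: complex assume w: "\<omega> ^ N = 1"
      \<comment> \<open>The exponent 2 is an integer, so the monomial m is fixed by conjugation and
        subtracting it maps the orbit onto an orbit.\<close>
      have "\<omega> powi (- (2 * int N)) = (\<omega> ^ N) powi (- 2)"
        by (simp only: power_int_power mult.commute minus_mult_right)
      hence w': "\<omega> powi (- (2 * int N)) = 1" using w by simp
      show "rotate_factor N \<omega> q - m = rotate_factor N \<omega> (q - m)"
        by (intro poly_mapping_eqI)
          (simp add: coef_rotate_factor lookup_minus right_diff_distrib m_def lookup_single when_def fl w')
    qed
    ultimately show ?thesis
      using representsI[OF nd] Infty by (simp add: twist_circle_def pq(1) circle_of_def m_def)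
  qed
qed

lemma represents_scale:
  assumes "represents c Z \<Xi>" and \<mu>: "\<mu> \<noteq> 0"
  shows "represents (scale_circle \<mu> c) (fls_const \<mu> * Z) (fls_const (inverse \<mu>) * \<Xi>)"
proof -
  from assms obtain p q where pq: "c = circle_of p q" "parametrizes p q Z \<Xi>"
    and nd: "nondegenerate (fls_const \<mu> * Z) (fls_const (inverse \<mu>) * \<Xi>)"
    by (auto simp: represents_def nondegenerate_scale)
  obtain N s where N: "clears_denominators N q" "fls_subdegree s = 1" "Z = expand_coordinate p N s"
    "order_ge (\<Xi> * fls_deriv Z - fls_deriv (expand_factor N s q)) (-1)"
    using parametrizes_normal_form[OF pq(2)] .
  have N0: "0 < N" using N(1) by (rule clears_denominators_pos)
  define \<sigma> :: real where "\<sigma> = of_int (coordinate_order p)"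
  have s1: "(of_int (coordinate_order p * k) :: complex) = of_real \<sigma> * of_int k" for k by (simp add: \<sigma>_def)
  define f where "f = Poly_Mapping.mapp (\<lambda>e k. \<mu> powr (of_real \<sigma> * of_rat e) * k)"
  define p' where "p' = (case p of Aff a \<Rightarrow> Aff (\<mu> * a) | Infty \<Rightarrow> Infty)"
  \<comment> \<open>Multiplying s by \<nu> gives a uniformiser for \<open>\<mu> * Z\<close>. It is
    built from the principal logarithm so that its integer powers match the factors
    \<open>\<mu> powr (\<sigma> e)\<close> in \<open>scale_circle\<close> exactly.\<close>
  define \<nu> where "\<nu> = \<mu> powr (of_real \<sigma> / of_nat N)"
  have \<nu>0: "\<nu> \<noteq> 0" using \<mu> by (simp add: \<nu>_def)
  have "\<nu> ^ N = \<mu> powr of_real \<sigma>"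
    using \<mu> N0 by (simp add: \<nu>_def powr_def flip: exp_of_nat_mult)
  hence \<nu>N: "\<nu> ^ N = \<mu> powi coordinate_order p"
    using \<mu> by (cases p) (simp_all add: \<sigma>_def powr_minus power_int_minus)
  have cf: "coef (f q') e = \<mu> powr (of_real \<sigma> * of_rat e) * coef q' e" for q' e
    unfolding f_def by (rule coef_mapp_mult)
  have exf: "exponents (f q') = exponents q'" for q'
    using \<mu> by (auto simp: exponents_iff cf)
  define t where "t = fls_const \<nu> * s"
  have t: "fls_subdegree t = 1" using N(2) \<nu>0 by (cases "s = 0") (simp_all add: t_def)
  have co: "fls_const \<mu> * Z = expand_coordinate p' N t"
    using \<mu> \<nu>N by (cases p) (simp_all add: N(3) p'_def expand_coordinate_def t_def power_mult_distrib
      distrib_left power_int_minus flip: fls_const_power fls_const_mult_const fls_inverse_const)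
  have ef: "expand_factor N t (f q) = expand_factor N s q"
    unfolding expand_factor_def exf
  proof (intro sum.cong refl)
    fix e assume e: "e \<in> exponents q"
    have "of_int \<lfloor>e * of_nat N\<rfloor> = (of_rat (e * of_nat N) :: complex)"
      by (metis clears_denominators_floor[OF N(1) e] of_rat_of_int_eq)
    hence fl: "of_int \<lfloor>e * of_nat N\<rfloor> = (of_rat e * of_nat N :: complex)" by (simp add: of_rat_mult)
    have "\<nu> powi (- \<lfloor>e * of_nat N\<rfloor>) = exp (of_int (- \<lfloor>e * of_nat N\<rfloor>) * (of_real \<sigma> / of_nat N * ln \<mu>))"
      using \<mu> by (simp only: \<nu>_def powr_def exp_power_int if_False)
    also have "of_int (- \<lfloor>e * of_nat N\<rfloor>) * (of_real \<sigma> / of_nat N * ln \<mu>) = - (of_real \<sigma> * of_rat e * ln \<mu>)"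
      using N0 by (simp add: fl)
    also have "exp \<dots> = inverse (\<mu> powr (of_real \<sigma> * of_rat e))"
      using \<mu> by (simp add: powr_def exp_minus)
    finally have "\<mu> powr (of_real \<sigma> * of_rat e) * \<nu> powi (- \<lfloor>e * of_nat N\<rfloor>) = 1"
      using \<mu> by simp
    hence "fls_const (\<mu> powr (of_real \<sigma> * of_rat e)) * fls_const (\<nu> powi (- \<lfloor>e * of_nat N\<rfloor>)) = 1"
      by simp
    note unit = this
    have alg: "(A * C) * (B * S) = C * S" if "A * B = 1" for A B C S :: "complex fls"
    proof -
      have "(A * C) * (B * S) = (A * B) * (C * S)" by (simp only: mult_ac)
      thus ?thesis using that by simp
    qed
    show "fls_const (coef (f q) e) * t powi (- \<lfloor>e * of_nat N\<rfloor>) = fls_const (coef q e) * s powi (- \<lfloor>e * of_nat N\<rfloor>)"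
      unfolding cf t_def power_int_mult_distrib fls_const_power_int[symmetric] fls_const_mult_const[symmetric]
      by (rule alg[OF unit])
  qed
  have dZ: "fls_const (inverse \<mu>) * \<Xi> * fls_deriv (fls_const \<mu> * Z) = \<Xi> * fls_deriv Z"
    using \<mu> by (simp add: mult.assoc mult.left_commute[of _ "fls_const \<mu>"])
  have cl: "clears_denominators N (f q)"
    using N(1) clears_denominators_cong[OF exf] by blast
  have "exp_factor (f q)" using parametrizes_exp_factor[OF pq(2)] by (simp add: exp_factor_def exf)
  moreover have "order_ge (fls_const (inverse \<mu>) * \<Xi> * fls_deriv (fls_const \<mu> * Z) - fls_deriv (expand_factor N t (f q))) (-1)"
    unfolding dZ ef by (rule N(4))
  ultimately have "parametrizes p' (f q) (fls_const \<mu> * Z) (fls_const (inverse \<mu>) * \<Xi>)"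
    using t by (intro parametrizesI[OF _ cl _ co]) simp_all
  moreover have "f ` galois_orbit q = galois_orbit (f q)"
    by (rule image_galois_orbit[of N q f, OF N(1) cl]) (intro poly_mapping_eqI, simp add: cf coef_rotate_factor)
  hence "scale_circle \<mu> c = circle_of p' (f q)"
    by (cases p) (simp_all add: pq(1) scale_circle_def circle_of_def p'_def f_def \<sigma>_def)
  ultimately show ?thesis using representsI[OF nd] by simp
qed

section \<open>The Fourier transform on curves\<close>

text \<open>
  Perturbing \<open>\<Xi>\<close> within regular singular forms amounts, after a change of parameter that restores
  \<open>\<Xi>\<close>, to perturbing \<open>Z\<close> within regular singular forms.
\<close>

lemma parametrizes_fourier_perturb:
  assumes e: "fls_subdegree (\<Xi>\<^sub>0 - fls_const b) = e" "e \<noteq> 0"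
    and \<Xi>: "order_ge (\<Xi> - \<Xi>\<^sub>0) (- n)" and Z: "order_ge (Z - fls_const a) n" and ne: "n + e < 0"
    and P: "parametrizes p q \<Xi>\<^sub>0 (- Z)"
  shows "parametrizes p q \<Xi> (- Z)"
proof -
  define D0 D where "D0 = \<Xi>\<^sub>0 - fls_const b" and "D = \<Xi> - fls_const b"
  have D: "D - D0 = \<Xi> - \<Xi>\<^sub>0" by (simp add: D0_def D_def)
  \<comment> \<open>The bound \<open>n + e < 0\<close> makes the error in \<Xi> of higher order than
    \<open>D0\<close>, so a substitution tangent to the identity absorbs it.\<close>
  have "order_ge (D - D0) (fls_subdegree D0 + 1)"
    unfolding D using e ne by (intro order_ge_mono[OF \<Xi>]) (simp add: D0_def)
  then obtain \<phi> where \<phi>: "subdegree \<phi> = 1" "fps_nth \<phi> 1 = 1" "D0 \<triangleleft> \<phi> = D"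
    using tangent_compose_exists[of D0 D] e by (auto simp: D0_def)
  have rp: "reparam \<phi>" using \<phi>(1) by simp
  have \<Xi>\<phi>: "\<Xi>\<^sub>0 \<triangleleft> \<phi> = \<Xi>"
    using \<phi>(3) by (simp add: D0_def D_def compose_simps[OF rp rp])
  \<comment> \<open>The relative precision \<open>- n - e\<close> of \<Xi> passes to Z, which moves
    by order at least -e. Since \<open>d\<Xi>\<close> has order at least e - 1, this just leaves a
    logarithmic pole.\<close>
  have "order_ge (D0 \<triangleleft> \<phi> - D0) (fls_subdegree D0 + (- n - e))"
    unfolding \<phi>(3) D using e(1) \<Xi> by (simp add: D0_def)
  hence "order_ge ((Z - fls_const a) \<triangleleft> \<phi> - (Z - fls_const a)) (n + (- n - e))"
    using e ne by (intro close_compose_transfer[OF \<phi>(1,2) _ _ _ Z, of D0]) (auto simp: D0_def)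
  hence ZZ: "order_ge (Z \<triangleleft> \<phi> - Z) (- e)" by (simp add: compose_simps[OF rp rp])
  have "order_ge D0 e" using e(1) by (simp add: D0_def order_ge_iff)
  hence "order_ge D e" using order_ge_compose_unif[OF \<phi>(1)] \<phi>(3) by metis
  hence "order_ge (fls_deriv D) (e - 1)" by (rule order_ge_deriv)
  hence "order_ge ((Z \<triangleleft> \<phi> - Z) * fls_deriv \<Xi>) (- e + (e - 1))"
    using ZZ by (intro order_ge_mult) (simp_all add: D_def)
  moreover have "- Z - (- Z) \<triangleleft> \<phi> = Z \<triangleleft> \<phi> - Z" by simp
  ultimately have "order_ge ((- Z - (- Z) \<triangleleft> \<phi>) * fls_deriv \<Xi>) (-1)" by (simp only:) simp
  moreover have "parametrizes p q \<Xi> ((- Z) \<triangleleft> \<phi>)"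
    using parametrizes_compose[OF rp P] by (simp only: \<Xi>\<phi>)
  ultimately show ?thesis using parametrizes_perturb by blast
qed

text \<open>\<open>\<Xi>\<^sub>0\<close> is dq/dz on the cover of degree \<open>ram q\<close>. Of
  the two bounds on e, the first places it at \<open>p'\<close>, and the second gives
  \<open>(\<Xi>\<^sub>0 - b) dZ\<^sub>0\<close>, with b the base point of \<open>p'\<close>, a pole
  beyond a logarithmic one, as absorbing errors requires. Every curve of q is, up to a logarithmic
  form, a substitution into this one, so a single q' serves all curves and the whole Legendre
  orbit.\<close>

lemma fourier_core:
  fixes p p' q
  defines "Z\<^sub>0 \<equiv> expand_coordinate p (ram q) fls_X"
  defines "\<Xi>\<^sub>0 \<equiv> fls_deriv (expand_factor (ram q) fls_X q) / fls_deriv Z\<^sub>0"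
  defines "e \<equiv> fls_subdegree (\<Xi>\<^sub>0 - fls_const (basepoint p'))"
  assumes q: "exp_factor q"
    and e: "0 < coordinate_order p' * e" "coordinate_order p * int (ram q) + e < 0"
  obtains q' where "exp_factor q'"
    "{q''. \<exists>q\<^sub>1\<in>galois_orbit q. legendre p q\<^sub>1 p' q''} = galois_orbit q'"
    "\<And>Z \<Xi>. parametrizes p q Z \<Xi> \<Longrightarrow> parametrizes p' q' \<Xi> (- Z)"
proof -
  define r where "r = ram q"
  define Q\<^sub>0 where "Q\<^sub>0 = expand_factor r fls_X q"
  have r: "0 < r" "clears_denominators r q" by (simp_all add: r_def ram_pos clears_denominators_ram)
  have Z\<^sub>0': "fls_deriv Z\<^sub>0 \<noteq> 0"
    unfolding Z\<^sub>0_def using deriv_expand_coordinate(1)[of "ram q" fls_X p] r by (simp add: r_def)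
  have \<Xi>\<^sub>0: "\<Xi>\<^sub>0 * fls_deriv Z\<^sub>0 = fls_deriv Q\<^sub>0"
    using Z\<^sub>0' by (simp add: \<Xi>\<^sub>0_def Q\<^sub>0_def r_def)
  have "fls_subdegree (\<Xi>\<^sub>0 - fls_const (basepoint p')) = coordinate_order p' * int (nat \<bar>e\<bar>)"
    using e(1) by (cases p') (auto simp: e_def)
  moreover have "0 < nat \<bar>e\<bar>" using e(1) by auto
  ultimately obtain q' where q': "parametrizes p' q' \<Xi>\<^sub>0 (- Z\<^sub>0)" using parametrizes_exists by blast
  \<comment> \<open>A parametrization without error term factors through the minimal one because
    \<open>ram q\<close> divides N; the substitution is \<open>x ^ k\<close>.\<close>
  have exact: "\<exists>k \<phi>. 0 < k \<and> int (subdegree \<phi>) = k * fls_subdegree x \<and> reparam \<phi> \<and> N = r * nat k \<and> Z = Z\<^sub>0 \<triangleleft> \<phi> \<and> \<Xi> = \<Xi>\<^sub>0 \<triangleleft> \<phi>"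
    if N: "clears_denominators N q" and x: "0 < fls_subdegree x" and Z: "Z = expand_coordinate p N x"
      and \<Xi>: "\<Xi> * fls_deriv Z = fls_deriv (expand_factor N x q)" for N x Z \<Xi>
  proof -
    obtain k where k: "N = r * k" using ram_dvd[OF N] by (auto simp: r_def)
    have k0: "0 < k" using k clears_denominators_pos[OF N] by (cases k) auto
    define \<phi> where "\<phi> = fls_regpart (x ^ k)"
    have xk: "fls_subdegree (x ^ k) = int k * fls_subdegree x" by (simp add: fls_subdegree_pow)
    hence pos: "0 < fls_subdegree (x ^ k)" using k0 x by simp
    have f: "fps_to_fls \<phi> = x ^ k" using pos by (simp add: \<phi>_def)
    have d: "int (subdegree \<phi>) = int k * fls_subdegree x"
      using xk f by (metis fls_subdegree_fls_to_fps)
    hence rp: "reparam \<phi>" using pos xk by simp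
    have X: "fls_X \<triangleleft> \<phi> = x ^ k" by (simp add: f)
    have Z1: "Z\<^sub>0 \<triangleleft> \<phi> = Z"
      unfolding Z\<^sub>0_def Z expand_coordinate_compose[OF rp] X expand_coordinate_power k r_def ..
    have Q1: "Q\<^sub>0 \<triangleleft> \<phi> = expand_factor N x q"
      unfolding Q\<^sub>0_def expand_factor_compose[OF rp] X k by (rule expand_factor_power[OF r(2)])
    have "fls_deriv Z \<noteq> 0"
      unfolding Z using N x clears_denominators_pos by (intro deriv_expand_coordinate)
    moreover have "(\<Xi>\<^sub>0 \<triangleleft> \<phi>) * fls_deriv Z = fls_deriv (expand_factor N x q)"
      unfolding Z1[symmetric] Q1[symmetric] fls_deriv_compose[OF rp] \<Xi>\<^sub>0[symmetric]
      by (simp add: compose_simps[OF rp rp] mult_ac)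
    ultimately have "\<Xi> = \<Xi>\<^sub>0 \<triangleleft> \<phi>" using \<Xi> by (metis mult_right_cancel)
    with d rp Z1 k k0 show ?thesis by (intro exI[of _ "int k"] exI[of _ \<phi>]) simp
  qed
  have exact': "parametrizes p' q' \<Xi> (- Z)"
    if "clears_denominators N q" "0 < fls_subdegree x" "Z = expand_coordinate p N x"
      "\<Xi> * fls_deriv Z = fls_deriv (expand_factor N x q)" for N x Z \<Xi>
  proof -
    note * = exact[OF that]
    obtain \<phi> where "reparam \<phi>" "Z = Z\<^sub>0 \<triangleleft> \<phi>" "\<Xi> = \<Xi>\<^sub>0 \<triangleleft> \<phi>" using * by blast
    thus ?thesis using parametrizes_compose[OF _ q', of \<phi>] by simp
  qed
  show ?thesis
  proof (rule that)
    show "exp_factor q'" using q' by (rule parametrizes_exp_factor)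
  next
    fix Z \<Xi> assume P: "parametrizes p q Z \<Xi>"
    obtain N s where N: "clears_denominators N q" "fls_subdegree s = 1" "Z = expand_coordinate p N s"
      "order_ge (\<Xi> * fls_deriv Z - fls_deriv (expand_factor N s q)) (-1)"
      using parametrizes_normal_form[OF P] .
    have N0: "0 < N" using N(1) by (rule clears_denominators_pos)
    define \<Xi>' where "\<Xi>' = fls_deriv (expand_factor N s q) / fls_deriv Z"
    have dZ: "fls_deriv Z \<noteq> 0" "fls_subdegree (fls_deriv Z) = coordinate_order p * int N - 1"
      using deriv_expand_coordinate[of N s p] N N0 by auto
    have \<Xi>': "\<Xi>' * fls_deriv Z = fls_deriv (expand_factor N s q)" using dZ by (simp add: \<Xi>'_def)
    have P': "parametrizes p' q' \<Xi>' (- Z)" using exact'[OF N(1) _ N(3) \<Xi>'] N(2) by simp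
    obtain k \<phi> where k: "0 < k" "int (subdegree \<phi>) = k" "N = r * nat k" "reparam \<phi>" "\<Xi>' = \<Xi>\<^sub>0 \<triangleleft> \<phi>"
      using exact[OF N(1) _ N(3) \<Xi>'] N(2) by auto
    have "\<Xi>' - fls_const (basepoint p') = (\<Xi>\<^sub>0 - fls_const (basepoint p')) \<triangleleft> \<phi>"
      using k by (simp add: compose_simps)
    hence e': "fls_subdegree (\<Xi>' - fls_const (basepoint p')) = e * k"
      using subdegree_compose[OF k(4)] k(2) by (simp add: e_def)
    have "order_ge ((\<Xi> - \<Xi>') * fls_deriv Z) (-1)" using N(4) \<Xi>' by (simp add: algebra_simps)
    hence "order_ge (\<Xi> - \<Xi>') (- (coordinate_order p * int N))"
      using order_ge_mult_cancel[OF _ dZ(1)] dZ(2) by fastforce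
    moreover have "order_ge (Z - fls_const (basepoint p)) (coordinate_order p * int N)"
      using subdegree_expand_coordinate[of p N s] N(2,3) by (simp add: order_ge_iff)
    moreover have "coordinate_order p * int N + e * k = (coordinate_order p * int r + e) * k"
      using k by (simp add: algebra_simps)
    hence "coordinate_order p * int N + e * k < 0"
      using e(2) k(1) by (simp add: r_def mult_neg_pos)
    moreover have "e * k \<noteq> 0" using e(1) k(1) by auto
    ultimately show "parametrizes p' q' \<Xi> (- Z)"
      using parametrizes_fourier_perturb[OF e' _ _ _ _ P'] by blast
  next
    show "{q''. \<exists>q\<^sub>1\<in>galois_orbit q. legendre p q\<^sub>1 p' q''} = galois_orbit q'"
    proof (intro equalityI subsetI; clarify?)
      fix q'' q\<^sub>1 assume q\<^sub>1: "q\<^sub>1 \<in> galois_orbit q" and L: "legendre p q\<^sub>1 p' q''"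
      from L obtain N N' x Q Z \<Xi> where L: "exp_factor q''" "clears_denominators N q\<^sub>1"
        "clears_denominators N' q''" "0 < fls_subdegree x" "Q = expand_factor N x q\<^sub>1"
        "Z = expand_coordinate p N x" "\<Xi> = expand_coordinate p' N' fls_X"
        "fls_deriv Q = \<Xi> * fls_deriv Z"
        "\<forall>m<0. fls_nth (Q - \<Xi> * Z) m = fls_nth (expand_factor N' fls_X q'') m"
        unfolding legendre_def Let_def by blast
      define \<Xi>' where "\<Xi>' = \<Xi>"
      have orb: "galois_orbit q\<^sub>1 = galois_orbit q" using q\<^sub>1 by (rule galois_orbit_cong)
      have "order_ge (Q - \<Xi> * Z - expand_factor N' fls_X q'') 0"
        using L(9) by (simp add: order_ge_def)
      hence "order_ge (fls_deriv (Q - \<Xi> * Z - expand_factor N' fls_X q'')) (0 - 1)" by (rule order_ge_deriv)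
      \<comment> \<open>From \<open>dQ = \<Xi> dZ\<close> and the product rule,
        \<open>d(Q - \<Xi> Z) = - Z d\<Xi>\<close>.\<close>
      hence "order_ge ((- Z) * fls_deriv \<Xi> - fls_deriv (expand_factor N' fls_X q'')) (-1)"
        using L(8) by (simp add: algebra_simps)
      hence P1: "parametrizes p' q'' \<Xi> (- Z)"
        using L by (intro parametrizesI[of q'' N' fls_X]) simp_all
      have "parametrizes p q\<^sub>1 Z \<Xi>"
        using L q q\<^sub>1 by (intro parametrizesI[of q\<^sub>1 N x]) (simp_all add: exp_factor_galois_orbit)
      hence P: "parametrizes p q Z \<Xi>"
        by (rule parametrizes_conj) (simp add: orb galois_orbit_refl)
      obtain \<omega> where w: "\<omega> ^ N = 1" "\<omega> \<noteq> 0" "q = rotate_factor N \<omega> q\<^sub>1"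
        using galois_orbitE[of q q\<^sub>1 N] L(2) orb galois_orbit_refl[of q] by metis
      define y where "y = fls_const (inverse \<omega>) * x"
      have "expand_factor N y q = Q"
        unfolding y_def L(5) by (subst expand_factor_rotate) (simp_all add: w rotate_factor_rotate_factor)
      moreover have "expand_coordinate p N y = Z"
        unfolding y_def L(6) using w by (intro expand_coordinate_const_mult) (simp add: power_inverse)
      moreover have "0 < fls_subdegree y"
        using L(4) w(2) by (cases "x = 0") (simp_all add: y_def)
      moreover have "clears_denominators N q"
        using L(2) q\<^sub>1 clears_denominators_galois_orbit by blast
      ultimately have "parametrizes p' q' \<Xi> (- Z)"
        using exact'[of N y Z \<Xi>] L(8) by simp
      from parametrizes_unique(2)[OF this P1] show "q'' \<in> galois_orbit q'"
        using galois_orbit_refl by blast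
    next
      fix q'' assume q'': "q'' \<in> galois_orbit q'"
      obtain N t where N: "clears_denominators N q''" "fls_subdegree t = 1" "\<Xi>\<^sub>0 = expand_coordinate p' N t"
        "order_ge (- Z\<^sub>0 * fls_deriv \<Xi>\<^sub>0 - fls_deriv (expand_factor N t q'')) (-1)"
        using parametrizes_normal_form[OF parametrizes_conj[OF q' q'']] .
      \<comment> \<open>\<open>legendre\<close> wants the target coordinate as an exact power of the
        parameter, so t is reparametrized to become \<open>fls_X\<close>; x is the old parameter in
        terms of the new one.\<close>
      obtain \<psi> where \<psi>: "int (subdegree \<psi>) = fls_subdegree (fls_X :: complex fls)" "t \<triangleleft> \<psi> = fls_X"
        using exists_reparam[OF N(2), of fls_X] by auto
      hence d: "subdegree \<psi> = 1" by simp
      hence rp: "reparam \<psi>" by simp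
      define x where "x = fps_to_fls \<psi>"
      have x: "fls_X \<triangleleft> \<psi> = x" "0 < fls_subdegree x" using rp by (simp_all add: x_def fls_subdegree_fls_to_fps)
      define Q Z \<Xi> where "Q = expand_factor r x q" and "Z = expand_coordinate p r x"
        and "\<Xi> = expand_coordinate p' N fls_X"
      have Q: "Q = Q\<^sub>0 \<triangleleft> \<psi>" unfolding Q_def Q\<^sub>0_def expand_factor_compose[OF rp] x(1) ..
      have Z: "Z = Z\<^sub>0 \<triangleleft> \<psi>" unfolding Z_def Z\<^sub>0_def expand_coordinate_compose[OF rp] x(1) r_def ..
      have \<Xi>: "\<Xi> = \<Xi>\<^sub>0 \<triangleleft> \<psi>" unfolding \<Xi>_def N(3) expand_coordinate_compose[OF rp] \<psi>(2) ..
      have E: "expand_factor N fls_X q'' = expand_factor N t q'' \<triangleleft> \<psi>"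
        unfolding expand_factor_compose[OF rp] \<psi>(2) ..
      have dQ: "fls_deriv Q = \<Xi> * fls_deriv Z"
        unfolding Q Z \<Xi> fls_deriv_compose[OF rp] \<Xi>\<^sub>0[symmetric] by (simp add: compose_simps[OF rp rp] mult_ac)
      have "((- Z\<^sub>0 * fls_deriv \<Xi>\<^sub>0 - fls_deriv (expand_factor N t q'')) \<triangleleft> \<psi>) * fls_deriv (fps_to_fls \<psi>)
        = - Z * fls_deriv \<Xi> - fls_deriv (expand_factor N fls_X q'')"
        unfolding Z \<Xi> E fls_deriv_compose[OF rp] by (simp add: compose_simps[OF rp rp] algebra_simps)
      also have "\<dots> = fls_deriv (Q - \<Xi> * Z - expand_factor N fls_X q'')"
        using dQ by (simp add: algebra_simps)
      finally have "order_ge (fls_deriv (Q - \<Xi> * Z - expand_factor N fls_X q'')) (0 - 1)"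
        using order_ge_log_compose[OF rp N(4)] by simp
      hence "order_ge (Q - \<Xi> * Z - expand_factor N fls_X q'') 0"
        by (rule order_ge_deriv_cancel) simp
      hence "\<forall>m<0. fls_nth (Q - \<Xi> * Z) m = fls_nth (expand_factor N fls_X q'') m"
        by (simp add: order_ge_def)
      hence "legendre p q p' q''"
        using dQ r(2) N(1) x(2) parametrizes_exp_factor[OF q'] exp_factor_galois_orbit[OF q'']
        unfolding legendre_def Let_def Q_def Z_def \<Xi>_def by blast
      thus "\<exists>q\<^sub>1\<in>galois_orbit q. legendre p q\<^sub>1 p' q''" using galois_orbit_refl by blast
    qed
  qed
qed

section \<open>The Fourier transform on the different kinds of circles\<close>

lemma subdegree_deriv_expand_factor:
  assumes "exp_factor q" "q \<noteq> 0" "clears_denominators r q" "fls_subdegree s = 1"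
  shows "fls_deriv (expand_factor r s q) \<noteq> 0"
    and "of_int (fls_subdegree (fls_deriv (expand_factor r s q))) = - slope q * of_nat r - 1"
proof -
  let ?Q = "expand_factor r s q"
  have Q: "of_int (fls_subdegree ?Q) = - (slope q * of_nat r)"
    using subdegree_expand_factor(2)[OF assms(3,2,4)] assms by (simp add: slope_eq)
  moreover have neg: "- (slope q * of_nat r) < 0"
    using slope_pos[OF assms(1,2)] clears_denominators_pos[OF assms(3)] by simp
  ultimately have "of_int (fls_subdegree ?Q) < (of_int 0 :: rat)" by simp
  hence lt: "fls_subdegree ?Q < 0" by (simp only: of_int_less_iff)
  have d: "fls_subdegree (fls_deriv ?Q) = fls_subdegree ?Q - 1"
    using lt by (intro fls_subdegree_deriv) simp
  thus "of_int (fls_subdegree (fls_deriv ?Q)) = - slope q * of_nat r - 1" using Q by simp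
  show "fls_deriv ?Q \<noteq> 0" using d lt by auto
qed

lemma a_representative_circle_of: "a_representative (circle_of p q) \<in> galois_orbit q"
  unfolding a_representative_def circle_of_def snd_conv by (rule someI, rule galois_orbit_refl)

lemma circle_of_cong: "q' \<in> galois_orbit q \<Longrightarrow> circle_of p q' = circle_of p q"
  by (simp add: circle_of_def galois_orbit_cong)

text \<open>Here q1 is q with the linear part removed when the target is finite, since that part
  only contributes the constant b to dq/dz. The last hypothesis reads slope > 1 from infinity to
  infinity and slope < 1 from infinity to a finite point; from a finite point to infinity it always
  holds.\<close>

lemma fourier_core_circle:
  assumes "represents c Z \<Xi>" and c: "c = circle_of p q" and P: "parametrizes p q Z \<Xi>"
    and F: "fourier_circle c = (p', {q''. \<exists>q\<in>snd c. legendre p q p' q''})"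
    and q1: "exp_factor q1" "q1 \<noteq> 0" "clears_denominators (ram q) q1"
    and dQ: "fls_deriv (expand_factor (ram q) fls_X q) =
      fls_deriv (expand_factor (ram q) fls_X q1) + fls_const (basepoint p') * fls_deriv (expand_coordinate p (ram q) fls_X)"
    and e: "0 < of_int (coordinate_order p') * (- slope q1 - of_int (coordinate_order p))"
  shows "represents (fourier_circle c) \<Xi> (- Z)"
proof -
  define r where "r = ram q"
  have r: "0 < r" by (simp add: r_def ram_pos)
  define dZ where "dZ = fls_deriv (expand_coordinate p r fls_X)"
  have dZ: "dZ \<noteq> 0" "fls_subdegree dZ = coordinate_order p * int r - 1"
    using deriv_expand_coordinate[of r fls_X p] r by (simp_all add: dZ_def)
  define dQ1 where "dQ1 = fls_deriv (expand_factor r fls_X q1)"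
  have dQ1: "dQ1 \<noteq> 0" "of_int (fls_subdegree dQ1) = - slope q1 * of_nat r - 1"
    using subdegree_deriv_expand_factor[OF q1, of fls_X] by (simp_all add: dQ1_def r_def)
  define D where "D = fls_deriv (expand_factor r fls_X q) / dZ - fls_const (basepoint p')"
  have "D = dQ1 / dZ"
    using dZ(1) dQ by (simp add: D_def dQ1_def dZ_def r_def add_divide_distrib)
  hence sD: "fls_subdegree D = fls_subdegree dQ1 - (coordinate_order p * int r - 1)"
    using dQ1 dZ by (simp add: fls_divide_subdegree)
  have sD': "(of_int (fls_subdegree D) :: rat) = (- slope q1 - of_int (coordinate_order p)) * of_nat r"
    unfolding sD by (simp add: dQ1 algebra_simps)
  have "(of_int (coordinate_order p' * fls_subdegree D) :: rat)
      = of_int (coordinate_order p') * (- slope q1 - of_int (coordinate_order p)) * of_nat r"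
    by (simp add: sD')
  also have "\<dots> > 0" using e r by simp
  finally have e1: "0 < coordinate_order p' * fls_subdegree D" by (simp only: of_int_0_less_iff)
  have "(of_int (coordinate_order p * int r + fls_subdegree D) :: rat) = - (slope q1 * of_nat r)"
    by (simp add: sD' algebra_simps)
  also have "\<dots> < 0" using slope_pos[OF q1(1,2)] r by simp
  finally have e2: "coordinate_order p * int r + fls_subdegree D < 0" by (simp only: of_int_less_0_iff)
  obtain q' where "exp_factor q'" and
    q': "{q''. \<exists>q\<^sub>1\<in>galois_orbit q. legendre p q\<^sub>1 p' q''} = galois_orbit q'"
    "\<And>Z \<Xi>. parametrizes p q Z \<Xi> \<Longrightarrow> parametrizes p' q' \<Xi> (- Z)"
    by (rule fourier_core[OF parametrizes_exp_factor[OF P] e1[unfolded D_def dZ_def r_def] e2[unfolded D_def dZ_def r_def]],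
        rule that)
  have "fourier_circle c = circle_of p' q'"
    unfolding F using q'(1) by (simp add: c circle_of_def)
  moreover have "nondegenerate \<Xi> (- Z)"
    using assms(1) by (simp add: represents_def nondegenerate_fourier)
  ultimately show ?thesis using representsI q'(2)[OF P] by simp
qed

lemma represents_fourier:
  assumes R: "represents c Z \<Xi>"
  shows "represents (fourier_circle c) \<Xi> (- Z)"
proof -
  from R obtain p q0 where pq0: "c = circle_of p q0" "parametrizes p q0 Z \<Xi>"
    and nd: "nondegenerate \<Xi> (- Z)"
    by (auto simp: represents_def nondegenerate_fourier)
  define q where "q = a_representative c"
  have qo: "q \<in> galois_orbit q0" unfolding q_def pq0(1) by (rule a_representative_circle_of)
  have c: "c = circle_of p q" using circle_of_cong[OF qo] pq0(1) by simp
  have P: "parametrizes p q Z \<Xi>" using parametrizes_conj[OF pq0(2) qo] .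
  have fs: "fst c = p" "snd c = galois_orbit q" by (simp_all add: c circle_of_def)
  have q: "exp_factor q" using P by (rule parametrizes_exp_factor)
  define r where "r = ram q"
  have r: "0 < r" "clears_denominators r q" by (simp_all add: r_def ram_pos clears_denominators_ram)
  obtain N s where N: "clears_denominators N q" "fls_subdegree s = 1" "Z = expand_coordinate p N s"
    "order_ge (\<Xi> * fls_deriv Z - fls_deriv (expand_factor N s q)) (-1)"
    using parametrizes_normal_form[OF P] .
  have N0: "0 < N" using N(1) by (rule clears_denominators_pos)
  have dZ: "fls_deriv Z \<noteq> 0" "fls_subdegree (fls_deriv Z) = coordinate_order p * int N - 1"
    using deriv_expand_coordinate[of N s p] N N0 by auto
  have Zo: "order_ge (Z - fls_const (basepoint p)) (coordinate_order p * int N)"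
    using subdegree_expand_coordinate[of p N s] N(2,3) by (simp add: order_ge_iff)
  have res: "fls_nth (\<Xi> * fls_deriv Z) (-1) \<noteq> 0" using R by (simp add: represents_def nondegenerate_def)
  \<comment> \<open>This covers the tame circles at finite points and the circles of \<alpha> z at
    infinity. The nonzero residue forces \<open>(\<Xi> - b) dZ\<close> to have order exactly -1, so
    \<open>\<Xi> - b\<close> and Z minus its base point a have opposite orders. Then
    \<open>(Z - a) d\<Xi>\<close> is logarithmic as well, and \<open>- a d\<Xi>\<close> is all that
    remains of \<open>- Z d\<Xi>\<close>.\<close>
  have tame: "represents (circle_of p' q') \<Xi> (- Z)"
    if b: "order_ge ((\<Xi> - fls_const (basepoint p')) * fls_deriv Z) (-1)" and p': "coordinate_order p' = - coordinate_order p"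
      and q': "\<And>t. \<Xi> = expand_coordinate p' N t \<Longrightarrow> t \<noteq> 0 \<Longrightarrow> expand_factor N t q' = fls_const (- basepoint p) * \<Xi>"
      and cl: "clears_denominators N q'" "exp_factor q'" for p' q'
  proof -
    define D where "D = \<Xi> - fls_const (basepoint p')"
    have "fls_nth (fls_deriv Z) (-1) = 0" by (rule fls_deriv_residue)
    hence r1: "fls_nth (D * fls_deriv Z) (-1) \<noteq> 0"
      using res by (simp add: D_def left_diff_distrib)
    have "fls_subdegree (D * fls_deriv Z) = -1"
      using subdegree_eq_iff_order_ge[OF r1] b by (simp add: D_def)
    moreover have D0: "D \<noteq> 0" using r1 by auto
    ultimately have sD: "fls_subdegree D = coordinate_order p' * int N"
      using dZ p' by simp
    hence "fls_subdegree (\<Xi> - fls_const (basepoint p')) = coordinate_order p' * int N" by (simp add: D_def)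
    moreover obtain k where "k ^ N = fls_nth (\<Xi> - fls_const (basepoint p')) (coordinate_order p' * int N) powi coordinate_order p'"
      using exists_complex_root[OF N0] by blast
    ultimately obtain t where t: "fls_subdegree t = 1" "\<Xi> = expand_coordinate p' N t"
      using exists_uniformiser[OF _ N0] by blast
    have "t \<noteq> 0" using t(1) by auto
    note ex = q'[OF t(2) this]
    have "order_ge (fls_deriv D) (coordinate_order p' * int N - 1)"
      by (intro order_ge_deriv) (simp add: order_ge_iff sD)
    hence "order_ge ((Z - fls_const (basepoint p)) * fls_deriv D) (coordinate_order p * int N + (coordinate_order p' * int N - 1))"
      by (rule order_ge_mult[OF Zo])
    hence "order_ge (- ((Z - fls_const (basepoint p)) * fls_deriv D)) (-1)" using p' by simp
    also have "- ((Z - fls_const (basepoint p)) * fls_deriv D) = - Z * fls_deriv \<Xi> - fls_deriv (expand_factor N t q')"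
      unfolding ex by (simp add: D_def algebra_simps fls_const_uminus)
    finally have "parametrizes p' q' \<Xi> (- Z)"
      using t cl by (intro parametrizesI[of q' N t]) simp_all
    thus ?thesis using representsI[OF nd] by blast
  qed
  show ?thesis
  proof (cases p)
    case p: (Aff a)
    show ?thesis
    proof (cases "q = 0")
      case True
      have "represents (circle_of Infty (Poly_Mapping.single 1 (- a))) \<Xi> (- Z)"
      proof (rule tame)
        show "order_ge ((\<Xi> - fls_const (basepoint Infty)) * fls_deriv Z) (-1)" using N(4) True by simp
        show "clears_denominators N (Poly_Mapping.single 1 (- a))"
          using N0 by (auto simp: clears_denominators_def split: if_splits)
        show "exp_factor (Poly_Mapping.single 1 (- a))" by (rule exp_factor_single) simp
        show "expand_factor N t (Poly_Mapping.single 1 (- a)) = fls_const (- basepoint p) * \<Xi>"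
          if "\<Xi> = expand_coordinate Infty N t" for t
          unfolding that expand_factor_single p by (simp add: expand_coordinate_def power_int_minus)
      qed (simp add: p)
      moreover have "fourier_circle c = circle_of Infty (Poly_Mapping.single 1 (- a))"
        using True p by (simp add: fourier_circle_def fs flip: q_def)
      ultimately show ?thesis by simp
    next
      case False
      have F: "fourier_circle c = (Infty, {q''. \<exists>q\<in>snd c. legendre p q Infty q''})"
        using False p by (simp add: fourier_circle_def fs flip: q_def)
      show ?thesis
        by (rule fourier_core_circle[OF R c P F q False clears_denominators_ram])
          (use slope_pos[OF q False] p in simp_all)
    qed
  next
    case p: Infty
    define b where "b = coef q 1"
    define q1 where "q1 = drop_linear q"
    have q1: "q1 = q - Poly_Mapping.single 1 b" by (simp add: q1_def drop_linear_def b_def)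
    have cq1: "coef q1 e = (if e = 1 then 0 else coef q e)" for e
      by (simp add: q1 lookup_minus lookup_single when_def b_def)
    have exq1: "exponents q1 = exponents q - {1}" by (auto simp: exponents_iff cq1 split: if_splits)
    have efq1: "exp_factor q1" using q exq1 by (auto simp: exp_factor_def)
    have clq1: "clears_denominators M q1" if "clears_denominators M q" for M
      using that exq1 by (simp add: clears_denominators_def)
    have qq1: "q = q1 + Poly_Mapping.single 1 b" by (simp add: q1)
    have lin: "expand_factor M x (Poly_Mapping.single 1 b) = fls_const b * expand_coordinate Infty M x" for M x
      by (simp add: expand_factor_single expand_coordinate_def power_int_minus)
    have eq: "expand_factor M x q = expand_factor M x q1 + fls_const b * expand_coordinate Infty M x" for M x
      unfolding lin[symmetric] by (subst qq1) (rule expand_factor_add)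
    consider "1 < slope q" | "slope q \<le> 1" "q1 = 0" | "slope q \<le> 1" "q1 \<noteq> 0" by force
    thus ?thesis
    proof cases
      case 1
      hence F: "fourier_circle c = (Infty, {q''. \<exists>q\<in>snd c. legendre p q Infty q''})"
        using p by (simp add: fourier_circle_def fs flip: q_def)
      have "q \<noteq> 0" using 1 by auto
      show ?thesis
        by (rule fourier_core_circle[OF R c P F q \<open>q \<noteq> 0\<close> clears_denominators_ram])
          (use 1 p in simp_all)
    next
      case 2
      have "represents (circle_of (Aff b) 0) \<Xi> (- Z)"
      proof (rule tame)
        show "order_ge ((\<Xi> - fls_const (basepoint (Aff b))) * fls_deriv Z) (-1)"
          using N(4) 2(2) unfolding eq by (simp add: N(3) p algebra_simps)
        show "clears_denominators N 0" using N0 by (simp add: clears_denominators_def)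
      qed (simp_all add: p)
      moreover have "fourier_circle c = circle_of (Aff b) 0"
        using 2 p by (simp add: fourier_circle_def fs b_def q1_def flip: q_def)
      ultimately show ?thesis by simp
    next
      case 3
      have "coef q' 1 = b" if "q' \<in> galois_orbit q" for q'
        using coef_galois_orbit_of_int[OF that, of 1] by (simp add: b_def)
      hence F: "fourier_circle c = (Aff b, {q''. \<exists>q\<in>snd c. legendre p q (Aff b) q''})"
        using 3 p by (simp add: fourier_circle_def fs q1_def flip: q_def) (auto simp: b_def)
      have "\<forall>e\<in>exponents q. e \<le> 1" using 3(1) q slope_le_iff by simp
      hence "\<forall>e\<in>exponents q1. e < 1" using exq1 by (auto simp: less_le)
      moreover have "Max (exponents q1) \<in> exponents q1" using 3(2) by (intro Max_in) auto
      ultimately have "slope q1 < 1" using 3(2) efq1 by (simp add: slope_eq)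
      thus ?thesis
        by (intro fourier_core_circle[OF R c P F efq1 3(2) clq1[OF clears_denominators_ram]])
          (simp_all add: eq p)
    qed
  qed
qed

section \<open>Words in the elementary transformations\<close>

definition word_matrix :: "elementary list \<Rightarrow> complex^2^2" where
  "word_matrix gs = foldr (\<lambda>g M. elementary_matrix g ** M) gs (Finite_Cartesian_Product.mat 1)"

definition word_circle :: "elementary list \<Rightarrow> circle \<Rightarrow> circle" where
  "word_circle gs c = foldr elementary_circle gs c"

lemma represents_elementary:
  assumes "represents c Z \<Xi>" "valid_elementary g"
  shows "represents (elementary_circle g c) (act_Z (elementary_matrix g) Z \<Xi>) (act_\<Xi> (elementary_matrix g) Z \<Xi>)"
proof (cases g)
  case (Twist \<mu>)
  thus ?thesis using represents_twist[OF assms(1)] by (simp add: act_Z_def act_\<Xi>_def)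
next
  case (Scaling \<mu>)
  thus ?thesis using represents_scale[OF assms(1)] assms(2) by (simp add: act_Z_def act_\<Xi>_def)
next
  case Fourier
  thus ?thesis using represents_fourier[OF assms(1)] by (simp add: act_Z_def act_\<Xi>_def fls_const_uminus)
qed

lemma represents_word:
  assumes "represents c Z \<Xi>" "\<forall>g\<in>set gs. valid_elementary g"
  shows "represents (word_circle gs c) (act_Z (word_matrix gs) Z \<Xi>) (act_\<Xi> (word_matrix gs) Z \<Xi>)"
  using assms(2)
proof (induction gs)
  case Nil
  thus ?case using assms(1) by (simp add: word_circle_def word_matrix_def)
next
  case (Cons g gs)
  thus ?case using represents_elementary[of "word_circle gs c" _ _ g]
    by (simp add: word_circle_def word_matrix_def act_mult)
qed

lemma represents_exists:
  fixes p :: P1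
  assumes "exp_factor q" "clears_denominators N q"
  defines "Z \<equiv> expand_coordinate p N fls_X"
  defines "\<Xi> \<equiv> (fls_deriv (expand_factor N fls_X q) + fls_X_inv) / fls_deriv Z"
  shows "represents (circle_of p q) Z \<Xi>"
proof -
  have dZ: "fls_deriv Z \<noteq> 0"
    unfolding Z_def using deriv_expand_coordinate(1) clears_denominators_pos[OF assms(2)] by simp
  have e: "\<Xi> * fls_deriv Z = fls_deriv (expand_factor N fls_X q) + fls_X_inv"
    using dZ by (simp add: \<Xi>_def)
  have "nondegenerate Z \<Xi>" unfolding nondegenerate_def e by simp
  moreover have "parametrizes p q Z \<Xi>"
    using assms(1,2) by (intro parametrizesI[of q N fls_X]) (simp_all add: Z_def[symmetric] e order_ge_iff)
  ultimately show ?thesis by (rule representsI)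
qed

lemma is_circle_represents: "is_circle c \<Longrightarrow> \<exists>Z \<Xi>. represents c Z \<Xi>"
  unfolding is_circle_def using represents_exists clears_denominators_ram by blast

lemma is_circle_word:
  assumes "is_circle c" "\<forall>g\<in>set gs. valid_elementary g"
  shows "is_circle (word_circle gs c)"
proof -
  obtain Z \<Xi> where "represents c Z \<Xi>" using is_circle_represents[OF assms(1)] by blast
  from represents_word[OF this assms(2)] show ?thesis
    unfolding represents_def is_circle_def using parametrizes_exp_factor by blast
qed

lemma word_circle_eq_if_word_matrix_eq:
  assumes "is_circle c" "word_matrix gs = word_matrix hs"
    "\<forall>g\<in>set gs. valid_elementary g" "\<forall>g\<in>set hs. valid_elementary g"
  shows "word_circle gs c = word_circle hs c"
proof -
  obtain Z \<Xi> where R: "represents c Z \<Xi>" using is_circle_represents[OF assms(1)] by blast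
  show ?thesis
    using represents_unique[OF represents_word[OF R assms(4)] represents_word[OF R assms(3), unfolded assms(2)]] .
qed

lemma word_matrix_append: "word_matrix (gs @ hs) = word_matrix gs ** word_matrix hs"
  by (induction gs) (simp_all add: word_matrix_def matrix_mul_assoc)

lemma word_circle_append: "word_circle (gs @ hs) c = word_circle gs (word_circle hs c)"
  by (simp add: word_circle_def)

lemma det_word_matrix: "\<forall>g\<in>set gs. valid_elementary g \<Longrightarrow> det (word_matrix gs) = 1"
proof (induction gs)
  case (Cons g gs)
  have "det (elementary_matrix g) = 1" using Cons.prems by (cases g) (auto simp: det_2)
  thus ?case using Cons by (simp add: word_matrix_def det_mul)
qed (simp add: word_matrix_def)

lemma exists_word:
  assumes "A \<in> SL2"
  obtains gs where "\<forall>g\<in>set gs. valid_elementary g" "word_matrix gs = A"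
  using sl2_acts_exists[OF assms, of undefined] unfolding sl2_acts_def word_matrix_def by blast

text \<open>Any factorization of the inverse matrix serves: the composite word has the identity
  matrix, like the empty word, hence acts like it on circles.\<close>

lemma exists_inverse_word:
  assumes "\<forall>g\<in>set gs. valid_elementary g"
  obtains hs where "\<forall>g\<in>set hs. valid_elementary g"
    "word_matrix gs ** word_matrix hs = Finite_Cartesian_Product.mat 1" "word_matrix hs ** word_matrix gs = Finite_Cartesian_Product.mat 1"
    "\<And>c. is_circle c \<Longrightarrow> word_circle hs (word_circle gs c) = c"
proof -
  have d: "det (word_matrix gs) = 1" by (rule det_word_matrix[OF assms])
  then obtain B where B: "word_matrix gs ** B = Finite_Cartesian_Product.mat 1" "B ** word_matrix gs = Finite_Cartesian_Product.mat 1"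
    using invertible_det_nz[of "word_matrix gs"] unfolding invertible_def by auto
  have "det (word_matrix gs ** B) = 1" unfolding B(1) by simp
  hence "B \<in> SL2" using d by (simp add: SL2_def det_mul)
  then obtain hs where hs: "\<forall>g\<in>set hs. valid_elementary g" "word_matrix hs = B" by (rule exists_word)
  have "word_circle hs (word_circle gs c) = c" if "is_circle c" for c
  proof -
    have "word_circle (hs @ gs) c = word_circle [] c"
      using that assms hs B
      by (intro word_circle_eq_if_word_matrix_eq) (auto simp: word_matrix_append, simp add: word_matrix_def)
    thus ?thesis by (simp add: word_circle_append) (simp add: word_circle_def)
  qed
  with hs B that show ?thesis by blast
qed

section \<open>Circles at infinity of slope at most two\<close>

definition flat :: "circle \<Rightarrow> bool" where
  "flat c \<longleftrightarrow> fst c = Infty \<and> (\<forall>q\<in>snd c. slope q \<le> 2)"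

lemma is_circleE:
  assumes "is_circle c"
  obtains p q where "exp_factor q" "c = circle_of p q"
  using assms unfolding is_circle_def by blast

lemma is_circle_member:
  assumes "is_circle c" "q \<in> snd c"
  shows "exp_factor q" "c = circle_of (fst c) q" "snd c = galois_orbit q"
proof -
  obtain p q0 where c: "exp_factor q0" "c = circle_of p q0" using assms(1) by (rule is_circleE)
  hence q: "q \<in> galois_orbit q0" using assms(2) by (simp add: circle_of_def)
  show "exp_factor q" using q c exp_factor_galois_orbit by blast
  show "c = circle_of (fst c) q" "snd c = galois_orbit q"
    using galois_orbit_cong[OF q] c(2) by (simp_all add: circle_of_def)
qed

lemma is_circle_a_representative: "is_circle c \<Longrightarrow> a_representative c \<in> snd c"
  using a_representative_circle_of by (auto simp: is_circle_def circle_of_def)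

lemma circle_ram_eq:
  assumes "is_circle c" "q \<in> snd c"
  shows "circle_ram c = ram q"
  using is_circle_a_representative[OF assms(1)] is_circle_member(3)[OF assms] ram_galois_orbit
  by (simp add: circle_ram_def)

lemma flat_circle_of: "flat (circle_of Infty q) \<longleftrightarrow> slope q \<le> 2"
proof -
  have "(\<forall>q'\<in>galois_orbit q. slope q' \<le> 2) \<longleftrightarrow> slope q \<le> 2"
    using galois_orbit_refl slope_galois_orbit by metis
  thus ?thesis by (simp add: flat_def circle_of_def)
qed

text \<open>As \<open>dZ\<close> has order one less than Z, the condition on \<Xi> says that
  \<open>\<Xi> dZ\<close> has order at least twice that of Z minus 1. This is the bound on dq for
  slope 2, and the logarithmic error lies within it.\<close>

lemma parametrizes_slope_le_2_iff:
  assumes "parametrizes Infty q Z \<Xi>"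
  shows "order_ge \<Xi> (fls_subdegree Z) \<longleftrightarrow> slope q \<le> 2"
proof -
  obtain N s where N: "clears_denominators N q" "fls_subdegree s = 1" "Z = expand_coordinate Infty N s"
    "order_ge (\<Xi> * fls_deriv Z - fls_deriv (expand_factor N s q)) (-1)"
    using parametrizes_normal_form[OF assms] .
  have N0: "0 < N" using N(1) by (rule clears_denominators_pos)
  have dZ: "fls_deriv Z \<noteq> 0" "fls_subdegree (fls_deriv Z) = - int N - 1" "fls_subdegree Z = - int N"
    using deriv_expand_coordinate[of N s Infty] subdegree_expand_coordinate[of Infty N s] N N0 by auto
  let ?Q = "fls_deriv (expand_factor N s q)" and ?k = "2 * int N"
  have err: "order_ge (\<Xi> * fls_deriv Z - ?Q) (- ?k - 1)" using N(4) by (rule order_ge_mono) simp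
  have "order_ge \<Xi> (- int N) \<longleftrightarrow> order_ge (\<Xi> * fls_deriv Z) (- ?k - 1)"
    using order_ge_mult[of \<Xi> "- int N" "fls_deriv Z" "- int N - 1"] order_ge_mult_cancel[OF _ dZ(1), of \<Xi> "- ?k - 1"] dZ
    by (auto simp: order_ge_iff[of "fls_deriv Z"])
  also have "\<dots> \<longleftrightarrow> order_ge ?Q (- ?k - 1)"
    using order_ge_add[OF err, of ?Q] order_ge_diff[OF _ err, of "\<Xi> * fls_deriv Z"] by auto
  also have "\<dots> \<longleftrightarrow> slope q * of_nat N \<le> of_int ?k"
    using N assms by (intro order_ge_deriv_expand_factor_iff) (auto dest: parametrizes_exp_factor)
  also have "\<dots> \<longleftrightarrow> slope q \<le> 2" using N0 by simp
  finally show ?thesis using dZ(3) by simp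
qed

section \<open>Simultaneous transformation of branches over a common cover\<close>

definition std_Z :: "nat \<Rightarrow> complex fls" where
  "std_Z R = expand_coordinate Infty R fls_X"

text \<open>All factors cleared by R share \<open>std_Z R\<close>, so branches of different circles
  lie over one z. The term \<open>fls_X_inv\<close> supplies the nonzero residue required by
  \<open>nondegenerate\<close> and cancels in differences.\<close>

definition std_\<Xi> :: "nat \<Rightarrow> expfactor \<Rightarrow> complex fls" where
  "std_\<Xi> R q = (fls_deriv (expand_factor R fls_X q) + fls_X_inv) / fls_deriv (std_Z R)"

lemma std_Z: "0 < R \<Longrightarrow> fls_subdegree (std_Z R) = - int R" "fls_nth (std_Z R) (- int R) = 1"
    "0 < R \<Longrightarrow> fls_deriv (std_Z R) \<noteq> 0" "0 < R \<Longrightarrow> fls_subdegree (fls_deriv (std_Z R)) = - int R - 1"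
proof -
  have Z: "std_Z R = fls_X powi (- int R)" unfolding std_Z_def expand_coordinate_def power_int_minus power_int_of_nat by simp
  show "fls_subdegree (std_Z R) = - int R" "fls_nth (std_Z R) (- int R) = 1" by (simp_all add: Z)
  show "0 < R \<Longrightarrow> fls_deriv (std_Z R) \<noteq> 0" "0 < R \<Longrightarrow> fls_subdegree (fls_deriv (std_Z R)) = - int R - 1"
    unfolding std_Z_def using deriv_expand_coordinate[of R fls_X Infty] by auto
qed

lemma std_\<Xi>_diff:
  "0 < R \<Longrightarrow> (std_\<Xi> R q - std_\<Xi> R q') * fls_deriv (std_Z R) = fls_deriv (expand_factor R fls_X (q - q'))"
  using std_Z(3)[of R] by (simp add: std_\<Xi>_def expand_factor_diff left_diff_distrib)

lemma represents_std:
  "exp_factor q \<Longrightarrow> clears_denominators R q \<Longrightarrow> represents (circle_of Infty q) (std_Z R) (std_\<Xi> R q)"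
  unfolding std_Z_def std_\<Xi>_def by (rule represents_exists)

lemma order_ge_std_\<Xi>:
  assumes "exp_factor q" "clears_denominators R q" "slope q \<le> 2"
  shows "order_ge (std_\<Xi> R q) (- int R)"
proof -
  have R: "0 < R" using assms(2) by (rule clears_denominators_pos)
  obtain p q' where q': "circle_of Infty q = circle_of p q'" "parametrizes p q' (std_Z R) (std_\<Xi> R q)"
    using represents_std[OF assms(1,2)] unfolding represents_def by blast
  hence "p = Infty" "q' \<in> galois_orbit q" using galois_orbit_refl by (auto simp: circle_of_def)
  thus ?thesis
    using q'(2) parametrizes_slope_le_2_iff assms(3) slope_galois_orbit std_Z(1)[OF R] by metis
qed

text \<open>
  \<open>\<kappa>\<close> fixes the leading coefficient of the new uniformiser in terms of that of \<open>\<Xi>\<close>. Without this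
  choice \<open>q'\<close> is determined up to conjugation only, and conjugates of different circles do not match.
\<close>

definition transforms ::
  "nat \<Rightarrow> complex^2^2 \<Rightarrow> (complex \<Rightarrow> complex) \<Rightarrow> expfactor \<Rightarrow> complex fls \<Rightarrow> expfactor \<Rightarrow> bool" where
  "transforms R A \<kappa> q s q' \<longleftrightarrow>
     (let z = act_Z A (std_Z R) (std_\<Xi> R q); \<xi> = act_\<Xi> A (std_Z R) (std_\<Xi> R q) in
      fls_subdegree s = 1 \<and> fls_nth s 1 = \<kappa> (fls_nth (std_\<Xi> R q) (- int R)) \<and>
      z = expand_coordinate Infty R s \<and> exp_factor q' \<and> clears_denominators R q' \<and>
      order_ge (\<xi> * fls_deriv z - fls_deriv (expand_factor R s q')) (-1))"

text \<open>The new coordinate has leading coefficient \<open>d - c l\<close> (second row of A) and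
  is to equal s^(-R), hence the inverse in the condition on \<kappa>.\<close>

lemma transforms_exists:
  assumes q: "exp_factor q" "clears_denominators R q" "slope q \<le> 2"
    and lam: "l = fls_nth (std_\<Xi> R q) (- int R)" and nz: "A $ 2 $ 2 - A $ 2 $ 1 * l \<noteq> 0"
    and \<kappa>: "\<kappa> l ^ R = inverse (A $ 2 $ 2 - A $ 2 $ 1 * l)"
  shows "\<exists>s q'. transforms R A \<kappa> q s q'"
proof -
  have R: "0 < R" using q(2) by (rule clears_denominators_pos)
  define z where "z = act_Z A (std_Z R) (std_\<Xi> R q)"
  have "order_ge z (- int R)"
    unfolding z_def act_Z_def
    by (intro order_ge_diff order_ge_const_mult order_ge_std_\<Xi> q) (simp add: order_ge_iff std_Z R)
  moreover have zn: "fls_nth z (- int R) = A $ 2 $ 2 - A $ 2 $ 1 * l"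
    by (simp add: z_def act_Z_def lam std_Z)
  ultimately have "fls_subdegree z = - int R" using subdegree_eq_iff_order_ge nz by metis
  then obtain s where s: "fls_subdegree s = 1" "fls_nth s 1 = \<kappa> l" "z = expand_coordinate Infty R s"
    using exists_uniformiser[of z Infty R "\<kappa> l"] R \<kappa> zn by (auto simp: power_int_minus)
  from exists_expand_factor[OF s(1) R, of "act_\<Xi> A (std_Z R) (std_\<Xi> R q) * fls_deriv z"] s
  show ?thesis unfolding transforms_def Let_def z_def lam by blast
qed

lemma slope_mult_int:
  assumes "exp_factor q" "clears_denominators N q"
  obtains k where "0 \<le> k" "slope q * of_nat N = of_int k"
proof (cases "q = 0")
  case True
  thus ?thesis using that[of 0] by simp
next
  case False
  have M: "Max (exponents q) \<in> exponents q" using False by (intro Max_in) auto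
  have "slope q = Max (exponents q)" using False by (simp add: slope_eq[OF assms(1)])
  hence k: "slope q * of_nat N = of_int \<lfloor>slope q * of_nat N\<rfloor>"
    by (simp only: clears_denominators_floor[OF assms(2) M])
  moreover have "0 \<le> \<lfloor>slope q * of_nat N\<rfloor>" using slope_nonneg[OF assms(1)] by simp
  ultimately show ?thesis using that by blast
qed

text \<open>The slope of q1 - q2 is the order of \<open>\<Xi>1 - \<Xi>2\<close> over the common Z;
  that of q1' - q2' is the order of \<delta>, where \<phi> carries z1 to z2. The identities
  \<open>z1 \<triangleleft> \<phi> - z1 = c * (\<Xi>1 - \<Xi>2)\<close> and \<open>\<delta> =
  (\<xi>1 \<triangleleft> \<phi> - \<xi>1) + a * (\<Xi>1 - \<Xi>2)\<close> bound \<delta> by the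
  mean value principle. The converse expresses Z and \<Xi> through z and \<xi> by the inverse
  matrix.\<close>

lemma transforms_slope:
  assumes det: "det A = 1"
    and q1: "exp_factor q1" "clears_denominators R q1" "slope q1 \<le> 2"
    and q2: "exp_factor q2" "clears_denominators R q2" "slope q2 \<le> 2"
    and T1: "transforms R A \<kappa> q1 s1 q1'" and T2: "transforms R A \<kappa> q2 s2 q2'"
    and fl: "slope q1' \<le> 2" "slope q2' \<le> 2"
  shows "slope (q1' - q2') = slope (q1 - q2)"
proof -
  have R: "0 < R" using q1(2) by (rule clears_denominators_pos)
  define a b c d where "a = fls_const (A $ 1 $ 1)" and "b = fls_const (A $ 1 $ 2)"
    and "c = fls_const (A $ 2 $ 1)" and "d = fls_const (A $ 2 $ 2)"
  have "a * d - b * c = fls_const (det A)"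
    by (simp add: a_def b_def c_def d_def det_2 fls_minus_const)
  hence abcd: "a * d - b * c = 1" using det by simp
  have og: "order_ge (a * f) n" "order_ge (b * f) n" "order_ge (c * f) n" "order_ge (d * f) n"
    if "order_ge f n" for f n
    using that by (simp_all add: a_def b_def c_def d_def order_ge_const_mult)
  define Z \<Xi>1 \<Xi>2 where "Z = std_Z R" and "\<Xi>1 = std_\<Xi> R q1" and "\<Xi>2 = std_\<Xi> R q2"
  define z1 z2 \<xi>1 \<xi>2 where "z1 = d * Z - c * \<Xi>1" and "z2 = d * Z - c * \<Xi>2"
    and "\<xi>1 = a * \<Xi>1 - b * Z" and "\<xi>2 = a * \<Xi>2 - b * Z"
  define l1 l2 where "l1 = fls_nth \<Xi>1 (- int R)" and "l2 = fls_nth \<Xi>2 (- int R)"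
  have act: "act_Z A (std_Z R) (std_\<Xi> R q1) = z1" "act_Z A (std_Z R) (std_\<Xi> R q2) = z2"
    "act_\<Xi> A (std_Z R) (std_\<Xi> R q1) = \<xi>1" "act_\<Xi> A (std_Z R) (std_\<Xi> R q2) = \<xi>2"
    by (simp_all add: act_Z_def act_\<Xi>_def z1_def z2_def \<xi>1_def \<xi>2_def a_def b_def c_def d_def Z_def \<Xi>1_def \<Xi>2_def)
  have t1: "fls_subdegree s1 = 1" "fls_nth s1 1 = \<kappa> l1" "z1 = expand_coordinate Infty R s1"
      "exp_factor q1'" "clears_denominators R q1'"
      "order_ge (\<xi>1 * fls_deriv z1 - fls_deriv (expand_factor R s1 q1')) (-1)"
    and t2: "fls_subdegree s2 = 1" "fls_nth s2 1 = \<kappa> l2" "z2 = expand_coordinate Infty R s2"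
      "exp_factor q2'" "clears_denominators R q2'"
      "order_ge (\<xi>2 * fls_deriv z2 - fls_deriv (expand_factor R s2 q2')) (-1)"
    using T1 T2 unfolding transforms_def Let_def act l1_def l2_def \<Xi>1_def \<Xi>2_def by blast+
  have Z: "fls_subdegree Z = - int R" "fls_nth Z (- int R) = 1" "fls_deriv Z \<noteq> 0"
      "fls_subdegree (fls_deriv Z) = - int R - 1"
    using std_Z[of R] R by (simp_all add: Z_def)
  have oZ: "order_ge Z (- int R)" by (simp add: order_ge_iff Z)
  have o\<Xi>: "order_ge \<Xi>1 (- int R)" "order_ge \<Xi>2 (- int R)"
    using order_ge_std_\<Xi> q1 q2 by (simp_all add: \<Xi>1_def \<Xi>2_def)
  have o\<xi>: "order_ge \<xi>1 (- int R)" unfolding \<xi>1_def by (intro order_ge_diff og oZ o\<Xi>)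
  have z: "fls_subdegree z1 = - int R" "fls_deriv z2 \<noteq> 0" "fls_subdegree (fls_deriv z2) = - int R - 1"
    using subdegree_expand_coordinate[of Infty R s1] deriv_expand_coordinate[of R s2 Infty] t1 t2 R by auto
  obtain \<phi> where \<phi>: "subdegree \<phi> = 1" "s1 \<triangleleft> \<phi> = s2"
    using exists_reparam[OF t1(1), of s2] t2(1) by auto
  have rp: "reparam \<phi>" using \<phi>(1) by simp
  have z12: "z1 \<triangleleft> \<phi> = z2" unfolding t1(3) t2(3) expand_coordinate_compose[OF rp] \<phi>(2) ..
  \<comment> \<open>This is where \<kappa> enters: equal directions give s1 and s2 equal leading
    coefficients, and \<phi> carries s1 to s2.\<close>
  have tangent: "fps_nth \<phi> 1 = 1" if "l1 = l2"
  proof -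
    have "fls_nth s1 1 * fps_nth \<phi> 1 = fls_nth s2 1"
      using fls_nth_compose_leading[OF \<phi>(1), of s1] t1(1) by (simp add: \<phi>(2) order_ge_iff)
    moreover have "fls_nth s1 1 = fls_nth s2 1" using t1(2) t2(2) that by simp
    moreover have "s2 \<noteq> 0" using t2(1) by auto
    hence "fls_nth s2 1 \<noteq> 0" using nth_fls_subdegree_nonzero t2(1) by metis
    ultimately show ?thesis by simp
  qed
  have F1: "slope (q1 - q2) * of_nat R \<le> of_int k \<longleftrightarrow> order_ge (\<Xi>1 - \<Xi>2) (int R - k)" if "0 \<le> k" for k
  proof -
    have "slope (q1 - q2) * of_nat R \<le> of_int k \<longleftrightarrow> order_ge ((\<Xi>1 - \<Xi>2) * fls_deriv Z) (- k - 1)"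
      unfolding \<Xi>1_def \<Xi>2_def Z_def std_\<Xi>_diff[OF R]
      using q1 q2 that by (intro order_ge_deriv_expand_factor_iff[symmetric] clears_denominators_diff exp_factor_diff) simp_all
    also have "\<dots> \<longleftrightarrow> order_ge (\<Xi>1 - \<Xi>2) (int R - k)"
      using order_ge_mult[of "\<Xi>1 - \<Xi>2" "int R - k" "fls_deriv Z" "- int R - 1"]
        order_ge_mult_cancel[OF _ Z(3), of "\<Xi>1 - \<Xi>2" "- k - 1"] Z(4)
      by (auto simp: order_ge_iff[of "fls_deriv Z"])
    finally show ?thesis .
  qed
  define \<delta> where "\<delta> = \<xi>1 \<triangleleft> \<phi> - \<xi>2"
  have F2: "slope (q1' - q2') * of_nat R \<le> of_int k \<longleftrightarrow> order_ge \<delta> (int R - k)" if "0 \<le> k" for k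
  proof -
    let ?Q = "fls_deriv (expand_factor R s2 (q1' - q2'))"
    have "((\<xi>1 * fls_deriv z1 - fls_deriv (expand_factor R s1 q1')) \<triangleleft> \<phi>) * fls_deriv (fps_to_fls \<phi>)
        = (\<xi>1 \<triangleleft> \<phi>) * fls_deriv z2 - fls_deriv (expand_factor R s2 q1')"
      unfolding z12[symmetric] \<phi>(2)[symmetric] expand_factor_compose[OF rp, symmetric] fls_deriv_compose[OF rp]
      by (simp add: compose_simps[OF rp rp] algebra_simps)
    hence "order_ge ((\<xi>1 \<triangleleft> \<phi>) * fls_deriv z2 - fls_deriv (expand_factor R s2 q1')) (-1)"
      using order_ge_log_compose[OF rp t1(6)] by simp
    from order_ge_diff[OF this t2(6)] have "order_ge (\<delta> * fls_deriv z2 - ?Q) (-1)"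
      by (simp add: \<delta>_def expand_factor_diff algebra_simps)
    hence err: "order_ge (\<delta> * fls_deriv z2 - ?Q) (- k - 1)" by (rule order_ge_mono) (use that in simp)
    have "slope (q1' - q2') * of_nat R \<le> of_int k \<longleftrightarrow> order_ge ?Q (- k - 1)"
      using t1 t2 that by (intro order_ge_deriv_expand_factor_iff[symmetric] clears_denominators_diff exp_factor_diff) simp_all
    also have "\<dots> \<longleftrightarrow> order_ge (\<delta> * fls_deriv z2) (- k - 1)"
      using order_ge_add[OF err, of ?Q] order_ge_diff[OF _ err, of "\<delta> * fls_deriv z2"] by auto
    also have "\<dots> \<longleftrightarrow> order_ge \<delta> (int R - k)"
      using order_ge_mult[of \<delta> "int R - k" "fls_deriv z2" "- int R - 1"]
        order_ge_mult_cancel[OF _ z(2), of \<delta> "- k - 1"] z(3)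
      by (auto simp: order_ge_iff[of "fls_deriv z2"])
    finally show ?thesis .
  qed
  \<comment> \<open>The bound on k means agreement strictly beyond the leading order -R, without
    which \<phi> need not be tangent to the identity.\<close>
  have main: "order_ge (\<Xi>1 - \<Xi>2) (int R - k) \<longleftrightarrow> order_ge \<delta> (int R - k)" if k: "k < 2 * int R" for k
  proof
    assume h: "order_ge (\<Xi>1 - \<Xi>2) (int R - k)"
    have "fls_nth (\<Xi>1 - \<Xi>2) (- int R) = 0" using h k unfolding order_ge_def by auto
    hence "fps_nth \<phi> 1 = 1" by (intro tangent) (simp add: l1_def l2_def)
    moreover have "z1 \<triangleleft> \<phi> - z1 = c * (\<Xi>1 - \<Xi>2)" unfolding z12 by (simp add: z1_def z2_def algebra_simps)
    hence "order_ge (z1 \<triangleleft> \<phi> - z1) (fls_subdegree z1 + (2 * int R - k))" using og(3)[OF h] z(1) by simp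
    ultimately have "order_ge (\<xi>1 \<triangleleft> \<phi> - \<xi>1) (- int R + (2 * int R - k))"
      using k z(1) R by (intro close_compose_transfer[OF \<phi>(1) _ _ _ _ o\<xi>, of z1]) simp_all
    moreover have "\<delta> = (\<xi>1 \<triangleleft> \<phi> - \<xi>1) + a * (\<Xi>1 - \<Xi>2)"
      by (simp add: \<delta>_def \<xi>1_def \<xi>2_def algebra_simps)
    ultimately show "order_ge \<delta> (int R - k)" using og(1)[OF h] by (simp add: order_ge_add)
  next
    assume h: "order_ge \<delta> (int R - k)"
    have Za: "Z = a * z1 + c * \<xi>1" "Z = a * z2 + c * \<xi>2" "\<Xi>1 = d * \<xi>1 + b * z1" "\<Xi>2 = d * \<xi>2 + b * z2"
    proof -
      have "a * z1 + c * \<xi>1 = (a * d - b * c) * Z" "a * z2 + c * \<xi>2 = (a * d - b * c) * Z"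
        "d * \<xi>1 + b * z1 = (a * d - b * c) * \<Xi>1" "d * \<xi>2 + b * z2 = (a * d - b * c) * \<Xi>2"
        by (simp_all add: z1_def z2_def \<xi>1_def \<xi>2_def algebra_simps)
      thus "Z = a * z1 + c * \<xi>1" "Z = a * z2 + c * \<xi>2" "\<Xi>1 = d * \<xi>1 + b * z1" "\<Xi>2 = d * \<xi>2 + b * z2"
        by (simp_all only: abcd mult_1)
    qed
    have con: "a \<triangleleft> \<phi> = a" "b \<triangleleft> \<phi> = b" "c \<triangleleft> \<phi> = c" "d \<triangleleft> \<phi> = d"
      by (simp_all add: a_def b_def c_def d_def)
    have "Z \<triangleleft> \<phi> = a * z2 + c * (\<xi>1 \<triangleleft> \<phi>)"
      by (subst Za(1)) (simp add: compose_simps[OF rp rp] con z12)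
    hence "Z \<triangleleft> \<phi> - Z = c * \<delta>"
      unfolding \<delta>_def using Za(2) by (simp add: algebra_simps)
    hence ZZ: "order_ge (Z \<triangleleft> \<phi> - Z) (int R - k)" using og(3)[OF h] by simp
    have "\<Xi>1 \<triangleleft> \<phi> = d * (\<xi>1 \<triangleleft> \<phi>) + b * z2"
      by (subst Za(3)) (simp add: compose_simps[OF rp rp] con z12)
    hence "\<Xi>1 \<triangleleft> \<phi> - \<Xi>2 = d * \<delta>"
      unfolding \<delta>_def using Za(4) by (simp add: algebra_simps)
    hence \<Xi>\<Xi>: "order_ge (\<Xi>1 \<triangleleft> \<phi> - \<Xi>2) (int R - k)" using og(4)[OF h] by simp
    \<comment> \<open>Tangency needs \<open>l1 = l2\<close>, still unknown in this direction. E
      lacks the leading term of \<Xi>1, and substitution of \<phi> keeps its order whatever the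
      linear coefficient. Since \<open>\<Xi>1 \<triangleleft> \<phi>\<close> and
      \<open>Z \<triangleleft> \<phi>\<close> agree with \<Xi>2 and Z to leading order,
      \<open>\<Xi>2 - l1 Z\<close> has no leading term either.\<close>
    define E where "E = \<Xi>1 - fls_const l1 * Z"
    have "order_ge E (- int R + 1)"
      unfolding E_def by (intro order_ge_Suc order_ge_diff order_ge_const_mult o\<Xi> oZ) (simp add: l1_def Z)
    hence E: "order_ge (E \<triangleleft> \<phi>) (- int R + 1)" by (rule order_ge_compose_unif[OF \<phi>(1)])
    have "\<Xi>2 - fls_const l1 * Z = E \<triangleleft> \<phi> - (\<Xi>1 \<triangleleft> \<phi> - \<Xi>2) + fls_const l1 * (Z \<triangleleft> \<phi> - Z)"
      by (simp add: E_def compose_simps[OF rp rp] algebra_simps)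
    moreover have "order_ge \<dots> (- int R + 1)"
      using k by (intro order_ge_add order_ge_diff E order_ge_const_mult order_ge_mono[OF \<Xi>\<Xi>] order_ge_mono[OF ZZ]) simp_all
    ultimately have "order_ge (\<Xi>2 - fls_const l1 * Z) (- int R + 1)" by (simp only:)
    hence "fls_nth (\<Xi>2 - fls_const l1 * Z) (- int R) = 0" unfolding order_ge_def by simp
    hence "l1 = l2" by (simp add: l2_def Z)
    note tan = tangent[OF this]
    have "order_ge (Z \<triangleleft> \<phi> - Z) (fls_subdegree Z + (2 * int R - k))" using ZZ Z(1) by simp
    hence "order_ge (\<Xi>1 \<triangleleft> \<phi> - \<Xi>1) (- int R + (2 * int R - k))"
      using k Z(1) R by (intro close_compose_transfer[OF \<phi>(1) tan _ _ _ o\<Xi>(1), of Z]) simp_all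
    hence "order_ge (\<Xi>1 \<triangleleft> \<phi> - \<Xi>1) (int R - k)" by simp
    from order_ge_diff[OF \<Xi>\<Xi> this] show "order_ge (\<Xi>1 - \<Xi>2) (int R - k)" by simp
  qed
  obtain m where m: "0 \<le> m" "slope (q1 - q2) * of_nat R = of_int m"
    using slope_mult_int[OF exp_factor_diff clears_denominators_diff] q1 q2 by metis
  obtain m' where m': "0 \<le> m'" "slope (q1' - q2') * of_nat R = of_int m'"
    using slope_mult_int[OF exp_factor_diff clears_denominators_diff] t1 t2 by metis
  \<comment> \<open>With both slopes at most 2, the numbers m and m' are at most 2R, so the
    equivalences for k < 2R already determine them.\<close>
  have "slope (q1 - q2) \<le> 2" "slope (q1' - q2') \<le> 2"
    using slope_diff_le q1 q2 t1 t2 fl by blast+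
  hence "slope (q1 - q2) * of_nat R \<le> 2 * of_nat R" "slope (q1' - q2') * of_nat R \<le> 2 * of_nat R"
    by (intro mult_right_mono; simp)+
  hence "(of_int m :: rat) \<le> of_int (2 * int R)" "(of_int m' :: rat) \<le> of_int (2 * int R)"
    unfolding m m' by simp_all
  hence le: "m \<le> 2 * int R" "m' \<le> 2 * int R" by (simp_all only: of_int_le_iff)
  have iff: "m \<le> k \<longleftrightarrow> m' \<le> k" if "0 \<le> k" "k < 2 * int R" for k
    using F1[OF that(1)] F2[OF that(1)] main[OF that(2)] unfolding m m' of_int_le_iff by blast
  have "m = m'"
  proof (rule ccontr)
    assume "m \<noteq> m'"
    then consider "m < m'" | "m' < m" by linarith
    thus False using iff[of m] iff[of m'] le m(1) m'(1) by cases auto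
  qed
  thus ?thesis using m(2) m'(2) R by (metis mult_right_cancel of_nat_eq_0_iff less_irrefl)
qed

lemma transforms_word:
  assumes c: "is_circle c" "flat c" and gs: "\<forall>g\<in>set gs. valid_elementary g" and fl: "flat (word_circle gs c)"
    and q: "q \<in> snd c" "clears_denominators R q"
    and \<kappa>: "\<And>l. word_matrix gs $ 2 $ 2 - word_matrix gs $ 2 $ 1 * l \<noteq> 0 \<Longrightarrow>
      \<kappa> l ^ R = inverse (word_matrix gs $ 2 $ 2 - word_matrix gs $ 2 $ 1 * l)"
  shows "\<exists>s q'. transforms R (word_matrix gs) \<kappa> q s q' \<and> q' \<in> snd (word_circle gs c)"
proof -
  define A where "A = word_matrix gs"
  have R: "0 < R" using q(2) by (rule clears_denominators_pos)
  have qe: "exp_factor q" "slope q \<le> 2" "c = circle_of Infty q"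
    using is_circle_member[OF c(1) q(1)] c(2) q(1) by (auto simp: flat_def)
  define \<Xi> l where "\<Xi> = std_\<Xi> R q" and "l = fls_nth \<Xi> (- int R)"
  define z \<xi> where "z = act_Z A (std_Z R) \<Xi>" and "\<xi> = act_\<Xi> A (std_Z R) \<Xi>"
  have rep: "represents (word_circle gs c) z \<xi>"
    unfolding z_def \<xi>_def \<Xi>_def A_def qe(3) by (intro represents_word represents_std qe q gs)
  then obtain p q0 where q0: "word_circle gs c = circle_of p q0" "parametrizes p q0 z \<xi>"
    by (auto simp: represents_def)
  have p: "p = Infty" using fl q0(1) by (simp add: flat_def circle_of_def)
  hence "slope q0 \<le> 2" using fl q0(1) flat_circle_of by simp
  hence \<xi>z: "order_ge \<xi> (fls_subdegree z)" using q0(2) p parametrizes_slope_le_2_iff by blast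
  have o: "order_ge (std_Z R) (- int R)" "order_ge \<Xi> (- int R)"
    using order_ge_std_\<Xi>[OF qe(1) q(2) qe(2)] by (simp_all add: order_ge_iff[of "std_Z R"] std_Z R \<Xi>_def)
  have oz: "order_ge z (- int R)" unfolding z_def act_Z_def
    by (intro order_ge_diff order_ge_const_mult o)
  have zn: "fls_nth z (- int R) = A $ 2 $ 2 - A $ 2 $ 1 * l"
    and \<xi>n: "fls_nth \<xi> (- int R) = A $ 1 $ 1 * l - A $ 1 $ 2"
    by (simp_all add: z_def \<xi>_def act_Z_def act_\<Xi>_def l_def std_Z)
  \<comment> \<open>If z lost its leading coefficient, flatness of the image would make that of
    \<xi> vanish too, and A would annihilate the nonzero vector (-l, 1).\<close>
  have nz: "A $ 2 $ 2 - A $ 2 $ 1 * l \<noteq> 0"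
  proof
    assume 0: "A $ 2 $ 2 - A $ 2 $ 1 * l = 0"
    obtain N s where "clears_denominators N q0" "fls_subdegree s = 1" "z = expand_coordinate Infty N s"
      using parametrizes_normal_form[OF q0(2)] p by blast
    hence "fls_subdegree z < 0"
      using subdegree_expand_coordinate[of Infty N s] clears_denominators_pos[of N q0] by simp
    hence "z \<noteq> 0" by auto
    moreover have "order_ge z (- int R + 1)" using order_ge_Suc[OF oz] zn 0 by simp
    ultimately have "- int R + 1 \<le> fls_subdegree z" by (simp add: order_ge_iff)
    hence "fls_nth \<xi> (- int R) = 0" using \<xi>z by (simp add: order_ge_def)
    hence "A $ 1 $ 2 = A $ 1 $ 1 * l" "A $ 2 $ 2 = A $ 2 $ 1 * l" using \<xi>n 0 by simp_all
    hence "det A = 0" by (simp add: det_2)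
    thus False using det_word_matrix[OF gs] by (simp add: A_def)
  qed
  obtain s q' where T: "transforms R A \<kappa> q s q'"
    using transforms_exists[OF qe(1) q(2) qe(2) _ nz, of \<kappa>] \<kappa>[of l] nz unfolding l_def \<Xi>_def A_def by blast
  hence "parametrizes Infty q' z \<xi>"
    unfolding transforms_def Let_def z_def[symmetric] \<xi>_def[symmetric] \<Xi>_def[symmetric]
    by (elim conjE) (rule parametrizesI[of q' R s], assumption+, simp, assumption+)
  hence "galois_orbit q' = galois_orbit q0" using parametrizes_unique(2)[OF q0(2)] by blast
  hence "q' \<in> snd (word_circle gs c)"
    using galois_orbit_refl[of q'] by (simp add: q0(1) circle_of_def)
  with T show ?thesis unfolding A_def by blast
qed

lemma exists_root_choice:
  assumes "0 < R"
  shows "\<exists>\<kappa>. \<forall>l::complex. d - c * l \<noteq> 0 \<longrightarrow> \<kappa> l ^ R = inverse (d - c * l)"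
  using exists_complex_root[OF assms] by (intro choice allI) blast

text \<open>The transformed factor lives on a cover of the same degree \<open>ram q\<close>, so its
  own ramification is no larger.\<close>

lemma circle_ram_word_le:
  assumes "is_circle c" "flat c" "\<forall>g\<in>set gs. valid_elementary g" "flat (word_circle gs c)"
  shows "circle_ram (word_circle gs c) \<le> circle_ram c"
proof -
  define q where "q = a_representative c"
  have q: "q \<in> snd c" unfolding q_def using assms(1) by (rule is_circle_a_representative)
  obtain \<kappa> where \<kappa>: "\<And>l. word_matrix gs $ 2 $ 2 - word_matrix gs $ 2 $ 1 * l \<noteq> 0 \<Longrightarrow>
      \<kappa> l ^ ram q = inverse (word_matrix gs $ 2 $ 2 - word_matrix gs $ 2 $ 1 * l)"
    using exists_root_choice[OF ram_pos] by blast
  obtain s q' where "transforms (ram q) (word_matrix gs) \<kappa> q s q'" "q' \<in> snd (word_circle gs c)"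
    using transforms_word[OF assms q clears_denominators_ram \<kappa>] by blast
  thus ?thesis
    using circle_ram_eq[OF assms(1) q] circle_ram_eq[OF is_circle_word[OF assms(1,3)]] ram_le
    unfolding transforms_def Let_def by metis
qed

text \<open>One R and one \<kappa> serve both orbits, so G is a single map on their union and
  respects slopes across the two circles. It is injective because only 0 has slope 0.\<close>

lemma word_circle_bij:
  assumes c: "is_circle c1" "is_circle c2" "flat c1" "flat c2"
    and gs: "\<forall>g\<in>set gs. valid_elementary g" and fl: "flat (word_circle gs c1)" "flat (word_circle gs c2)"
  obtains G where "inj_on G (snd c1)" "G ` snd c1 \<subseteq> snd (word_circle gs c1)"
    "inj_on G (snd c2)" "G ` snd c2 \<subseteq> snd (word_circle gs c2)"
    "\<And>q q'. q \<in> snd c1 \<Longrightarrow> q' \<in> snd c2 \<Longrightarrow> slope (G q - G q') = slope (q - q')"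
proof -
  define R where "R = circle_ram c1 * circle_ram c2"
  have cl: "clears_denominators R q" if "q \<in> snd c1 \<union> snd c2" for q
  proof -
    have "0 < circle_ram c1" "0 < circle_ram c2" by (simp_all add: circle_ram_def ram_pos)
    hence "clears_denominators (ram q * circle_ram c1) q" "clears_denominators (ram q * circle_ram c2) q"
      by (intro clears_denominators_mult clears_denominators_ram; simp)+
    moreover have "ram q = circle_ram c1 \<or> ram q = circle_ram c2"
      using that circle_ram_eq[OF c(1), of q] circle_ram_eq[OF c(2), of q] by auto
    ultimately show ?thesis unfolding R_def by (auto simp: mult.commute)
  qed
  have R: "0 < R" by (simp add: R_def circle_ram_def ram_pos)
  obtain \<kappa> where \<kappa>: "\<And>l. word_matrix gs $ 2 $ 2 - word_matrix gs $ 2 $ 1 * l \<noteq> 0 \<Longrightarrow>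
      \<kappa> l ^ R = inverse (word_matrix gs $ 2 $ 2 - word_matrix gs $ 2 $ 1 * l)"
    using exists_root_choice[OF R] by blast
  define ok where "ok = (\<lambda>q q'. (\<exists>s. transforms R (word_matrix gs) \<kappa> q s q') \<and>
    (q \<in> snd c1 \<longrightarrow> q' \<in> snd (word_circle gs c1)) \<and> (q \<in> snd c2 \<longrightarrow> q' \<in> snd (word_circle gs c2)))"
  \<comment> \<open>A factor in both orbits is subject to both membership demands in
    \<open>ok\<close>; they coincide because circles at infinity sharing a factor are equal.\<close>
  have same: "c1 = c2" if "q \<in> snd c1" "q \<in> snd c2" for q
    using is_circle_member(2)[OF c(1) that(1)] is_circle_member(2)[OF c(2) that(2)] c(3,4)
    by (simp add: flat_def)
  have "\<exists>q'. ok q q'" if "q \<in> snd c1 \<union> snd c2" for q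
    using transforms_word[OF c(1) c(3) gs fl(1) _ cl[OF that] \<kappa>] transforms_word[OF c(2) c(4) gs fl(2) _ cl[OF that] \<kappa>]
      that same unfolding ok_def by blast
  then obtain G where G: "\<And>q. q \<in> snd c1 \<union> snd c2 \<Longrightarrow> ok q (G q)" by metis
  have sl: "slope (G q - G q') = slope (q - q')" if q: "q \<in> snd c1 \<union> snd c2" and q': "q' \<in> snd c1 \<union> snd c2" for q q'
  proof -
    obtain s s' where T: "transforms R (word_matrix gs) \<kappa> q s (G q)" "transforms R (word_matrix gs) \<kappa> q' s' (G q')"
      using G[OF q] G[OF q'] unfolding ok_def by blast
    have ex: "exp_factor q \<and> slope q \<le> 2 \<and> slope (G q) \<le> 2" if "q \<in> snd c1 \<union> snd c2" for q
      using that c fl G[OF that] is_circle_member(1) unfolding ok_def flat_def by blast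
    show ?thesis
      using transforms_slope[OF det_word_matrix[OF gs] _ cl[OF q] _ _ cl[OF q'] _ T] ex[OF q] ex[OF q'] by blast
  qed
  have "inj_on G (snd c1 \<union> snd c2)"
  proof (rule inj_onI)
    fix q q' assume q: "q \<in> snd c1 \<union> snd c2" "q' \<in> snd c1 \<union> snd c2" and eq: "G q = G q'"
    hence "slope (q - q') = 0" using sl[OF q] by simp
    moreover have "exp_factor (q - q')" using q c is_circle_member(1) by (intro exp_factor_diff) blast+
    ultimately show "q = q'" using slope_eq_0_iff by auto
  qed
  hence "inj_on G (snd c1)" "inj_on G (snd c2)" by (auto intro: inj_on_subset)
  moreover have "G ` snd c1 \<subseteq> snd (word_circle gs c1)" "G ` snd c2 \<subseteq> snd (word_circle gs c2)"
    using G unfolding ok_def by blast+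
  ultimately show ?thesis using that sl by blast
qed

lemma finite_snd_circle: "is_circle c \<Longrightarrow> finite (snd c)"
  using finite_galois_orbit by (auto simp: is_circle_def circle_of_def)

lemma card_word_circle_le:
  assumes "is_circle c" "flat c" "\<forall>g\<in>set gs. valid_elementary g" "flat (word_circle gs c)"
  shows "card (snd c) \<le> card (snd (word_circle gs c))"
proof -
  obtain G where G: "inj_on G (snd c)" "G ` snd c \<subseteq> snd (word_circle gs c)"
    by (rule word_circle_bij[OF assms(1,1,2,2,3,4,4)], rule that)
  show ?thesis by (rule card_inj_on_le[OF G finite_snd_circle[OF is_circle_word[OF assms(1,3)]]])
qed

text \<open>The one-sided bounds, applied to the word and to an inverse word, become
  equalities.\<close>

lemma word_circle_flat_invariants:
  assumes c: "is_circle c" "flat c" and gs: "\<forall>g\<in>set gs. valid_elementary g" and fl: "flat (word_circle gs c)"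
  shows "circle_ram (word_circle gs c) = circle_ram c" "card (snd (word_circle gs c)) = card (snd c)"
proof -
  obtain hs where hs1: "\<forall>g\<in>set hs. valid_elementary g"
    and inv: "\<And>c. is_circle c \<Longrightarrow> word_circle hs (word_circle gs c) = c"
    by (rule exists_inverse_word[OF gs], rule that)
  note hs = hs1 inv[OF c(1)]
  note * = is_circle_word[OF c(1) gs] fl hs(1)
  have "flat (word_circle hs (word_circle gs c))" using c hs(2) by simp
  thus "circle_ram (word_circle gs c) = circle_ram c" "card (snd (word_circle gs c)) = card (snd c)"
    using circle_ram_word_le[OF *] circle_ram_word_le[OF assms] card_word_circle_le[OF *] card_word_circle_le[OF assms]
    unfolding hs(2) by simp_all
qed

lemma word_circle_inj:
  assumes "is_circle c1" "is_circle c2" "\<forall>g\<in>set gs. valid_elementary g"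
  shows "word_circle gs c1 = word_circle gs c2 \<longleftrightarrow> c1 = c2"
proof -
  obtain hs where inv: "\<And>c. is_circle c \<Longrightarrow> word_circle hs (word_circle gs c) = c"
    by (rule exists_inverse_word[OF assms(3)], rule that)
  show ?thesis using inv[OF assms(1)] inv[OF assms(2)] by metis
qed

lemma circle_B_word:
  assumes c: "is_circle c1" "is_circle c2" "flat c1" "flat c2"
    and gs: "\<forall>g\<in>set gs. valid_elementary g" and fl: "flat (word_circle gs c1)" "flat (word_circle gs c2)"
  shows "circle_B (word_circle gs c1) (word_circle gs c2) = circle_B c1 c2"
proof -
  obtain G where G: "inj_on G (snd c1)" "G ` snd c1 \<subseteq> snd (word_circle gs c1)"
    "inj_on G (snd c2)" "G ` snd c2 \<subseteq> snd (word_circle gs c2)"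
    and sl: "\<And>q q'. q \<in> snd c1 \<Longrightarrow> q' \<in> snd c2 \<Longrightarrow> slope (G q - G q') = slope (q - q')"
    by (rule word_circle_bij[OF assms], rule that)
  have eq: "snd (word_circle gs c1) = G ` snd c1" "snd (word_circle gs c2) = G ` snd c2"
    using card_image[OF G(1)] card_image[OF G(3)] word_circle_flat_invariants(2)[OF c(1,3) gs fl(1)]
      word_circle_flat_invariants(2)[OF c(2,4) gs fl(2)]
    by (intro card_subset_eq[symmetric] G finite_snd_circle is_circle_word[OF _ gs] c; simp)+
  have "circle_A (word_circle gs c1) (word_circle gs c2) = circle_A c1 c2"
    unfolding circle_A_def eq sum.reindex[OF G(1)] sum.reindex[OF G(3)] by (simp add: sl)
  thus ?thesis
    using word_circle_flat_invariants(1)[OF c(1,3) gs fl(1)] word_circle_flat_invariants(1)[OF c(2,4) gs fl(2)]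
      word_circle_inj[OF c(1,2) gs] by (simp add: circle_B_def)
qed

section \<open>Monodromy classes\<close>

definition annihilates :: "complex poly \<Rightarrow> complex mat set \<Rightarrow> bool" where
  "annihilates p C \<longleftrightarrow> (\<forall>M\<in>C. \<forall>i<dim_row M. \<forall>j<dim_row M.
     (\<Sum>k\<le>degree p. coeff p k * index_mat (M ^\<^sub>m k) (i, j)) = 0)"

definition invertible_class :: "complex mat set \<Rightarrow> bool" where
  "invertible_class C \<longleftrightarrow> (\<forall>M\<in>C. \<exists>d. M \<in> carrier_mat d d \<and>
     (\<exists>N\<in>carrier_mat d d. M * N = 1\<^sub>m d \<and> N * M = 1\<^sub>m d))"

text \<open>If neither predicate is satisfiable they are the same predicate, so even the unspecified
  values of \<open>Least\<close> agree.\<close>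

lemma Least_eq_if_mutually_bounded:
  fixes P Q :: "nat \<Rightarrow> bool"
  assumes PQ: "\<And>x. P x \<Longrightarrow> \<exists>y\<le>x. Q y" and QP: "\<And>x. Q x \<Longrightarrow> \<exists>y\<le>x. P y"
  shows "Least P = Least Q"
proof (cases "\<exists>x. P x")
  case True
  hence P: "P (Least P)" by (metis LeastI)
  then obtain y where y: "y \<le> Least P" "Q y" using PQ by blast
  hence Q: "Q (Least Q)" by (metis LeastI)
  then obtain x where x: "x \<le> Least Q" "P x" using QP by blast
  show ?thesis using x y Least_le[of P x] Least_le[of Q y] by linarith
next
  case False
  hence "P = Q" using QP by blast
  thus ?thesis by simp
qed

lemma class_minpoly_degree_eqI:
  assumes "\<And>p. p \<noteq> 0 \<Longrightarrow> annihilates p C \<Longrightarrow> \<exists>p'. p' \<noteq> 0 \<and> degree p' \<le> degree p \<and> annihilates p' C'"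
    and "\<And>p. p \<noteq> 0 \<Longrightarrow> annihilates p C' \<Longrightarrow> \<exists>p'. p' \<noteq> 0 \<and> degree p' \<le> degree p \<and> annihilates p' C"
  shows "class_minpoly_degree C = class_minpoly_degree C'"
  unfolding class_minpoly_degree_def annihilates_def[symmetric]
  by (rule Least_eq_if_mutually_bounded; use assms in blast)

lemma smult_mult_smult:
  fixes A B :: "complex mat"
  assumes A: "A \<in> carrier_mat d d" and B: "B \<in> carrier_mat d d"
  shows "(a \<cdot>\<^sub>m A) * (b \<cdot>\<^sub>m B) = (a * b) \<cdot>\<^sub>m (A * B)"
proof -
  have "(a \<cdot>\<^sub>m A) * (b \<cdot>\<^sub>m B) = a \<cdot>\<^sub>m (A * (b \<cdot>\<^sub>m B))"
    by (rule mult_smult_assoc_mat[OF A smult_carrier_mat[OF B]])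
  also have "A * (b \<cdot>\<^sub>m B) = b \<cdot>\<^sub>m (A * B)" by (rule mult_smult_distrib[OF A B])
  also have "a \<cdot>\<^sub>m (b \<cdot>\<^sub>m (A * B)) = (a * b) \<cdot>\<^sub>m (A * B)" by (intro eq_matI) simp_all
  finally show ?thesis .
qed

lemma pow_mat_smult:
  fixes M :: "complex mat"
  assumes M: "M \<in> carrier_mat d d"
  shows "(c \<cdot>\<^sub>m M) ^\<^sub>m k = c ^ k \<cdot>\<^sub>m (M ^\<^sub>m k)"
proof (induction k)
  case (Suc k)
  have Mk: "M ^\<^sub>m k \<in> carrier_mat d d" using M by simp
  show ?case using smult_mult_smult[OF Mk M, of "c ^ k" c] by (simp add: Suc mult.commute)
qed (use M in \<open>intro eq_matI; simp\<close>)

text \<open>The k-th coefficient of \<open>p(\<epsilon> X)\<close> and the k-th power of the scaled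
  matrix each contribute \<open>\<epsilon> ^ k\<close>, and the two cancel.\<close>

lemma annihilates_smult:
  assumes e: "\<epsilon> * \<epsilon> = 1" and C: "invertible_class C" and p: "annihilates p C"
  shows "annihilates (pcompose p [:0, \<epsilon>:]) ((\<lambda>M. \<epsilon> \<cdot>\<^sub>m M) ` C)"
  unfolding annihilates_def
proof (intro ballI allI impI; clarify)
  fix M i j assume M: "M \<in> C" and ij: "i < dim_row (\<epsilon> \<cdot>\<^sub>m M)" "j < dim_row (\<epsilon> \<cdot>\<^sub>m M)"
  obtain d where d: "M \<in> carrier_mat d d" using C M unfolding invertible_class_def by blast
  have e0: "\<epsilon> \<noteq> 0" using e by auto
  have deg: "degree (pcompose p [:0, \<epsilon>:]) = degree p" using e0 by (simp add: degree_pcompose)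
  have sq: "\<epsilon> ^ k * \<epsilon> ^ k = 1" for k using e by (simp flip: power_mult_distrib)
  have "coeff (pcompose p [:0, \<epsilon>:]) k * index_mat ((\<epsilon> \<cdot>\<^sub>m M) ^\<^sub>m k) (i, j) = coeff p k * index_mat (M ^\<^sub>m k) (i, j)" for k
  proof -
    have "i < dim_row (M ^\<^sub>m k)" "j < dim_col (M ^\<^sub>m k)" using ij d by simp_all
    thus ?thesis
      using sq[of k] by (simp add: pow_mat_smult[OF d] coeff_pcompose_linear)
  qed
  thus "(\<Sum>k\<le>degree (pcompose p [:0, \<epsilon>:]). coeff (pcompose p [:0, \<epsilon>:]) k * index_mat ((\<epsilon> \<cdot>\<^sub>m M) ^\<^sub>m k) (i, j)) = 0"
    using p M ij unfolding annihilates_def deg by simp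
qed

lemma invertible_class_smult:
  assumes e: "\<epsilon> * \<epsilon> = 1" and C: "invertible_class C"
  shows "invertible_class ((\<lambda>M. \<epsilon> \<cdot>\<^sub>m M) ` C)"
  unfolding invertible_class_def
proof (intro ballI; clarify)
  fix M assume "M \<in> C"
  then obtain d N where dN: "M \<in> carrier_mat d d" "N \<in> carrier_mat d d" "M * N = 1\<^sub>m d" "N * M = 1\<^sub>m d"
    using C unfolding invertible_class_def by blast
  have "(\<epsilon> \<cdot>\<^sub>m M) * (\<epsilon> \<cdot>\<^sub>m N) = (\<epsilon> * \<epsilon>) \<cdot>\<^sub>m (M * N)" "(\<epsilon> \<cdot>\<^sub>m N) * (\<epsilon> \<cdot>\<^sub>m M) = (\<epsilon> * \<epsilon>) \<cdot>\<^sub>m (N * M)"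
    by (rule smult_mult_smult[OF dN(1,2)], rule smult_mult_smult[OF dN(2,1)])
  hence "(\<epsilon> \<cdot>\<^sub>m M) * (\<epsilon> \<cdot>\<^sub>m N) = 1\<^sub>m d" "(\<epsilon> \<cdot>\<^sub>m N) * (\<epsilon> \<cdot>\<^sub>m M) = 1\<^sub>m d"
    unfolding dN e by (simp_all, (intro eq_matI; simp)+)
  thus "\<exists>d. \<epsilon> \<cdot>\<^sub>m M \<in> carrier_mat d d \<and> (\<exists>N\<in>carrier_mat d d. \<epsilon> \<cdot>\<^sub>m M * N = 1\<^sub>m d \<and> N * (\<epsilon> \<cdot>\<^sub>m M) = 1\<^sub>m d)"
    using dN by (intro exI[of _ d] conjI bexI[of _ "\<epsilon> \<cdot>\<^sub>m N"]) simp_all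
qed

lemma class_minpoly_degree_smult:
  assumes e: "\<epsilon> * \<epsilon> = 1" and C: "invertible_class C"
  shows "class_minpoly_degree ((\<lambda>M. \<epsilon> \<cdot>\<^sub>m M) ` C) = class_minpoly_degree C"
proof -
  let ?D = "(\<lambda>M. \<epsilon> \<cdot>\<^sub>m M) ` C"
  have e0: "\<epsilon> \<noteq> 0" using e by auto
  have p0: "pcompose p [:0, \<epsilon>:] \<noteq> 0 \<and> degree (pcompose p [:0, \<epsilon>:]) \<le> degree p" if "p \<noteq> 0" for p
  proof -
    have "coeff (pcompose p [:0, \<epsilon>:]) (degree p) \<noteq> 0" using that e0 by (simp add: coeff_pcompose_linear)
    thus ?thesis using e0 by (auto simp: degree_pcompose)
  qed
  have "\<epsilon> \<cdot>\<^sub>m (\<epsilon> \<cdot>\<^sub>m M) = M" for M using e by (intro eq_matI) (simp_all flip: mult.assoc)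
  hence DD: "(\<lambda>M. \<epsilon> \<cdot>\<^sub>m M) ` ?D = C" by (simp add: image_image)
  show ?thesis
    using p0 annihilates_smult[OF e invertible_class_smult[OF e C]] annihilates_smult[OF e C]
    unfolding DD by (intro class_minpoly_degree_eqI) blast+
qed

lemma index_mult_mat_sum:
  fixes A B :: "complex mat"
  assumes "A \<in> carrier_mat d d" "B \<in> carrier_mat d d" "i < d" "j < d"
  shows "index_mat (A * B) (i, j) = (\<Sum>l<d. index_mat A (i, l) * index_mat B (l, j))"
  using assms by (simp add: scalar_prod_def atLeast0LessThan)

lemma pow_mat_Suc_left:
  fixes M :: "complex mat"
  assumes M: "M \<in> carrier_mat d d"
  shows "M ^\<^sub>m Suc k = M * M ^\<^sub>m k"
proof (induction k)
  case (Suc k)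
  have "M ^\<^sub>m Suc (Suc k) = (M * M ^\<^sub>m k) * M" using Suc by simp
  also have "\<dots> = M * (M ^\<^sub>m k * M)" using M by (intro assoc_mult_mat[of _ d d _ d _ d]) simp_all
  finally show ?case by simp
qed (use M in simp)

lemma pow_mat_inverse:
  fixes M N :: "complex mat"
  assumes MN: "M \<in> carrier_mat d d" "N \<in> carrier_mat d d" "N * M = 1\<^sub>m d"
  shows "N ^\<^sub>m (m + k) * M ^\<^sub>m k = N ^\<^sub>m m"
proof (induction k)
  case 0
  show ?case using MN by simp
next
  case (Suc k)
  have c: "N ^\<^sub>m (m + k) \<in> carrier_mat d d" "M ^\<^sub>m k \<in> carrier_mat d d" using MN by simp_all
  have "N ^\<^sub>m (m + Suc k) * M ^\<^sub>m Suc k = (N ^\<^sub>m (m + k) * N) * (M * M ^\<^sub>m k)"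
    by (simp add: pow_mat_Suc_left[OF MN(1)] del: pow_mat.simps(2)) simp
  also have "\<dots> = N ^\<^sub>m (m + k) * (N * (M * M ^\<^sub>m k))"
    using MN c by (intro assoc_mult_mat[of _ d d _ d _ d]) simp_all
  also have "N * (M * M ^\<^sub>m k) = (N * M) * M ^\<^sub>m k"
    using MN c by (intro assoc_mult_mat[of _ d d _ d _ d, symmetric]) simp_all
  also have "\<dots> = M ^\<^sub>m k" unfolding MN(3) by (rule left_mult_one_mat[OF c(2)])
  finally show ?case using Suc by simp
qed

text \<open>With n the degree of p, the reversed polynomial at N is \<open>N^n p(M)\<close>. Its
  degree drops when 0 is a root of p, which is why the degree comparison is stated with an
  inequality.\<close>

lemma annihilates_inverse:
  assumes C: "invertible_class C" and p: "annihilates p C"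
  shows "annihilates (reflect_poly p) (inverse_class C)"
  unfolding annihilates_def
proof (intro ballI allI impI)
  fix N i j assume "N \<in> inverse_class C" and ij: "i < dim_row N" "j < dim_row N"
  then obtain M where M: "M \<in> C" "N \<in> carrier_mat (dim_row M) (dim_row M)" "inverts_mat N M"
    unfolding inverse_class_def by blast
  obtain d where "M \<in> carrier_mat d d" using C M(1) unfolding invertible_class_def by blast
  hence d: "M \<in> carrier_mat d d" "N \<in> carrier_mat d d" "N * M = 1\<^sub>m d"
    using M(2,3) by (auto simp: inverts_mat_def)
  have ij: "i < d" "j < d" using ij d by auto
  define n where "n = degree p"
  have "(\<Sum>k\<le>degree (reflect_poly p). coeff (reflect_poly p) k * index_mat (N ^\<^sub>m k) (i, j))
      = (\<Sum>k\<le>n. coeff (reflect_poly p) k * index_mat (N ^\<^sub>m k) (i, j))"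
    using degree_reflect_poly_le[of p] by (intro sum.mono_neutral_left) (auto simp: n_def coeff_eq_0)
  also have "\<dots> = (\<Sum>k\<le>n. coeff p (n - k) * index_mat (N ^\<^sub>m k) (i, j))"
    by (intro sum.cong refl) (auto simp: coeff_reflect_poly n_def)
  also have "\<dots> = (\<Sum>k\<le>n. coeff p k * index_mat (N ^\<^sub>m (n - k)) (i, j))"
    by (rule sum.reindex_bij_witness[of _ "\<lambda>k. n - k" "\<lambda>k. n - k"]) auto
  also have "\<dots> = (\<Sum>k\<le>n. \<Sum>l<d. index_mat (N ^\<^sub>m n) (i, l) * (coeff p k * index_mat (M ^\<^sub>m k) (l, j)))"
  proof (intro sum.cong refl)
    fix k assume "k \<in> {..n}"
    hence "N ^\<^sub>m (n - k) = N ^\<^sub>m n * M ^\<^sub>m k" using pow_mat_inverse[OF d, of "n - k" k] by simp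
    also have "index_mat \<dots> (i, j) = (\<Sum>l<d. index_mat (N ^\<^sub>m n) (i, l) * index_mat (M ^\<^sub>m k) (l, j))"
      using d ij by (intro index_mult_mat_sum) simp_all
    finally show "coeff p k * index_mat (N ^\<^sub>m (n - k)) (i, j)
      = (\<Sum>l<d. index_mat (N ^\<^sub>m n) (i, l) * (coeff p k * index_mat (M ^\<^sub>m k) (l, j)))"
      by (simp add: sum_distrib_left mult_ac)
  qed
  also have "\<dots> = (\<Sum>l<d. index_mat (N ^\<^sub>m n) (i, l) * (\<Sum>k\<le>n. coeff p k * index_mat (M ^\<^sub>m k) (l, j)))"
    by (subst sum.swap) (simp add: sum_distrib_left)
  also have "\<dots> = 0"
  proof (intro sum.neutral ballI)
    fix l assume "l \<in> {..<d}"
    hence "(\<Sum>k\<le>n. coeff p k * index_mat (M ^\<^sub>m k) (l, j)) = 0"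
      using p M(1) ij d(1) unfolding annihilates_def n_def by auto
    thus "index_mat (N ^\<^sub>m n) (i, l) * (\<Sum>k\<le>n. coeff p k * index_mat (M ^\<^sub>m k) (l, j)) = 0" by simp
  qed
  finally show "(\<Sum>k\<le>degree (reflect_poly p). coeff (reflect_poly p) k * index_mat (N ^\<^sub>m k) (i, j)) = 0" .
qed

lemma invertible_class_inverse:
  assumes C: "invertible_class C"
  shows "invertible_class (inverse_class C)"
  unfolding invertible_class_def
proof
  fix N assume "N \<in> inverse_class C"
  then obtain M where M: "M \<in> C" "N \<in> carrier_mat (dim_row M) (dim_row M)" "inverts_mat M N" "inverts_mat N M"
    unfolding inverse_class_def by blast
  obtain d where "M \<in> carrier_mat d d" using C M(1) unfolding invertible_class_def by blast
  hence "M \<in> carrier_mat d d" "N \<in> carrier_mat d d" "M * N = 1\<^sub>m d" "N * M = 1\<^sub>m d"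
    using M by (auto simp: inverts_mat_def)
  thus "\<exists>d. N \<in> carrier_mat d d \<and> (\<exists>M\<in>carrier_mat d d. N * M = 1\<^sub>m d \<and> M * N = 1\<^sub>m d)" by blast
qed

text \<open>One inclusion is enough for annihilation, which passes to smaller sets of
  matrices.\<close>

lemma subset_inverse_class_inverse_class:
  assumes C: "invertible_class C"
  shows "C \<subseteq> inverse_class (inverse_class C)"
proof
  fix M assume M: "M \<in> C"
  then obtain d N where N: "M \<in> carrier_mat d d" "N \<in> carrier_mat d d" "M * N = 1\<^sub>m d" "N * M = 1\<^sub>m d"
    using C unfolding invertible_class_def by blast
  hence i: "dim_row M = d" "dim_row N = d" "inverts_mat M N" "inverts_mat N M"
    by (auto simp: inverts_mat_def)
  have "N \<in> inverse_class C" unfolding inverse_class_def using M N(2) i by blast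
  thus "M \<in> inverse_class (inverse_class C)"
    using N(1) i unfolding inverse_class_def[of "inverse_class C"] mem_Collect_eq
    by (intro bexI[of _ N] conjI) simp_all
qed

lemma class_minpoly_degree_inverse:
  assumes C: "invertible_class C"
  shows "class_minpoly_degree (inverse_class C) = class_minpoly_degree C"
proof (rule class_minpoly_degree_eqI)
  fix p :: "complex poly" assume p: "p \<noteq> 0" "annihilates p (inverse_class C)"
  hence "annihilates (reflect_poly p) (inverse_class (inverse_class C))"
    using annihilates_inverse[OF invertible_class_inverse[OF C]] by blast
  hence "annihilates (reflect_poly p) C"
    using subset_inverse_class_inverse_class[OF C] unfolding annihilates_def by blast
  thus "\<exists>p'. p' \<noteq> 0 \<and> degree p' \<le> degree p \<and> annihilates p' C"
    using p(1) degree_reflect_poly_le[of p] by (intro exI[of _ "reflect_poly p"]) simp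
next
  fix p :: "complex poly" assume p: "p \<noteq> 0" "annihilates p C"
  thus "\<exists>p'. p' \<noteq> 0 \<and> degree p' \<le> degree p \<and> annihilates p' (inverse_class C)"
    using annihilates_inverse[OF C] degree_reflect_poly_le[of p] by (intro exI[of _ "reflect_poly p"]) simp
qed

fun word_class :: "elementary list \<Rightarrow> circle \<Rightarrow> complex mat set \<Rightarrow> complex mat set" where
  "word_class [] c C = C"
| "word_class (g # gs) c C = elementary_class g (word_circle gs c) (word_class gs c C)"

lemma elementary_class_invariants:
  assumes "invertible_class C"
  shows "invertible_class (elementary_class g c C) \<and> class_minpoly_degree (elementary_class g c C) = class_minpoly_degree C"
proof (cases g)
  case Fourier
  have "((-1) ^ k :: complex) * (-1) ^ k = 1" for k by (simp flip: power_mult_distrib)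
  thus ?thesis
    using Fourier assms invertible_class_inverse class_minpoly_degree_inverse
      invertible_class_smult class_minpoly_degree_smult
    by (simp add: fourier_class_def Let_def)
qed (use assms in simp_all)

lemma word_class_invariants:
  assumes "invertible_class C"
  shows "invertible_class (word_class gs c C) \<and> class_minpoly_degree (word_class gs c C) = class_minpoly_degree C"
  using assms elementary_class_invariants by (induction gs) simp_all

lemma foldr_elementary_data:
  "foldr elementary_data gs D = (\<lambda>(c, n, C). (word_circle gs c, n, word_class gs c C)) ` D"
proof (induction gs)
  case (Cons g gs)
  have "foldr elementary_data (g # gs) D = elementary_data g ((\<lambda>(c, n, C). (word_circle gs c, n, word_class gs c C)) ` D)"
    using Cons by simp
  also have "\<dots> = (\<lambda>(c, n, C). (word_circle (g # gs) c, n, word_class (g # gs) c C)) ` D"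
    unfolding elementary_data_def image_image by (intro image_cong refl) (auto simp: word_circle_def)
  finally show ?case .
qed (simp add: word_circle_def)

subsection \<open>Formal monodromy is invertible\<close>

text \<open>A bound on the powers of log x turns the sum in \<open>formal_monodromy\<close> into a
  finite one over a fixed range, which gives linearity.\<close>

definition log_bounded :: "nat \<Rightarrow> ('n::finite) formal_section \<Rightarrow> bool" where
  "log_bounded K c \<longleftrightarrow> (\<forall>\<mu> k. K < k \<longrightarrow> c \<mu> k = 0)"

lemma log_bounded_mono: "log_bounded K c \<Longrightarrow> K \<le> L \<Longrightarrow> log_bounded L c"
  by (simp add: log_bounded_def)

lemma admissible_log_bounded: "admissible c \<Longrightarrow> \<exists>K. log_bounded K c"
  unfolding admissible_def log_bounded_def by (meson not_less)

lemma formal_monodromy_eq: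
  fixes c :: "('n::finite) formal_section"
  assumes "log_bounded K c"
  shows "formal_monodromy r c \<mu> k = exp (2 * of_real pi * \<i> * of_nat r * \<mu>) *s
     (\<Sum>l\<le>K. (of_nat ((k + l) choose k) * (2 * of_real pi * \<i> * of_nat r) ^ l) *s c \<mu> (k + l))"
proof -
  have "Sum_any (\<lambda>l. (of_nat ((k + l) choose k) * (2 * of_real pi * \<i> * of_nat r) ^ l) *s c \<mu> (k + l))
    = (\<Sum>l\<le>K. (of_nat ((k + l) choose k) * (2 * of_real pi * \<i> * of_nat r) ^ l) *s c \<mu> (k + l))"
  proof (rule Sum_any.expand_superset)
    have "c \<mu> (k + l) = 0" if "K < l" for l using assms that by (simp add: log_bounded_def)
    hence "(of_nat ((k + l) choose k) * (2 * of_real pi * \<i> * of_nat r) ^ l) *s c \<mu> (k + l) = 0" if "\<not> l \<le> K" for l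
      using that by simp
    thus "{l. (of_nat ((k + l) choose k) * (2 * of_real pi * \<i> * of_nat r) ^ l) *s c \<mu> (k + l) \<noteq> 0} \<subseteq> {..K}"
      by blast
  qed simp
  thus ?thesis by (simp add: formal_monodromy_def)
qed

lemma log_bounded_formal_monodromy:
  assumes "log_bounded K c"
  shows "log_bounded K (formal_monodromy r c)"
  unfolding log_bounded_def formal_monodromy_eq[OF assms]
  using assms by (auto simp: log_bounded_def)

text \<open>At each exponent the highest power of log x is merely scaled by a nonzero exponential,
  so it cannot be killed.\<close>

lemma formal_monodromy_eq_0:
  fixes c :: "('n::finite) formal_section"
  assumes c: "log_bounded K c" and T: "formal_monodromy r c = 0"
  shows "c = 0"
proof (rule ccontr)
  assume "c \<noteq> 0"
  then obtain \<mu> k0 where k0: "c \<mu> k0 \<noteq> 0" by (auto simp: fun_eq_iff)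
  have "finite {k. c \<mu> k \<noteq> 0}"
    by (rule finite_subset[of _ "{..K}"]) (use c not_less in \<open>unfold log_bounded_def, blast+\<close>)
  define k where "k = Max {k. c \<mu> k \<noteq> 0}"
  have k: "c \<mu> k \<noteq> 0" "\<And>j. k < j \<Longrightarrow> c \<mu> j = 0"
    using Max_in[of "{k. c \<mu> k \<noteq> 0}"] Max_ge[of "{k. c \<mu> k \<noteq> 0}"] \<open>finite _\<close> k0 unfolding k_def
    by (blast, metis (mono_tags) mem_Collect_eq not_le)
  have "(\<Sum>l\<le>K. (of_nat ((k + l) choose k) * (2 * of_real pi * \<i> * of_nat r) ^ l) *s c \<mu> (k + l))
     = (\<Sum>l\<in>{0}. (of_nat ((k + l) choose k) * (2 * of_real pi * \<i> * of_nat r) ^ l) *s c \<mu> (k + l))"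
    by (rule sum.mono_neutral_right) (auto simp: k(2))
  hence "formal_monodromy r c \<mu> k = exp (2 * of_real pi * \<i> * of_nat r * \<mu>) *s c \<mu> k"
    by (simp add: formal_monodromy_eq[OF c])
  thus False using k(1) by (simp add: T vector_mul_eq_0)
qed

lemma sum_apply2: "(\<Sum>j\<in>J. f j) x y = (\<Sum>j\<in>J. f j x y)"
  by (induction J rule: infinite_finite_induct) auto

lemma formal_monodromy_sum:
  fixes b :: "'j \<Rightarrow> ('n::finite) formal_section"
  assumes "finite J" "\<And>j. j \<in> J \<Longrightarrow> log_bounded K (b j)"
  shows "log_bounded K (\<Sum>j\<in>J. fs_scale (v j) (b j))"
    and "formal_monodromy r (\<Sum>j\<in>J. fs_scale (v j) (b j)) = (\<Sum>j\<in>J. fs_scale (v j) (formal_monodromy r (b j)))"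
proof -
  show K: "log_bounded K (\<Sum>j\<in>J. fs_scale (v j) (b j))"
    using assms by (auto simp: log_bounded_def sum_apply2 fs_scale_def)
  show "formal_monodromy r (\<Sum>j\<in>J. fs_scale (v j) (b j)) = (\<Sum>j\<in>J. fs_scale (v j) (formal_monodromy r (b j)))"
  proof (intro ext)
    fix \<mu> k
    define x where "x l = of_nat ((k + l) choose k) * (2 * of_real pi * \<i> * of_nat r) ^ l" for l
    define E where "E = exp (2 * of_real pi * \<i> * of_nat r * \<mu>)"
    have "formal_monodromy r (\<Sum>j\<in>J. fs_scale (v j) (b j)) \<mu> k = E *s (\<Sum>l\<le>K. x l *s (\<Sum>j\<in>J. v j *s b j \<mu> (k + l)))"
      unfolding formal_monodromy_eq[OF K] x_def E_def by (simp only: sum_apply2 fs_scale_def)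
    also have "\<dots> = (\<Sum>j\<in>J. \<Sum>l\<le>K. (E * x l * v j) *s b j \<mu> (k + l))"
      by (simp add: vec.scale_sum_right vector_smult_assoc mult.assoc) (rule sum.swap)
    also have "\<dots> = (\<Sum>j\<in>J. v j *s (E *s (\<Sum>l\<le>K. x l *s b j \<mu> (k + l))))"
      by (simp add: vec.scale_sum_right vector_smult_assoc mult_ac)
    also have "\<dots> = (\<Sum>j\<in>J. v j *s formal_monodromy r (b j) \<mu> k)"
      using formal_monodromy_eq[OF assms(2)] unfolding x_def E_def by (intro sum.cong refl) simp
    finally show "formal_monodromy r (\<Sum>j\<in>J. fs_scale (v j) (b j)) \<mu> k = (\<Sum>j\<in>J. fs_scale (v j) (formal_monodromy r (b j))) \<mu> k"
      by (simp add: sum_apply2 fs_scale_def)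
  qed
qed

lemma modified_space_log_bounded:
  assumes "c \<in> modified_space B p q"
  shows "\<exists>K. log_bounded K c"
proof -
  have hs: "\<exists>K. log_bounded K c" if "c \<in> horizontal_sections B p q" for c
    using that admissible_log_bounded unfolding horizontal_sections_def by blast
  show ?thesis
  proof (cases "p \<noteq> Infty \<and> q = 0")
    case True
    then obtain c' where c': "c' \<in> horizontal_sections B p q" "c = formal_monodromy 1 c' - c'"
      using assms unfolding modified_space_def by auto
    from hs[OF c'(1)] obtain K where "log_bounded K c'" by blast
    with log_bounded_formal_monodromy[OF this, of 1] show ?thesis
      unfolding c'(2) log_bounded_def by (intro exI[of _ K]) auto
  next
    case False
    thus ?thesis using assms hs unfolding modified_space_def by auto
  qed
qed

text \<open>A kernel vector of M is the coordinate vector of a section killed by the monodromy. That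
  section is 0, and the basis is independent, so M has trivial kernel.\<close>

lemma invertible_class_modified: "invertible_class (modified_class B c)"
  unfolding invertible_class_def
proof
  fix M assume "M \<in> modified_class B c"
  define V where "V = modified_space B (fst c) (a_representative c)"
  define T :: "'a formal_section \<Rightarrow> 'a formal_section" where "T = formal_monodromy (ram (a_representative c))"
  define d where "d = fs.dim V"
  have "represents_on M T V"
    using \<open>M \<in> _\<close> by (simp add: modified_class_def Let_def T_def V_def)
  then obtain b :: "nat \<Rightarrow> 'a formal_section" where M: "M \<in> carrier_mat d d" and b: "inj_on b {..<d}"
    "fs.independent (b ` {..<d})" "fs.span (b ` {..<d}) = V"
    "\<And>j. j < d \<Longrightarrow> T (b j) = (\<Sum>i<d. fs_scale (index_mat M (i, j)) (b i))"
    unfolding represents_on_def Let_def d_def by blast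
  have "\<exists>K. log_bounded K (b j)" if "j < d" for j
  proof -
    have "b j \<in> fs.span (b ` {..<d})" using that by (intro fs.span_base) simp
    thus ?thesis unfolding b(3) V_def by (rule modified_space_log_bounded)
  qed
  then obtain K where K: "\<And>j. j < d \<Longrightarrow> log_bounded (K j) (b j)" by metis
  define L where "L = Max (insert 0 (K ` {..<d}))"
  have L: "log_bounded L (b j)" if "j \<in> {..<d}" for j
    using that by (intro log_bounded_mono[OF K]) (auto simp: L_def)
  have inj: "v = 0\<^sub>v d" if v: "v \<in> carrier_vec d" "M *\<^sub>v v = 0\<^sub>v d" for v
  proof -
    define w where "w = (\<Sum>j<d. fs_scale (vec_index v j) (b j))"
    note lin = formal_monodromy_sum[where b = b and J = "{..<d}" and K = L and v = "vec_index v", OF finite_lessThan L]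
    have "T w = (\<Sum>j<d. fs_scale (vec_index v j) (T (b j)))" unfolding w_def T_def by (rule lin(2))
    also have "\<dots> = (\<Sum>j<d. fs_scale (vec_index v j) (\<Sum>i<d. fs_scale (index_mat M (i, j)) (b i)))"
      by (intro sum.cong refl) (simp add: b(4))
    also have "\<dots> = (\<Sum>i<d. fs_scale (\<Sum>j<d. index_mat M (i, j) * vec_index v j) (b i))"
      by (simp add: fs.scale_sum_right fs.scale_sum_left mult.commute) (rule sum.swap)
    also have "\<dots> = 0"
    proof (intro sum.neutral ballI)
      fix i assume i: "i \<in> {..<d}"
      hence "vec_index (M *\<^sub>v v) i = (\<Sum>j<d. index_mat M (i, j) * vec_index v j)"
        using M v(1) by (simp add: scalar_prod_def atLeast0LessThan)
      thus "fs_scale (\<Sum>j<d. index_mat M (i, j) * vec_index v j) (b i) = 0"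
        using v(2) i by simp
    qed
    finally have "w = 0"
      using formal_monodromy_eq_0[OF lin(1)] unfolding w_def T_def by blast
    hence "(\<Sum>x\<in>b ` {..<d}. fs_scale (vec_index v (inv_into {..<d} b x)) x) = 0"
      unfolding sum.reindex[OF b(1)] w_def by (simp add: b(1))
    hence z: "vec_index v (inv_into {..<d} b x) = 0" if "x \<in> b ` {..<d}" for x
      using fs.independentD[OF b(2), of "b ` {..<d}"] that by simp
    show "v = 0\<^sub>v d"
    proof (rule eq_vecI)
      fix i assume "i < dim_vec (0\<^sub>v d :: complex Matrix.vec)"
      thus "vec_index v i = vec_index (0\<^sub>v d) i" using z[of "b i"] inv_into_f_f[OF b(1), of i] by simp
    qed (use v(1) in simp)
  qed
  have "Determinant.det M \<noteq> 0"
    using det_0_iff_vec_prod_zero[OF M] inj by blast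
  from det_non_zero_imp_unit[OF M this, of "()"] obtain N where "N \<in> carrier_mat d d" "N * M = 1\<^sub>m d" "M * N = 1\<^sub>m d"
    unfolding Units_def ring_mat_def by auto
  thus "\<exists>d. M \<in> carrier_mat d d \<and> (\<exists>N\<in>carrier_mat d d. M * N = 1\<^sub>m d \<and> N * M = 1\<^sub>m d)"
    using M by blast
qed

section \<open>Finiteness of the set of exponential factors\<close>

text \<open>
  Horizontal sections \<open>exp(q) x^\<mu> w(x^(1/r))\<close> with pairwise distinct \<open>q\<close> are independent over
  the field of Laurent series in \<open>t = x^(1/r)\<close>: the coefficients \<open>b\<close> of a shortest relation would have
  the logarithmic derivative of \<open>exp(q - q')\<close> up to a constant, which has a pole of higher order
  than the logarithmic derivative of a Laurent series. The following system is the equation of \<open>w\<close>.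
\<close>

definition reduced_section ::
  "complex fls^'n^'n \<Rightarrow> nat \<Rightarrow> expfactor \<Rightarrow> complex \<Rightarrow> complex fls^'n \<Rightarrow> bool" where
  "reduced_section N r q \<nu> w \<longleftrightarrow> (\<forall>i. fls_X * fls_deriv (w $ i)
     + (fls_const \<nu> + fls_X * fls_deriv (expand_factor r fls_X q)) * w $ i = (\<Sum>j\<in>UNIV. N $ i $ j * w $ j))"

lemma reduced_sections_independent:
  fixes N :: "complex fls^('n::finite)^'n" and w :: "expfactor \<Rightarrow> complex fls^'n"
  assumes "finite I"
    and "\<And>q. q \<in> I \<Longrightarrow> exp_factor q \<and> clears_denominators r q \<and> w q \<noteq> 0 \<and> reduced_section N r q (\<nu> q) (w q)"
    and "(\<Sum>q\<in>I. a q *s w q) = 0" and "q \<in> I"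
  shows "a q = 0"
  using assms
proof (induction I arbitrary: a q rule: finite_induct)
  case (insert q0 I)
  have IH: "a q = 0" if "(\<Sum>q\<in>I. a q *s w q) = 0" "q \<in> I" for a q
    using insert.IH[OF insert.prems(1) that] by blast
  have a0: "a q0 = 0"
  proof (rule ccontr)
    assume nz: "a q0 \<noteq> 0"
    define b where "b q = - a q / a q0" for q
    define f where "f q = fls_const (\<nu> q) + fls_X * fls_deriv (expand_factor r fls_X q)" for q
    have rs: "fls_X * fls_deriv (w q $ i) + f q * w q $ i = (\<Sum>j\<in>UNIV. N $ i $ j * w q $ j)"
      if "q \<in> insert q0 I" for q i
      using insert.prems(1)[OF that] unfolding reduced_section_def f_def by blast
    have w0: "w q0 $ i = (\<Sum>q\<in>I. b q * w q $ i)" for i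
    proof -
      have "(\<Sum>q\<in>insert q0 I. a q *s w q) $ i = 0" using insert.prems(2) by simp
      hence "a q0 * w q0 $ i + (\<Sum>q\<in>I. a q * w q $ i) = 0"
        using insert.hyps by simp
      hence "w q0 $ i = - (\<Sum>q\<in>I. a q * w q $ i) / a q0"
        using nz by (simp add: field_simps eq_neg_iff_add_eq_0)
      thus ?thesis by (simp add: b_def sum_divide_distrib sum_negf)
    qed
    \<comment> \<open>Substituting the expression of \<open>w q0\<close> into its own equation and
      using the equations of the other sections leaves a relation over I alone, to which the
      induction hypothesis applies.\<close>
    have "(\<Sum>q\<in>I. (fls_X * fls_deriv (b q) + (f q0 - f q) * b q) *s w q) = 0"
    proof (subst Finite_Cartesian_Product.vec_eq_iff, intro allI)
      fix i
      have "(\<Sum>j\<in>UNIV. N $ i $ j * w q0 $ j) = (\<Sum>q\<in>I. b q * (\<Sum>j\<in>UNIV. N $ i $ j * w q $ j))"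
        unfolding w0 sum_distrib_left by (subst sum.swap) (simp add: mult_ac)
      also have "\<dots> = (\<Sum>q\<in>I. b q * (fls_X * fls_deriv (w q $ i) + f q * w q $ i))"
        by (intro sum.cong refl) (simp add: rs)
      finally have "fls_X * fls_deriv (w q0 $ i) + f q0 * w q0 $ i
          = (\<Sum>q\<in>I. b q * (fls_X * fls_deriv (w q $ i) + f q * w q $ i))"
        using rs[of q0 i] by simp
      moreover have "fls_X * fls_deriv (w q0 $ i) + f q0 * w q0 $ i
          = (\<Sum>q\<in>I. fls_X * (b q * fls_deriv (w q $ i) + fls_deriv (b q) * w q $ i) + f q0 * (b q * w q $ i))"
        unfolding w0 by (simp add: fls_deriv_sum sum_distrib_left sum.distrib distrib_left)
      ultimately have "(\<Sum>q\<in>I. fls_X * (b q * fls_deriv (w q $ i) + fls_deriv (b q) * w q $ i) + f q0 * (b q * w q $ i)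
          - b q * (fls_X * fls_deriv (w q $ i) + f q * w q $ i)) = 0"
        by (simp add: sum_subtractf)
      also have "(\<Sum>q\<in>I. fls_X * (b q * fls_deriv (w q $ i) + fls_deriv (b q) * w q $ i) + f q0 * (b q * w q $ i)
          - b q * (fls_X * fls_deriv (w q $ i) + f q * w q $ i))
          = (\<Sum>q\<in>I. (fls_X * fls_deriv (b q) + (f q0 - f q) * b q) * w q $ i)"
        by (intro sum.cong refl) (simp add: algebra_simps)
      finally show "(\<Sum>q\<in>I. (fls_X * fls_deriv (b q) + (f q0 - f q) * b q) *s w q) $ i = 0 $ i"
        by (simp only: sum_component vector_smult_component zero_index)
    qed
    note bq = IH[OF this]
    have "b q = 0" if q: "q \<in> I" for q
    proof (rule ccontr)
      assume b0: "b q \<noteq> 0"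
      define g where "g = fls_deriv (expand_factor r fls_X q) - fls_deriv (expand_factor r fls_X q0)"
      have "(f q - f q0) * b q = fls_X * fls_deriv (b q)" using bq[OF q] by (simp add: algebra_simps)
      \<comment> \<open>The order of \<open>t b'\<close> is no lower than that of b, so the quotient
        \<open>f q - f q0\<close> has no pole, whereas distinct factors would produce one.\<close>
      moreover have "order_ge (fls_X * fls_deriv (b q)) (1 + (fls_subdegree (b q) - 1))"
        by (intro order_ge_mult order_ge_deriv order_ge_X) (simp add: order_ge_iff)
      ultimately have "order_ge ((f q - f q0) * b q) (fls_subdegree (b q))" by simp
      from order_ge_mult_cancel[OF this b0] have "order_ge (f q - f q0) 0" by simp
      hence "order_ge (f q - f q0 - fls_const (\<nu> q - \<nu> q0)) 0" by (rule order_ge_diff[OF _ order_ge_const])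
      moreover have "f q - f q0 - fls_const (\<nu> q - \<nu> q0) = g * fls_X"
        by (simp add: f_def g_def algebra_simps flip: fls_minus_const)
      ultimately have "order_ge (g * fls_X) 0" by simp
      from order_ge_mult_cancel[OF this] have "order_ge g (-1)" by simp
      hence "q = q0"
        unfolding g_def using insert.prems(1)[of q] insert.prems(1)[of q0] q
        by (intro expand_factor_eqI[of r _ _ fls_X]) auto
      thus False using q insert.hyps by blast
    qed
    hence "w q0 = 0" using w0 by (simp add: Finite_Cartesian_Product.vec_eq_iff)
    thus False using insert.prems(1)[of q0] by simp
  qed
  show ?case
  proof (cases "q = q0")
    case False
    have "(\<Sum>q\<in>I. a q *s w q) = 0" using insert.prems(2) insert.hyps a0 by simp
    thus ?thesis using IH False insert.prems(3) by blast
  qed (use a0 in simp)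
qed simp

lemma card_reduced_sections_le:
  fixes N :: "complex fls^('n::finite)^'n" and w :: "expfactor \<Rightarrow> complex fls^'n"
  assumes "finite I"
    and "\<And>q. q \<in> I \<Longrightarrow> exp_factor q \<and> clears_denominators r q \<and> w q \<noteq> 0 \<and> reduced_section N r q (\<nu> q) (w q)"
  shows "card I \<le> CARD('n)"
proof -
  have indep: "a q = 0" if "(\<Sum>q\<in>I. a q *s w q) = 0" "q \<in> I" for a q
    by (rule reduced_sections_independent[where I = I, OF assms(1) _ that]) (rule assms(2))
  have inj: "inj_on w I"
  proof (rule inj_onI, rule ccontr)
    fix q q' assume q: "q \<in> I" "q' \<in> I" "w q = w q'" "q \<noteq> q'"
    define a :: "expfactor \<Rightarrow> complex fls" where "a x = (if x = q then 1 else if x = q' then -1 else 0)" for x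
    have "(\<Sum>x\<in>I. a x *s w x) = (\<Sum>x\<in>{q, q'}. a x *s w x)"
      using q assms(1) by (intro sum.mono_neutral_right) (auto simp: a_def)
    also have "\<dots> = 0" using q by (simp add: a_def)
    finally have "a q = 0" using indep q(1) by blast
    thus False by (simp add: a_def)
  qed
  have "vec.independent (w ` I)"
  proof
    assume "vec.dependent (w ` I)"
    then obtain u v where u: "v \<in> w ` I" "u v \<noteq> 0" "(\<Sum>v\<in>w ` I. u v *s v) = 0"
      using vec.dependent_finite[of "w ` I"] assms(1) by auto
    hence "(\<Sum>q\<in>I. u (w q) *s w q) = 0" by (simp add: sum.reindex[OF inj])
    hence "u (w q) = 0" if "q \<in> I" for q using indep[of "\<lambda>q. u (w q)"] that by blast
    thus False using u by auto
  qed
  hence "card (w ` I) \<le> vec.dim (UNIV :: (complex fls^'n) set)"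
    by (intro vec.independent_card_le_dim) simp_all
  thus ?thesis using card_image[OF inj] by (simp add: card_cart_basis)
qed

section \<open>From horizontal sections to Laurent series solutions\<close>

lemma fls_times_nth_Sum_any:
  fixes f g :: "complex fls"
  shows "fls_nth (f * g) n = Sum_any (\<lambda>k. fls_nth f k * fls_nth g (n - k))"
proof -
  have "fls_nth (f * g) n = (\<Sum>i = fls_subdegree f + fls_subdegree g..n.
      fls_nth f (i - fls_subdegree g) * fls_nth g (fls_subdegree g + n - i))"
    by (rule fls_times_nth(1))
  also have "\<dots> = (\<Sum>k = fls_subdegree f..n - fls_subdegree g. fls_nth f k * fls_nth g (n - k))"
    by (rule sum.reindex_bij_witness[of _ "\<lambda>k. k + fls_subdegree g" "\<lambda>i. i - fls_subdegree g"])
      (auto simp: algebra_simps)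
  also have "\<dots> = Sum_any (\<lambda>k. fls_nth f k * fls_nth g (n - k))"
  proof (rule Sum_any.expand_superset[symmetric])
    show "{k. fls_nth f k * fls_nth g (n - k) \<noteq> 0} \<subseteq> {fls_subdegree f..n - fls_subdegree g}"
      using fls_subdegree_leI[of f] fls_subdegree_leI[of g] by force
  qed simp
  finally show ?thesis .
qed

lemma fls_compose_power_times_nth:
  fixes f g :: "complex fls"
  assumes r: "0 < r"
  shows "fls_nth (fls_compose_power f r * g) n = Sum_any (\<lambda>m. fls_nth f m * fls_nth g (n - int r * m))"
proof -
  define h where "h k = fls_nth (fls_compose_power f r) k * fls_nth g (n - k)" for k
  have hm: "h (int r * m) = fls_nth f m * fls_nth g (n - int r * m)" for m
    using r by (simp add: h_def fls_nth_compose_power)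
  have inj: "inj_on (\<lambda>m. int r * m) X" for X using r by (auto simp: inj_on_def)
  have "{k. h k \<noteq> 0} = (\<lambda>m. int r * m) ` {m. h (int r * m) \<noteq> 0}"
    using r by (auto simp: h_def fls_nth_compose_power split: if_splits)
  hence "Sum_any h = Sum_any (\<lambda>m. h (int r * m))"
    unfolding Sum_any.expand_set by (simp add: sum.reindex[OF inj])
  thus ?thesis unfolding fls_times_nth_Sum_any hm h_def[symmetric] by simp
qed

text \<open>For \<open>x = t ^ r\<close> one has \<open>t d/dt = r x d/dx\<close>, which turns dy/dx
  = M y into \<open>t dy/dt = r t^r M(t^r) y\<close>.\<close>

definition reduced_matrix :: "(complex fls)^'n^'n \<Rightarrow> nat \<Rightarrow> (complex fls)^('n::finite)^'n" where
  "reduced_matrix M r = (\<chi> i j. of_nat r * (fls_X ^ r * fls_compose_power (M $ i $ j) r))"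

lemma exists_reduced_section:
  fixes B :: "complex \<Rightarrow> complex^('n::finite)^'n"
  assumes c: "c \<in> horizontal_sections B p q" "c \<noteq> 0"
  obtains r\<^sub>0 where "0 < r\<^sub>0"
    "\<And>r. 0 < r \<Longrightarrow> r\<^sub>0 dvd r \<Longrightarrow> clears_denominators r q \<and>
       (\<exists>\<nu> w. w \<noteq> 0 \<and> reduced_section (reduced_matrix (local_matrix B p) r) r q \<nu> w)"
proof -
  have adm: "admissible c" and hor: "horizontal B p q c" using c by (auto simp: horizontal_sections_def)
  obtain \<Lambda> r1 Kb where \<Lambda>: "finite \<Lambda>" "(1::nat) \<le> r1"
    "\<And>\<mu> k. c \<mu> k \<noteq> 0 \<Longrightarrow> k \<le> Kb \<and> (\<exists>\<nu>\<in>\<Lambda>. \<exists>j::nat. \<mu> = \<nu> + of_nat j / of_nat r1)"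
    using adm unfolding admissible_def by metis
  define Ks where "Ks = {k. \<exists>\<mu>. c \<mu> k \<noteq> 0}"
  have "Ks \<subseteq> {..Kb}" using \<Lambda>(3) by (auto simp: Ks_def)
  hence fK: "finite Ks" using finite_subset by blast
  have nK: "Ks \<noteq> {}" using c(2) by (auto simp: Ks_def fun_eq_iff)
  define K where "K = Max Ks"
  have "K \<in> Ks" unfolding K_def using fK nK by (rule Max_in)
  then obtain \<mu>0 where \<mu>0: "c \<mu>0 K \<noteq> 0" by (auto simp: Ks_def)
  have K1: "c \<mu> (Suc K) = 0" for \<mu>
    using Max_ge[OF fK, of "Suc K"] by (force simp: K_def Ks_def)
  define lo where "lo = Min (Re ` \<Lambda>)"
  have lo: "lo \<le> Re \<mu>" if "c \<mu> K \<noteq> 0" for \<mu>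
  proof -
    note * = \<Lambda>(3)[OF that]
    obtain \<nu> j where \<nu>: "\<nu> \<in> \<Lambda>" "\<mu> = \<nu> + of_nat j / of_nat r1" using * by blast
    have "lo \<le> Re \<nu>" unfolding lo_def using \<Lambda>(1) \<nu>(1) by simp
    also have "Re \<nu> \<le> Re \<mu>" unfolding \<nu>(2) by simp
    finally show ?thesis .
  qed
  have main: "\<exists>\<nu> w. w \<noteq> 0 \<and> reduced_section (reduced_matrix (local_matrix B p) r) r q \<nu> w"
    if r: "0 < r" "clears_denominators r q" for r
  proof -
    define s where "s J = c (\<mu>0 + of_int J / of_nat r) K" for J :: int
    define J0 where "J0 = \<lfloor>real r * (lo - Re \<mu>0)\<rfloor>"
    have J0: "s J = 0" if "J < J0" for J
    proof (rule ccontr)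
      assume "s J \<noteq> 0"
      hence "lo \<le> Re (\<mu>0 + of_int J / of_nat r)" unfolding s_def by (rule lo)
      hence "lo \<le> Re \<mu>0 + of_int J / real r" by simp
      hence "real r * (lo - Re \<mu>0) \<le> of_int J" using r by (simp add: field_simps)
      thus False using that unfolding J0_def by linarith
    qed
    define w :: "complex fls^'n" where "w = (\<chi> i. Abs_fls (\<lambda>J. s J $ i))"
    have w: "fls_nth (w $ i) J = s J $ i" for i J
      unfolding w_def using J0 by (simp add: nth_Abs_fls_lower_bound[of J0])
    have wn: "fls_nth (w $ i) 0 = c \<mu>0 K $ i" for i by (simp add: w s_def)
    have w0: "w \<noteq> 0"
    proof
      assume "w = 0"
      hence "c \<mu>0 K $ i = 0" for i using wn[of i] by simp
      thus False using \<mu>0 by (simp add: Finite_Cartesian_Product.vec_eq_iff)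
    qed
    have "reduced_section (reduced_matrix (local_matrix B p) r) r q (of_nat r * \<mu>0) w"
      unfolding reduced_section_def
    proof (intro allI fls_eqI)
      fix i J
      \<comment> \<open>\<open>horizontal\<close> compares coefficients of dy/dx while J indexes
        those of y, hence the shift by one.\<close>
      define \<mu> where "\<mu> = \<mu>0 + of_int J / of_nat r - 1"
      have s1: "c (\<mu> + 1) K = s J" by (simp add: \<mu>_def s_def)
      have s2: "c (\<mu> - of_int m) K = s (J - int r - int r * m)" for m
        unfolding \<mu>_def s_def using r by (intro arg_cong2[of _ _ _ _ c] refl) (simp add: field_simps)
      have s3: "c (\<mu> + of_rat e + 1) K = s (J + \<lfloor>e * of_nat r\<rfloor>)" if "e \<in> exponents q" for e
      proof -
        have "(of_int \<lfloor>e * of_nat r\<rfloor> :: complex) = of_rat (e * of_nat r)"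
          by (metis clears_denominators_floor[OF r(2) that] of_rat_of_int_eq)
        thus ?thesis unfolding \<mu>_def s_def using r by (intro arg_cong2[of _ _ _ _ c] refl) (simp add: field_simps of_rat_mult)
      qed
      define M where "M = local_matrix B p"
      define a where "a = Min (range (\<lambda>(k, l). fls_subdegree (M $ k $ l)))"
      define F where "F = {a..max 0 (J - int r - J0)}"
      have fF: "finite F" by (simp add: F_def)
      \<comment> \<open>Below F the matrix coefficient vanishes; above F the index of s falls under
        J0, because \<open>m \<le> r * m\<close> for positive m.\<close>
      have out: "fls_nth (M $ k $ l) m = 0 \<or> s (J - int r - int r * m) = 0" if "m \<notin> F" for m k l
      proof (cases "m < a")
        case True
        have "a \<le> fls_subdegree (M $ k $ l)"
          unfolding a_def by (intro Min_le) (auto intro: range_eqI[of _ _ "(k, l)"])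
        with True show ?thesis by simp
      next
        case False
        hence m: "0 < m" "J - int r - J0 < m" using that by (auto simp: F_def)
        have "m \<le> int r * m" using m(1) r(1) by (simp add: mult_le_cancel_right1)
        hence "J - int r - int r * m < J0" using m(2) by linarith
        thus ?thesis using J0 by blast
      qed
      define v where "v m = local_coeff B p m *v s (J - int r - int r * m)" for m
      have v: "v m $ i = (\<Sum>j\<in>UNIV. fls_nth (M $ i $ j) m * s (J - int r - int r * m) $ j)" for m i
        by (simp add: v_def local_coeff_def M_def matrix_vector_mult_def)
      have out': "fls_nth (M $ i $ j) m * s (J - int r - int r * m) $ j = 0" if "m \<notin> F" for m i j
        using out[OF that, of i j] by auto
      have v0: "v m = 0" if "m \<notin> F" for m
        unfolding Finite_Cartesian_Product.vec_eq_iff v by (simp only: out'[OF that] sum.neutral_const zero_index) simp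
      have "{m. v m \<noteq> 0} \<subseteq> F" using v0 by blast
      hence "Sum_any v $ i = (\<Sum>m\<in>F. v m) $ i"
        by (simp only: Sum_any.expand_superset[OF fF])
      also have "\<dots> = (\<Sum>j\<in>UNIV. \<Sum>m\<in>F. fls_nth (M $ i $ j) m * s (J - int r - int r * m) $ j)"
        by (simp add: v) (rule sum.swap)
      also have "\<dots> = (\<Sum>j\<in>UNIV. fls_nth (fls_compose_power (M $ i $ j) r * w $ j) (J - int r))"
      proof (intro sum.cong refl)
        fix j
        show "(\<Sum>m\<in>F. fls_nth (M $ i $ j) m * s (J - int r - int r * m) $ j)
          = fls_nth (fls_compose_power (M $ i $ j) r * w $ j) (J - int r)"
          unfolding fls_compose_power_times_nth[OF r(1)] w
          using out' by (intro Sum_any.expand_superset[OF fF, symmetric]) blast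
      qed
      finally have V: "Sum_any v $ i = (\<Sum>j\<in>UNIV. fls_nth (fls_compose_power (M $ i $ j) r * w $ j) (J - int r))" .
      have rhs: "fls_nth (\<Sum>j\<in>UNIV. reduced_matrix M r $ i $ j * w $ j) J = of_nat r * Sum_any v $ i"
      proof -
        have "fls_nth (of_nat r * (fls_X ^ r * f) * g) J = of_nat r * fls_nth (f * g) (J - int r)" for f g :: "complex fls"
        proof -
          have "of_nat r * (fls_X ^ r * f) * g = fls_const (of_nat r) * (fls_X ^ r * (f * g))"
            by (simp only: fls_of_nat mult.assoc)
          thus ?thesis by (simp add: fls_X_power_times_conv_shift(1))
        qed
        thus ?thesis unfolding V fls_nth_sum reduced_matrix_def by (simp add: sum_distrib_left)
      qed
      have hor': "(\<mu> + 1) *s c (\<mu> + 1) K + of_nat (K + 1) *s c (\<mu> + 1) (K + 1)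
         - (\<Sum>e\<in>exponents q. (of_rat e * coef q e) *s c (\<mu> + of_rat e + 1) K)
         = Sum_any (\<lambda>m::int. local_coeff B p m *v c (\<mu> - of_int m) K)"
        using hor unfolding horizontal_def by blast
      have "(\<Sum>e\<in>exponents q. (of_rat e * coef q e) *s c (\<mu> + of_rat e + 1) K)
         = (\<Sum>e\<in>exponents q. (of_rat e * coef q e) *s s (J + \<lfloor>e * of_nat r\<rfloor>))"
        by (intro sum.cong refl) (simp add: s3)
      hence "(\<mu> + 1) *s s J - (\<Sum>e\<in>exponents q. (of_rat e * coef q e) *s s (J + \<lfloor>e * of_nat r\<rfloor>)) = Sum_any v"
        using hor' by (simp add: s1 s2 K1 v_def[abs_def])
      hence hor'': "of_nat r * Sum_any v $ i
        = of_nat r * ((\<mu> + 1) * s J $ i) - (\<Sum>e\<in>exponents q. of_nat r * (of_rat e * coef q e * s (J + \<lfloor>e * of_nat r\<rfloor>) $ i))"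
        by (subst (asm) eq_commute) (simp add: right_diff_distrib sum_distrib_left distrib_left distrib_right)
      have "fls_X * fls_deriv (expand_factor r fls_X q)
        = (\<Sum>e\<in>exponents q. fls_const (- of_int \<lfloor>e * of_nat r\<rfloor> * coef q e) * fls_X_intpow (- \<lfloor>e * of_nat r\<rfloor>))"
      proof -
        have "fls_X * fls_deriv (fls_const k * fls_X powi n) = fls_const (of_int n * k) * fls_X_intpow n" for k :: complex and n
        proof -
          have "fls_nth (fls_X * fls_deriv (fls_const k * fls_X powi n)) m = fls_nth (fls_const (of_int n * k) * fls_X_intpow n) m" for m
            by (simp add: fls_X_times_conv_shift(1))
          thus ?thesis by (intro fls_eqI)
        qed
        thus ?thesis
          unfolding expand_factor_def fls_deriv_sum sum_distrib_left
          by (intro sum.cong refl) (metis of_int_minus)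
      qed
      have "fls_nth (fls_X * fls_deriv (expand_factor r fls_X q) * w $ i) J
        = (\<Sum>e\<in>exponents q. - of_int \<lfloor>e * of_nat r\<rfloor> * coef q e * s (J + \<lfloor>e * of_nat r\<rfloor>) $ i)"
      proof -
        have "fls_nth (fls_const k * fls_X_intpow n * w $ i) J = k * s (J - n) $ i" for k n
          by (simp only: mult.assoc fls_X_intpow_times_conv_shift(1)) (simp add: w)
        note this[of _ "- _"]
        thus ?thesis
          unfolding \<open>fls_X * fls_deriv (expand_factor r fls_X q) = _\<close> sum_distrib_right fls_nth_sum by simp
      qed
      also have "\<dots> = - (\<Sum>e\<in>exponents q. of_nat r * (of_rat e * coef q e * s (J + \<lfloor>e * of_nat r\<rfloor>) $ i))"
      proof -
        have "(of_int \<lfloor>e * of_nat r\<rfloor> :: complex) = of_rat e * of_nat r" if "e \<in> exponents q" for e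
          by (metis clears_denominators_floor[OF r(2) that] of_rat_of_int_eq of_rat_mult of_rat_of_nat_eq)
        thus ?thesis by (simp add: sum_negf mult_ac)
      qed
      finally have lhs: "fls_nth (fls_X * fls_deriv (expand_factor r fls_X q) * w $ i) J
        = - (\<Sum>e\<in>exponents q. of_nat r * (of_rat e * coef q e * s (J + \<lfloor>e * of_nat r\<rfloor>) $ i))" .
      have "of_nat r * (\<mu> + 1) = of_int J + of_nat r * \<mu>0" using r(1) by (simp add: \<mu>_def field_simps)
      hence r\<mu>: "of_nat r * ((\<mu> + 1) * s J $ i) = (of_int J + of_nat r * \<mu>0) * s J $ i"
        by (simp only: mult.assoc[symmetric])
      have "fls_nth (fls_X * fls_deriv (w $ i)) J = of_int J * s J $ i"
        by (simp add: fls_X_times_conv_shift(1) w)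
      moreover have "fls_nth (fls_const (of_nat r * \<mu>0) * w $ i) J = of_nat r * \<mu>0 * s J $ i" by (simp add: w)
      ultimately have L: "fls_nth (fls_X * fls_deriv (w $ i) + (fls_const (of_nat r * \<mu>0) + fls_X * fls_deriv (expand_factor r fls_X q)) * w $ i) J
        = of_int J * s J $ i + (of_nat r * \<mu>0 * s J $ i
          + - (\<Sum>e\<in>exponents q. of_nat r * (of_rat e * coef q e * s (J + \<lfloor>e * of_nat r\<rfloor>) $ i)))"
        by (simp only: distrib_right fls_plus_nth lhs)
      show "fls_nth (fls_X * fls_deriv (w $ i) + (fls_const (of_nat r * \<mu>0) + fls_X * fls_deriv (expand_factor r fls_X q)) * w $ i) J
        = fls_nth (\<Sum>j\<in>UNIV. reduced_matrix (local_matrix B p) r $ i $ j * w $ j) J"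
        unfolding L rhs[unfolded M_def] hor'' r\<mu> by (simp add: distrib_right)
    qed
    with w0 show ?thesis by blast
  qed
  show ?thesis
  proof (rule that[of "ram q"])
    fix r assume "0 < r" "ram q dvd r"
    hence "clears_denominators r q"
      using clears_denominators_mult[OF clears_denominators_ram, of _ q] by (elim dvdE) simp
    thus "clears_denominators r q \<and>
       (\<exists>\<nu> w. w \<noteq> 0 \<and> reduced_section (reduced_matrix (local_matrix B p) r) r q \<nu> w)"
      using main \<open>0 < r\<close> by blast
  qed (rule ram_pos)
qed

lemma finite_exponential_factors:
  fixes B :: "complex \<Rightarrow> complex^('n::finite)^'n"
  shows "finite {q. exp_factor q \<and> (\<exists>c\<in>horizontal_sections B p q. c \<noteq> 0)}"
proof (rule ccontr)
  let ?S = "{q. exp_factor q \<and> (\<exists>c\<in>horizontal_sections B p q. c \<noteq> 0)}"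
  assume "infinite ?S"
  then obtain I where I: "I \<subseteq> ?S" "finite I" "card I = Suc (CARD('n))"
    using infinite_arbitrarily_large[OF \<open>infinite ?S\<close>, of "Suc (CARD('n))"] by blast
  define R where "R = (\<lambda>r q \<nu> w. w \<noteq> 0 \<and> reduced_section (reduced_matrix (local_matrix B p) r) r q \<nu> w)"
  define P where "P = (\<lambda>q r\<^sub>0. 0 < r\<^sub>0 \<and> (\<forall>r>0. r\<^sub>0 dvd r \<longrightarrow> clears_denominators r q \<and> (\<exists>\<nu> w. R r q \<nu> w)))"
  have "\<exists>r\<^sub>0. P q r\<^sub>0" if q: "q \<in> I" for q
  proof -
    obtain c where c: "c \<in> horizontal_sections B p q" "c \<noteq> 0" using q I(1) by blast
    obtain r\<^sub>0 where "0 < r\<^sub>0" "\<And>r. 0 < r \<Longrightarrow> r\<^sub>0 dvd r \<Longrightarrow> clears_denominators r q \<and>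
       (\<exists>\<nu> w. w \<noteq> 0 \<and> reduced_section (reduced_matrix (local_matrix B p) r) r q \<nu> w)"
      by (rule exists_reduced_section[OF c], rule that)
    thus ?thesis unfolding P_def R_def by blast
  qed
  then obtain \<rho> where \<rho>: "\<And>q. q \<in> I \<Longrightarrow> P q (\<rho> q)" by metis
  \<comment> \<open>Each q allows every positive multiple of its own denominator, so the product is
    a cover for all of I at once.\<close>
  define r where "r = (\<Prod>q\<in>I. \<rho> q)"
  have r: "0 < r" unfolding r_def using \<rho> by (intro prod_pos) (auto simp: P_def)
  have dvd: "\<rho> q dvd r" if "q \<in> I" for q unfolding r_def by (rule dvd_prodI[OF I(2) that])
  have cR: "clears_denominators r q" "\<exists>\<nu> w. R r q \<nu> w" if "q \<in> I" for q
    using \<rho>[OF that] dvd[OF that] r unfolding P_def by blast+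
  then obtain \<nu> w where w: "\<And>q. q \<in> I \<Longrightarrow> R r q (\<nu> q) (w q)" by metis
  have "card I \<le> CARD('n)"
  proof (rule card_reduced_sections_le[OF I(2)])
    fix q assume "q \<in> I"
    thus "exp_factor q \<and> clears_denominators r q \<and> w q \<noteq> 0
        \<and> reduced_section (reduced_matrix (local_matrix B p) r) r q (\<nu> q) (w q)"
      using w[unfolded R_def] cR(1) I(1) by blast
  qed
  thus False using I(3) by simp
qed

section \<open>Generic transformations\<close>

text \<open>The last condition says that the leading vector of (Z, \<Xi>) is not sent to the
  vertical direction. Then z keeps the negative order n, which places the circle at infinity, and
  \<xi> has no deeper pole.\<close>

lemma flat_word_circleI:
  assumes R: "represents c Z \<Xi>" and gs: "\<forall>g\<in>set gs. valid_elementary g"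
    and o: "order_ge Z n" "order_ge \<Xi> n" "n < 0"
    and nz: "word_matrix gs $ 2 $ 2 * fls_nth Z n - word_matrix gs $ 2 $ 1 * fls_nth \<Xi> n \<noteq> 0"
  shows "flat (word_circle gs c)"
proof -
  define A where "A = word_matrix gs"
  define z \<xi> where "z = act_Z A Z \<Xi>" and "\<xi> = act_\<Xi> A Z \<Xi>"
  have oz: "order_ge z n" "order_ge \<xi> n"
    unfolding z_def \<xi>_def act_Z_def act_\<Xi>_def by (rule order_ge_diff; rule order_ge_const_mult; rule o)+
  have "fls_nth z n \<noteq> 0" using nz by (simp add: z_def act_Z_def A_def)
  hence sz: "fls_subdegree z = n" using subdegree_eq_iff_order_ge oz(1) by blast
  obtain p q where pq: "word_circle gs c = circle_of p q" "parametrizes p q z \<xi>"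
    using represents_word[OF R gs] unfolding represents_def z_def \<xi>_def A_def by blast
  have "p = Infty"
  proof (cases p)
    case (Aff a)
    obtain N s where N: "clears_denominators N q" "fls_subdegree s = 1" "z = expand_coordinate p N s"
      using parametrizes_normal_form[OF pq(2)] by blast
    have "order_ge (z - fls_const a) 0"
      using subdegree_expand_coordinate[of p N s] N Aff by (simp add: order_ge_iff)
    from order_ge_add[OF this order_ge_const[of a]] have "order_ge z 0" by simp
    thus ?thesis using sz o(3) by (auto simp: order_ge_iff)
  qed
  moreover from this have "slope q \<le> 2"
    using parametrizes_slope_le_2_iff[of q z \<xi>] pq(2) oz(2) sz by simp
  ultimately show ?thesis using pq(1) flat_circle_of by simp
qed

text \<open>For a flat circle this is the leading ratio of \<Xi> to Z: twice the coefficient of z^2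
  in q, and 0 if the slope is below 2.\<close>

definition circle_direction :: "circle \<Rightarrow> complex" where
  "circle_direction c = fls_nth (std_\<Xi> (circle_ram c) (a_representative c)) (- int (circle_ram c))"

text \<open>For circles that are not flat, \<Xi> dominates Z, so the single condition on the lower
  left entry handles them all, however many there are. Only flat circles impose conditions of their
  own.\<close>

lemma flat_word_circle:
  assumes c: "is_circle c" and gs: "\<forall>g\<in>set gs. valid_elementary g"
    and A: "word_matrix gs $ 2 $ 1 \<noteq> 0"
      "flat c \<Longrightarrow> word_matrix gs $ 2 $ 2 - word_matrix gs $ 2 $ 1 * circle_direction c \<noteq> 0"
  shows "flat (word_circle gs c)"
proof (cases "flat c")
  case True
  define q R where "q = a_representative c" and "R = ram q"
  have q: "q \<in> snd c" unfolding q_def using c by (rule is_circle_a_representative)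
  have cq: "c = circle_of Infty q" "exp_factor q" "slope q \<le> 2"
    using is_circle_member[OF c q] True q by (auto simp: flat_def)
  have cl: "clears_denominators R q" unfolding R_def by (rule clears_denominators_ram)
  have R0: "0 < R" unfolding R_def by (rule ram_pos)
  have rep: "represents c (std_Z R) (std_\<Xi> R q)"
    unfolding cq(1) using cq(2) cl by (rule represents_std)
  have "circle_direction c = fls_nth (std_\<Xi> R q) (- int R)"
    by (simp add: circle_direction_def circle_ram_def q_def R_def)
  hence nz: "word_matrix gs $ 2 $ 2 * fls_nth (std_Z R) (- int R) - word_matrix gs $ 2 $ 1 * fls_nth (std_\<Xi> R q) (- int R) \<noteq> 0"
    using A(2)[OF True] by (simp add: std_Z)
  show ?thesis
    by (rule flat_word_circleI[OF rep gs _ order_ge_std_\<Xi>[OF cq(2) cl cq(3)] _ nz])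
      (simp_all add: order_ge_iff std_Z R0)
next
  case False
  obtain Z \<Xi> where R: "represents c Z \<Xi>" using is_circle_represents[OF c] by blast
  then obtain p q where pq: "c = circle_of p q" "parametrizes p q Z \<Xi>"
    and res: "fls_nth (\<Xi> * fls_deriv Z) (-1) \<noteq> 0"
    unfolding represents_def nondegenerate_def by blast
  obtain N s where N: "clears_denominators N q" "fls_subdegree s = 1" "Z = expand_coordinate p N s"
    using parametrizes_normal_form[OF pq(2)] by blast
  have N0: "0 < N" using N(1) by (rule clears_denominators_pos)
  have "\<Xi> \<noteq> 0 \<and> fls_subdegree \<Xi> < 0 \<and> order_ge Z (fls_subdegree \<Xi> + 1)"
  proof (cases p)
    case (Aff a)
    have "order_ge (Z - fls_const a) 0"
      using subdegree_expand_coordinate[of p N s] N Aff by (simp add: order_ge_iff)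
    from order_ge_add[OF this order_ge_const[of a]] have Z: "order_ge Z 0" by simp
    \<comment> \<open>The nonzero residue forces a pole of \<Xi> even on a tame circle.\<close>
    have "\<not> order_ge \<Xi> 0"
    proof
      assume \<Xi>: "order_ge \<Xi> 0"
      have "order_ge (fls_deriv Z) 0"
        using subdegree_expand_coordinate[of p N s] deriv_expand_coordinate[of N s p] N N0 Aff
        by (auto simp: order_ge_iff)
      from order_ge_mult[OF \<Xi> this] show False using res by (simp add: order_ge_def)
    qed
    hence "\<Xi> \<noteq> 0" "fls_subdegree \<Xi> < 0" by (auto simp: order_ge_iff)
    thus ?thesis using order_ge_mono[OF Z] by simp
  next
    case Infty
    have sZ: "fls_subdegree Z = - int N"
      using subdegree_expand_coordinate[of Infty N s] N Infty by simp
    have "\<not> slope q \<le> 2" using False flat_circle_of pq(1) Infty by simp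
    hence "\<not> order_ge \<Xi> (fls_subdegree Z)" using parametrizes_slope_le_2_iff pq(2) Infty by simp
    hence "\<Xi> \<noteq> 0" "fls_subdegree \<Xi> < fls_subdegree Z" by (auto simp: order_ge_iff)
    thus ?thesis using sZ N0 by (auto simp: order_ge_iff)
  qed
  hence n: "\<Xi> \<noteq> 0" "fls_subdegree \<Xi> < 0" "order_ge Z (fls_subdegree \<Xi> + 1)" by blast+
  have "fls_nth Z (fls_subdegree \<Xi>) = 0" using n(3) by (simp add: order_ge_def)
  moreover have "fls_nth \<Xi> (fls_subdegree \<Xi>) \<noteq> 0" using n(1) by simp
  ultimately have nz: "word_matrix gs $ 2 $ 2 * fls_nth Z (fls_subdegree \<Xi>)
      - word_matrix gs $ 2 $ 1 * fls_nth \<Xi> (fls_subdegree \<Xi>) \<noteq> 0"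
    using A(1) by (simp only: mult_zero_right diff_0 neg_equal_0_iff_equal mult_eq_0_iff) simp
  show ?thesis
    by (rule flat_word_circleI[OF R gs order_ge_mono[OF n(3)] _ n(2) nz]) (simp_all add: order_ge_iff)
qed

section \<open>Density of the generic transformations\<close>

lemma finite_affine_zeros:
  fixes a b :: complex
  assumes "a \<noteq> 0 \<or> b \<noteq> 0"
  shows "finite {s. a + s * b = 0}"
proof (cases "b = 0")
  case False
  hence "{s. a + s * b = 0} \<subseteq> {- a / b}" by (auto simp: field_simps add_eq_0_iff2 add_eq_0_iff)
  thus ?thesis using finite_subset by blast
qed (use assms in simp)

text \<open>Adding s times the first row to the second stays in \<open>SL2\<close>, and each
  direction in P becomes vertical for at most one s because A is injective. So arbitrarily small s
  avoid all of P.\<close>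

lemma SL2_subset_closure:
  assumes P: "finite P" "\<And>u v. (u, v) \<in> P \<Longrightarrow> u \<noteq> 0 \<or> v \<noteq> 0"
  shows "SL2 \<subseteq> closure {A\<in>SL2. \<forall>(u, v)\<in>P. A $ 2 $ 2 * u - A $ 2 $ 1 * v \<noteq> 0}" (is "_ \<subseteq> closure ?X")
proof
  fix A assume A: "A \<in> SL2"
  hence det: "A $ 1 $ 1 * A $ 2 $ 2 - A $ 1 $ 2 * A $ 2 $ 1 = 1" by (simp add: SL2_def det_2)
  define f :: "complex \<Rightarrow> complex^2^2" where
    "f s = (\<chi> i j. if i = 2 then A $ 2 $ j + s * A $ 1 $ j else A $ i $ j)" for s
  have f: "f s $ 1 $ j = A $ 1 $ j" "f s $ 2 $ j = A $ 2 $ j + s * A $ 1 $ j" for s j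
    by (simp_all add: f_def)
  have f0: "f 0 = A" by (simp add: f_def Finite_Cartesian_Product.vec_eq_iff)
  define bad where "bad = (\<Union>(u, v)\<in>P. {s. (A $ 2 $ 2 * u - A $ 2 $ 1 * v) + s * (A $ 1 $ 2 * u - A $ 1 $ 1 * v) = 0})"
  have "finite bad"
    unfolding bad_def
  proof (intro finite_UN_I P(1); clarify)
    fix u v assume uv: "(u, v) \<in> P"
    have "A $ 2 $ 2 * u - A $ 2 $ 1 * v \<noteq> 0 \<or> A $ 1 $ 2 * u - A $ 1 $ 1 * v \<noteq> 0"
    proof (rule ccontr)
      assume "\<not> ?thesis"
      hence 0: "A $ 2 $ 2 * u - A $ 2 $ 1 * v = 0" "A $ 1 $ 2 * u - A $ 1 $ 1 * v = 0" by auto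
      \<comment> \<open>Solving the two linear equations for (u, v) with determinant 1 would give
        the excluded zero vector.\<close>
      have "u = A $ 1 $ 1 * (A $ 2 $ 2 * u - A $ 2 $ 1 * v) - A $ 2 $ 1 * (A $ 1 $ 2 * u - A $ 1 $ 1 * v)"
        using arg_cong[OF det, of "\<lambda>x. x * u"] by (simp add: algebra_simps)
      moreover have "v = A $ 1 $ 2 * (A $ 2 $ 2 * u - A $ 2 $ 1 * v) - A $ 2 $ 2 * (A $ 1 $ 2 * u - A $ 1 $ 1 * v)"
        using arg_cong[OF det, of "\<lambda>x. x * v"] by (simp add: algebra_simps)
      ultimately show False using P(2)[OF uv] unfolding 0 by simp
    qed
    thus "finite {s. (A $ 2 $ 2 * u - A $ 2 $ 1 * v) + s * (A $ 1 $ 2 * u - A $ 1 $ 1 * v) = 0}"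
      by (rule finite_affine_zeros)
  qed
  hence "closure (- bad) = UNIV" by (simp add: closure_complement empty_interior_finite)
  moreover have "continuous_on UNIV f"
  proof -
    have "continuous_on UNIV (\<lambda>s. if b then x + s * y else z)" for b and x y z :: complex
      by (cases b) (auto intro!: continuous_intros)
    thus "continuous_on UNIV f" unfolding f_def by (intro continuous_on_vec_lambda)
  qed
  hence "f ` closure (- bad) \<subseteq> closure (f ` (- bad))"
    by (intro image_closure_subset[OF continuous_on_subset] closed_closure closure_subset) auto
  ultimately have "f 0 \<in> closure (f ` (- bad))" by blast
  hence "A \<in> closure (f ` (- bad))" unfolding f0 .
  moreover have "f ` (- bad) \<subseteq> ?X"
  proof (rule image_subsetI)
    fix s assume s: "s \<in> - bad"
    have "f s \<in> SL2" using det by (simp add: SL2_def det_2 f algebra_simps)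
    moreover have "f s $ 2 $ 2 * u - f s $ 2 $ 1 * v \<noteq> 0" if "(u, v) \<in> P" for u v
    proof
      assume "f s $ 2 $ 2 * u - f s $ 2 $ 1 * v = 0"
      hence "(A $ 2 $ 2 * u - A $ 2 $ 1 * v) + s * (A $ 1 $ 2 * u - A $ 1 $ 1 * v) = 0"
        by (simp add: f algebra_simps)
      thus False using s that unfolding bad_def by blast
    qed
    ultimately show "f s \<in> ?X" by blast
  qed
  hence "closure (f ` (- bad)) \<subseteq> closure ?X" by (rule closure_mono)
  ultimately show "A \<in> closure ?X" by (rule rev_subsetD)
qed

section \<open>Active circles, their images and the resulting diagrams\<close>

lemma fs_dim_eq_0: "V \<subseteq> {0} \<Longrightarrow> fs.dim V = 0"
proof -
  assume "V \<subseteq> {0}"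
  hence "fs.span V = fs.span {}" by (auto dest: subset_singletonD)
  thus ?thesis using fs.dim_eq_card[of "{}" V] fs.independent_empty by simp
qed

definition modified_active :: "(complex \<Rightarrow> complex^('n::finite)^'n) \<Rightarrow> circle set" where
  "modified_active B = {c. is_circle c \<and> modified_multiplicity B c \<noteq> 0}"

text \<open>At infinity the data are unmodified, so nonzero multiplicity yields a nonzero horizontal
  section, and only finitely many factors admit one.\<close>

lemma finite_modified_active_Infty: "finite {c\<in>modified_active B. fst c = Infty}"
proof -
  let ?Q = "{q. exp_factor q \<and> (\<exists>c\<in>horizontal_sections B Infty q. c \<noteq> 0)}"
  have "{c\<in>modified_active B. fst c = Infty} \<subseteq> circle_of Infty ` ?Q"
  proof
    fix c assume c: "c \<in> {c\<in>modified_active B. fst c = Infty}"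
    define q where "q = a_representative c"
    have ic: "is_circle c" and m: "fs.dim (modified_space B (fst c) q) \<noteq> 0" and p: "fst c = Infty"
      using c by (auto simp: modified_active_def modified_multiplicity_def q_def)
    have q: "q \<in> snd c" unfolding q_def using ic by (rule is_circle_a_representative)
    have "\<not> modified_space B Infty q \<subseteq> {0}" using m p fs_dim_eq_0 by metis
    hence "q \<in> ?Q" using is_circle_member(1)[OF ic q] by (auto simp: modified_space_def)
    thus "c \<in> circle_of Infty ` ?Q" using is_circle_member(2)[OF ic q] p by auto
  qed
  thus ?thesis using finite_exponential_factors finite_surj by blast
qed

text \<open>As minimal polynomial degrees survive transport, leg lengths are stated with the
  original classes. The images under two different words thus carry the same index set.\<close>

lemma sl2_acts_word:
  fixes B :: "complex \<Rightarrow> complex^('n::finite)^'n"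
  assumes "sl2_acts A (modified_formal_data B) D"
  obtains gs where "\<forall>g\<in>set gs. valid_elementary g" "word_matrix gs = A"
    "active_circles D = word_circle gs ` modified_active B"
    "nodes (diagram_infinity D) = (\<lambda>(c, i). (word_circle gs c, i)) `
       {(c, i). c \<in> modified_active B \<and> 1 \<le> i \<and> i \<le> class_minpoly_degree (modified_class B c)}"
proof -
  from assms obtain gs where gs: "\<forall>g\<in>set gs. valid_elementary g" "word_matrix gs = A"
    and D: "D = foldr elementary_data gs (modified_formal_data B)"
    unfolding sl2_acts_def word_matrix_def by blast
  have D': "(x, n, C) \<in> D \<longleftrightarrow> (\<exists>c. is_circle c \<and> x = word_circle gs c \<and> n = modified_multiplicity B c
      \<and> C = word_class gs c (modified_class B c))" for x n C
    unfolding D foldr_elementary_data modified_formal_data_def by (auto simp: image_iff)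
  have deg: "class_minpoly_degree (word_class gs c (modified_class B c)) = class_minpoly_degree (modified_class B c)" for c
    using word_class_invariants[OF invertible_class_modified] by blast
  have "active_circles D = word_circle gs ` modified_active B"
    unfolding active_circles_def D' modified_active_def by auto
  moreover have "nodes (diagram_infinity D) = (\<lambda>(c, i). (word_circle gs c, i)) `
       {(c, i). c \<in> modified_active B \<and> 1 \<le> i \<and> i \<le> class_minpoly_degree (modified_class B c)}"
    (is "?L = ?R")
  proof (intro equalityI subsetI)
    fix u assume "u \<in> ?L"
    then obtain x i n C where u: "u = (x, i)" "(x, n, C) \<in> D" "n \<noteq> 0" "1 \<le> i" "i \<le> class_minpoly_degree C"
      by (auto simp: diagram_infinity_def)
    then obtain c where "is_circle c" "x = word_circle gs c" "n = modified_multiplicity B c"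
      "C = word_class gs c (modified_class B c)" unfolding D' by blast
    with u show "u \<in> ?R" by (intro image_eqI[of _ _ "(c, i)"]) (simp_all add: deg modified_active_def)
  next
    fix u assume "u \<in> ?R"
    then obtain c i where u: "u = (word_circle gs c, i)" "c \<in> modified_active B" "1 \<le> i"
      "i \<le> class_minpoly_degree (modified_class B c)" by auto
    hence "(word_circle gs c, modified_multiplicity B c, word_class gs c (modified_class B c)) \<in> D"
      unfolding D' modified_active_def by blast
    with u show "u \<in> ?L" using deg[of c] unfolding diagram_infinity_def modified_active_def by force
  qed
  ultimately show ?thesis using that gs by blast
qed

text \<open>The relabelling takes the image of an active circle under one word to its image under
  the other. It is itself induced by a word, \<open>gs' @ hs\<close>, acting between flat circles,
  so \<open>circle_B_word\<close> yields the edges.\<close>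

lemma diagram_iso_if_flat:
  fixes B :: "complex \<Rightarrow> complex^('n::finite)^'n"
  assumes D: "sl2_acts A (modified_formal_data B) D" "sl2_acts A' (modified_formal_data B) D'"
    and fl: "\<And>c. c \<in> active_circles D \<Longrightarrow> flat c" "\<And>c. c \<in> active_circles D' \<Longrightarrow> flat c"
  shows "diagram_iso (diagram_infinity D) (diagram_infinity D')"
proof -
  define N where "N = {(c, i). c \<in> modified_active B \<and> (1::nat) \<le> i \<and> i \<le> class_minpoly_degree (modified_class B c)}"
  obtain gs where gs: "\<forall>g\<in>set gs. valid_elementary g"
    and act: "active_circles D = word_circle gs ` modified_active B"
    and nodes: "nodes (diagram_infinity D) = (\<lambda>(c, i). (word_circle gs c, i)) ` N"
    by (rule sl2_acts_word[OF D(1), folded N_def], rule that)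
  obtain gs' where gs': "\<forall>g\<in>set gs'. valid_elementary g"
    and act': "active_circles D' = word_circle gs' ` modified_active B"
    and nodes': "nodes (diagram_infinity D') = (\<lambda>(c, i). (word_circle gs' c, i)) ` N"
    by (rule sl2_acts_word[OF D(2), folded N_def], rule that)
  obtain hs where hs: "\<forall>g\<in>set hs. valid_elementary g"
    and inv: "\<And>c. is_circle c \<Longrightarrow> word_circle hs (word_circle gs c) = c"
    by (rule exists_inverse_word[OF gs], rule that)
  define k where "k = gs' @ hs"
  have k: "\<forall>g\<in>set k. valid_elementary g" using gs' hs by (auto simp: k_def)
  have circ: "is_circle c" if "c \<in> modified_active B" for c using that by (simp add: modified_active_def)
  have W: "word_circle k (word_circle gs c) = word_circle gs' c" if "c \<in> modified_active B" for c
    using inv[OF circ[OF that]] by (simp add: k_def word_circle_append)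
  have inj: "word_circle gs' c = word_circle gs' c' \<longleftrightarrow> c = c'" "word_circle gs c = word_circle gs c' \<longleftrightarrow> c = c'"
    if "c \<in> modified_active B" "c' \<in> modified_active B" for c c'
    using word_circle_inj circ that gs gs' by blast+
  have BB: "circle_B (word_circle gs' c) (word_circle gs' c') = circle_B (word_circle gs c) (word_circle gs c')"
    if "c \<in> modified_active B" "c' \<in> modified_active B" for c c'
  proof -
    have "circle_B (word_circle k (word_circle gs c)) (word_circle k (word_circle gs c')) = circle_B (word_circle gs c) (word_circle gs c')"
    proof (rule circle_B_word)
      show "is_circle (word_circle gs c)" "is_circle (word_circle gs c')"
        using is_circle_word circ that gs by blast+
      show "flat (word_circle gs c)" "flat (word_circle gs c')" using fl(1) act that by blast+
      show "flat (word_circle k (word_circle gs c))" "flat (word_circle k (word_circle gs c'))"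
        using fl(2) act' that by (simp_all add: W)
    qed (rule k)
    thus ?thesis by (simp add: W that)
  qed
  define f where "f = (\<lambda>(x, i :: nat). (word_circle k x, i))"
  have f: "f (word_circle gs c, i) = (word_circle gs' c, i)" if "c \<in> modified_active B" for c i
    using that by (simp add: f_def W)
  have NA: "c \<in> modified_active B" if "(c, i) \<in> N" for c i using that by (simp add: N_def)
  have "bij_betw f (nodes (diagram_infinity D)) (nodes (diagram_infinity D'))"
    unfolding bij_betw_def
  proof
    show "inj_on f (nodes (diagram_infinity D))"
      unfolding nodes inj_on_def using f NA inj by auto
    show "f ` nodes (diagram_infinity D) = nodes (diagram_infinity D')"
      unfolding nodes nodes' image_image using f NA by (intro image_cong) auto
  qed
  moreover have "f ` core (diagram_infinity D) = core (diagram_infinity D')"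
  proof -
    have core: "core (diagram_infinity E) = (\<lambda>c. (c, 1)) ` active_circles E" for E
      by (auto simp: diagram_infinity_def)
    show ?thesis unfolding core act act' image_image using f by (intro image_cong) auto
  qed
  moreover have "edge_mult (diagram_infinity D') (f u) (f v) = edge_mult (diagram_infinity D) u v"
    if u: "u \<in> nodes (diagram_infinity D)" and v: "v \<in> nodes (diagram_infinity D)" for u v
  proof -
    obtain c i where c: "u = (word_circle gs c, i)" "c \<in> modified_active B" using u NA unfolding nodes by auto
    obtain c' j where c': "v = (word_circle gs c', j)" "c' \<in> modified_active B" using v NA unfolding nodes by auto
    show ?thesis
      unfolding c(1) c'(1) f[OF c(2)] f[OF c'(2)] diagram_infinity_def
      by (simp add: BB[OF c(2) c'(2)] inj[OF c(2) c'(2)])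
  qed
  ultimately show ?thesis unfolding diagram_iso_def by blast
qed

theorem theorem5p1:
  fixes S :: "complex set" and B :: "complex \<Rightarrow> complex^'n^'n"
  assumes "algebraic_connection S B"
    and "irreducible_connection S B"
    and "\<not> (CARD('n) = 1 \<and> (\<forall>a. \<not> singular_at B (Aff a)) \<and>
            (\<forall>q. exp_factor q \<and> horizontal_sections B Infty q \<noteq> {0} \<longrightarrow> slope q < 2))"
  shows "\<exists>X. openin (top_of_set SL2) X \<and> SL2 \<subseteq> closure X \<and>
    (\<forall>A\<in>X. \<forall>D. sl2_acts A (modified_formal_data B) D \<longrightarrow> support_at_infinity D) \<and>
    (\<forall>A\<in>X. \<forall>A'\<in>X. \<forall>D D'.
       sl2_acts A (modified_formal_data B) D \<longrightarrow> sl2_acts A' (modified_formal_data B) D' \<longrightarrow>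
       diagram_iso (diagram_infinity D) (diagram_infinity D'))"
proof -
  define L where "L = circle_direction ` {c\<in>modified_active B. fst c = Infty}"
  have L: "finite L" unfolding L_def by (intro finite_imageI finite_modified_active_Infty)
  \<comment> \<open>These are leading vectors of (Z, \<Xi>): (0, 1) is the vertical direction of all
    circles that are not flat, and the (1, l) include the directions of the flat active ones. X asks
    that their images have nonzero z-component.\<close>
  define P :: "(complex \<times> complex) set" where "P = insert (0, 1) ((\<lambda>l. (1, l)) ` L)"
  define X where "X = {A\<in>SL2. \<forall>(u, v)\<in>P. A $ 2 $ 2 * u - A $ 2 $ 1 * v \<noteq> 0}"
  have P: "finite P" "\<And>u v. (u, v) \<in> P \<Longrightarrow> u \<noteq> 0 \<or> v \<noteq> 0"
    using L by (auto simp: P_def)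
  have "X = SL2 \<inter> (\<Inter>(u, v)\<in>P. {A. A $ 2 $ 2 * u - A $ 2 $ 1 * v \<noteq> 0})"
    unfolding X_def by auto
  moreover have "open (\<Inter>(u, v)\<in>P. {A :: complex^2^2. A $ 2 $ 2 * u - A $ 2 $ 1 * v \<noteq> 0})"
    using P(1) by (intro open_INT) (auto intro!: open_Collect_neq continuous_intros)
  ultimately have "openin (top_of_set SL2) X" using openin_open by blast
  moreover have "SL2 \<subseteq> closure X" unfolding X_def by (rule SL2_subset_closure[OF P])
  moreover have fl: "flat c" if A: "A \<in> X" and D: "sl2_acts A (modified_formal_data B) D" and c: "c \<in> active_circles D" for A D c
  proof -
    obtain gs where gs: "\<forall>g\<in>set gs. valid_elementary g" "word_matrix gs = A"
      and act: "active_circles D = word_circle gs ` modified_active B"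
      by (rule sl2_acts_word[OF D], rule that)
    obtain c0 where c0: "c0 \<in> modified_active B" "c = word_circle gs c0" using c act by blast
    have "A $ 2 $ 1 \<noteq> 0" using A by (auto simp: X_def P_def)
    moreover have "A $ 2 $ 2 - A $ 2 $ 1 * circle_direction c0 \<noteq> 0" if "flat c0"
    proof -
      have "circle_direction c0 \<in> L" using that c0(1) by (auto simp: L_def flat_def)
      hence "(1, circle_direction c0) \<in> P" by (simp add: P_def)
      thus ?thesis using A unfolding X_def by fastforce
    qed
    moreover have "is_circle c0" using c0(1) by (simp add: modified_active_def)
    ultimately show ?thesis unfolding c0(2) using gs by (intro flat_word_circle) auto
  qed
  hence "\<forall>A\<in>X. \<forall>D. sl2_acts A (modified_formal_data B) D \<longrightarrow> support_at_infinity D"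
    unfolding support_at_infinity_def flat_def by blast
  moreover have "\<forall>A\<in>X. \<forall>A'\<in>X. \<forall>D D'.
       sl2_acts A (modified_formal_data B) D \<longrightarrow> sl2_acts A' (modified_formal_data B) D' \<longrightarrow>
       diagram_iso (diagram_infinity D) (diagram_infinity D')"
    using diagram_iso_if_flat fl by blast
  ultimately show ?thesis by blast
qed

end
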